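(* Let $X$ be a $\mathrm{GTGS}_\gamma(\alpha,\lambda,\theta,\delta;\mu)$ random variable on $\mathbb R$ with $\theta_+,\theta_->0$ and $\gamma_+,\gamma_-\ne1$. Then its cumulants $k^X_n$, $n\ge1$, are given by $$k_1^X=\mu_1+\mu,$$ $$k_n^X=\frac{\delta_+\Gamma(n-\gamma_+)}{\theta_+^{\,n-\gamma_+}}\,{}_2R_1\!\left(1,n-\gamma_+,1,\alpha_+;-\frac{\lambda_+}{\theta_+^{\alpha_+}}\right)+(-1)^n\frac{\delta_-\Gamma(n-\gamma_-)}{\theta_-^{\,n-\gamma_-}}\,{}_2R_1\!\left(1,n-\gamma_-,1,\alpha_-;-\frac{\lambda_-}{\theta_-^{\alpha_-}}\right),\quad n>1.$$ Let instead $Y$ be a $\mathrm{GTGS}^0_\gamma(\alpha,\lambda,\delta;\mu)$ random variable. Then $Y$ has finite expectation if and only if $\min\{\alpha_++\gamma_+,\alpha_-+\gamma_-\}>1$, and finite variance if and only if $\min\{\alpha_++\gamma_+,\alpha_-+\gamma_-\}>2$, in which cases $$E[Y]=\mu_1+\mu,\qquad \mathrm{Var}[Y]=\delta_+\,\ell(\gamma_+-2,\alpha_+,\lambda_+)+\delta_-\,\ell(\gamma_--2,\alpha_-,\lambda_-)$$ respectively. Here $\mu_1=\int_{\{|x|>1\}}x\,m(x)\,dx$ with $m$ the L\'evy density of the variable under consideration ($X$ or $Y$), and $$\ell(x,y,w)=w^{x/y}\,\frac{\pi}{\sin(-\pi x/y)}\,\frac{1}{y\,\Gamma(1+x)}.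$$
   Context: For $a\in(0,1]$, $E_a(z)=\sum_{k\ge0}z^k/\Gamma(ak+1)$ is the Mittag-Leffler function. Let $\alpha=(\alpha_+,\alpha_-)\in(0,1]^2$, $\lambda=(\lambda_+,\lambda_-)\in(0,\infty)^2$, $\theta=(\theta_+,\theta_-)\in[0,\infty)^2$, $\delta=(\delta_+,\delta_-)\in[0,\infty)^2\setminus\{(0,0)\}$, $\gamma=(\gamma_+,\gamma_-)\in[0,2)^2$, $\mu\in\mathbb R$. The law $\mathrm{GTGS}_\gamma(\alpha,\lambda,\theta,\delta;\mu)$ is the infinitely divisible law on $\mathbb R$ with L\'evy triplet $(\mu,0,m(x)dx)$, where $$m(x)=\delta_+\frac{e^{-\theta_+x}}{x^{1+\gamma_+}}E_{\alpha_+}(-\lambda_+x^{\alpha_+})\mathbf 1_{\{x>0\}}+\delta_-\frac{e^{-\theta_-|x|}}{|x|^{1+\gamma_-}}E_{\alpha_-}(-\lambda_-|x|^{\alpha_-})\mathbf 1_{\{x<0\}}.$$ That is, $E[e^{izX}]=e^{\psi_X(z)}$ with $\psi_X(z)=iz\mu+\int_{\mathbb R}(e^{izx}-1-izx\mathbf 1_{\{|x|<1\}})m(x)\,dx$. The class $\mathrm{GTGS}^0_\gamma(\alpha,\lambda,\delta;\mu)$ is the case $\theta_+=\theta_-=0$. The generalized hypergeometric function ${}_2R_1$ is given, for $\tau>0$, $a,b,c\in\mathbb C$, $c\notin\mathbb Z_{\le0}$, by $${}_2R_1(a,b,c,\tau;w)=\frac{\Gamma(c)}{\Gamma(b)}\sum_{k\ge0}\frac{(a)_k\Gamma(b+\tau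 k)}{\Gamma(c+\tau k)}\frac{w^k}{k!},\qquad (a)_k=\frac{\Gamma(a+k)}{\Gamma(a)},$$ for $|w|<1$ (the series converging absolutely for $|w|\le1$ when $\mathrm{Re}(c-b-a)>0$), and is extended analytically to $w\in\mathbb C\setminus[1,\infty)$.
   Formalization: The "if and only if" claims for Y are proved as printed when δ₊,δ₋>0 and α₊,α₋<1; in general only sides with δ>0 and α<1 must satisfy α+γ>1 (resp. >2), since the printed form fails e.g. for α₊=α₋=1, γ=0, where all moments are finite. *)

theory Defs
  imports "HOL-Probability.Probability"
begin

definition mittag_leffler :: "real \<Rightarrow> real \<Rightarrow> real" where
  "mittag_leffler a z = (\<Sum>k. z ^ k / Gamma (a * real k + 1))"

text \<open>Two-sided parameters are pairs: the first component governs the positive half-line,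
  the second one the negative half-line.\<close>

definition half_density :: "real \<Rightarrow> real \<Rightarrow> real \<Rightarrow> real \<Rightarrow> real \<Rightarrow> real \<Rightarrow> real" where
  "half_density g a l t d r =
     d * (exp (- t * r) / r powr (1 + g)) * mittag_leffler a (- l * r powr a)"

definition gtgs_density ::
  "real \<times> real \<Rightarrow> real \<times> real \<Rightarrow> real \<times> real \<Rightarrow> real \<times> real \<Rightarrow> real \<times> real \<Rightarrow> real \<Rightarrow> real" where
  "gtgs_density \<gamma> \<alpha> l \<theta> \<delta> x =
     half_density (fst \<gamma>) (fst \<alpha>) (fst l) (fst \<theta>) (fst \<delta>) x * indicator {0<..} x
   + half_density (snd \<gamma>) (snd \<alpha>) (snd l) (snd \<theta>) (snd \<delta>) \<bar>x\<bar> * indicator {..<0} x"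

text \<open>The characteristic exponent with drift \<open>\<mu>\<close>, no Gaussian part and Levy density \<open>m\<close>,
  for the truncation function \<open>x \<mapsto> x 1(|x| < 1)\<close>.\<close>

definition levy_exponent :: "real \<Rightarrow> (real \<Rightarrow> real) \<Rightarrow> real \<Rightarrow> complex" where
  "levy_exponent \<mu> m z = \<i> * of_real (z * \<mu>)
     + (CLINT x|lborel. (iexp (z * x) - 1 - \<i> * of_real (z * x * indicator {x. \<bar>x\<bar> < 1} x))
                        * of_real (m x))"

definition gtgs_rv ::
  "'a measure \<Rightarrow> ('a \<Rightarrow> real) \<Rightarrow> real \<times> real \<Rightarrow> real \<times> real \<Rightarrow> real \<times> real \<Rightarrow>
   real \<times> real \<Rightarrow> real \<times> real \<Rightarrow> real \<Rightarrow> bool" where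
  "gtgs_rv M X \<gamma> \<alpha> l \<theta> \<delta> \<mu> \<longleftrightarrow>
     prob_space M \<and> X \<in> borel_measurable M \<and>
     (\<forall>z. char (distr M borel X) z = exp (levy_exponent \<mu> (gtgs_density \<gamma> \<alpha> l \<theta> \<delta>) z))"

definition gtgs0_rv ::
  "'a measure \<Rightarrow> ('a \<Rightarrow> real) \<Rightarrow> real \<times> real \<Rightarrow> real \<times> real \<Rightarrow> real \<times> real \<Rightarrow>
   real \<times> real \<Rightarrow> real \<Rightarrow> bool" where
  "gtgs0_rv M X \<gamma> \<alpha> l \<delta> \<mu> \<longleftrightarrow> gtgs_rv M X \<gamma> \<alpha> l (0, 0) \<delta> \<mu>"

text \<open>The \<open>n\<close>-th cumulant \<open>(-i)^n (d/dt)^n log E[exp(itX)]\<close> at \<open>t = 0\<close>. The principal branch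
  \<open>Ln\<close> is adequate because the characteristic function is continuous with value 1 at 0. If the
  \<open>n\<close>-th absolute moment is not finite, the derivatives need not exist and the value may be
  meaningless.\<close>

definition cumulant :: "'a measure \<Rightarrow> ('a \<Rightarrow> real) \<Rightarrow> nat \<Rightarrow> complex" where
  "cumulant M X n =
     (- \<i>) ^ n * ((\<lambda>f t. vector_derivative f (at t)) ^^ n) (\<lambda>t. Ln (char (distr M borel X) t)) 0"

definition hyp_2R1_series ::
  "complex \<Rightarrow> complex \<Rightarrow> complex \<Rightarrow> real \<Rightarrow> complex \<Rightarrow> complex" where
  "hyp_2R1_series a b c \<tau> w = Gamma c / Gamma b *
     (\<Sum>k. pochhammer a k * Gamma (b + of_real (\<tau> * real k)) / Gamma (c + of_real (\<tau> * real k))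
           * (w ^ k / fact k))"

text \<open>The analytic extension is unique on the slit plane, so the choice operator is harmless
  there. On the slit only \<open>w = 1\<close> can be meaningful, where the series may still converge.\<close>

definition hyp_2R1 :: "complex \<Rightarrow> complex \<Rightarrow> complex \<Rightarrow> real \<Rightarrow> complex \<Rightarrow> complex" where
  "hyp_2R1 a b c \<tau> w =
     (if w \<in> - (complex_of_real ` {1..})
      then (SOME f. f holomorphic_on - (complex_of_real ` {1..}) \<and>
                    (\<forall>v\<in>ball 0 1. f v = hyp_2R1_series a b c \<tau> v)) w
      else hyp_2R1_series a b c \<tau> w)"

definition large_jump_mean :: "(real \<Rightarrow> real) \<Rightarrow> real" where
  "large_jump_mean m = (LINT x:{x. \<bar>x\<bar> > 1}|lborel. x * m x)"

definition ell :: "real \<Rightarrow> real \<Rightarrow> real \<Rightarrow> real" where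
  "ell x y w = w powr (x / y) * (pi / sin (- pi * x / y)) * (1 / (y * Gamma (1 + x)))"

text \<open>With \<open>\<theta> = 0\<close> and \<open>a < 1\<close> a half-density decays like \<open>r powr (- (1 + g + a))\<close>, so its \<open>n\<close>-th
  moment at infinity is finite iff \<open>a + g > n\<close>. A half-density with \<open>d = 0\<close> vanishes, and one
  with \<open>a = 1\<close> decays exponentially; neither imposes a condition.\<close>

definition tail_moment :: "real \<Rightarrow> real \<Rightarrow> real \<Rightarrow> nat \<Rightarrow> bool" where
  "tail_moment g a d n \<longleftrightarrow> (0 < d \<and> a < 1 \<longrightarrow> real n < a + g)"

end

theory Submission
  imports Defs "HOL-Complex_Analysis.Complex_Analysis" "HOL-Real_Asymp.Real_Asymp"
begin

text \<open>Both parts rest on reading moments off the exponent \<open>\<psi>\<close> of the law. With a Levy density \<open>m\<close> that has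
finite moments, \<open>\<psi>\<close> can be differentiated under the integral sign. This gives
\<open>\<psi>'(0) = \<i> (\<mu>\<^sub>1 + \<mu>)\<close> and, for \<open>n \<ge> 2\<close>, the \<open>n\<close>-th derivative \<open>\<i>\<^sup>n \<integral> x\<^sup>n m(x) dx\<close> at the origin.
Near the origin \<open>\<psi>\<close> is the logarithm of the characteristic function, so these numbers are the cumulants.
What remains is to know when moments are finite, and to evaluate the integrals.

Finiteness needs a passage from characteristic functions to moments. For even moments this is
Fatou's lemma applied to \<open>(1 - cos (h X)) / h\<^sup>2\<close> as \<open>h\<close> tends to \<open>0\<close>: a characteristic function that is twice
differentiable has a second moment, and induction gives all even moments
(\<open>integrable_even_power_of_times_differentiable\<close>). The same inequality, applied to the Levy measure
instead of the law, shows that a finite variance forces \<open>\<integral> x\<^sup>2 m(x) dx\<close> to be finite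
(\<open>square_integrable_of_X\<close>). A differentiable characteristic function need not come from an integrable
variable, so first moments are treated differently: integrating
\<open>(1 - cos (t x)) / t\<^sup>2\<close> over \<open>0 < t < 1\<close> gives a function of \<open>x\<close> comparable with \<open>\<bar>x\<bar>\<close> at infinity. By
Fubini, both \<open>E \<bar>X\<bar>\<close> and the first moment of the large jumps are finite exactly when an integral over \<open>t\<close> is,
and the two integrals over \<open>t\<close> are compared through \<open>\<phi> = exp \<psi>\<close> (\<open>large_integrable_of_X\<close>,
\<open>integrable_X_of_large_integrable\<close>).

The analytic input on the Mittag-Leffler function is that \<open>t \<mapsto> E\<^sub>a(- t\<^sup>a)\<close> is, for \<open>0 < a < 1\<close>, a mixture of
decreasing exponentials with an explicit positive kernel (\<open>mittag_leffler_eq_ml_mixture\<close>). Both sides have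
the Laplace transform \<open>p\<^sup>a\<^sup>-\<^sup>1 / (p\<^sup>a + 1)\<close>: the left one by termwise integration for \<open>p > 1\<close>, the right one
because its transform is a Stieltjes integral which the residue theorem evaluates
(\<open>nn_integral_ml_kernel_stieltjes\<close>); and the Laplace transform is injective. The representation yields
positivity, monotonicity, two-sided bounds of order \<open>t\<^sup>-\<^sup>a\<close>, which decide the tail conditions, and the Laplace
transform for every \<open>p > 0\<close>, from which the Mellin transform and hence the variance without tempering follow.

With tempering, the \<open>n\<close>-th moment of a half-density is the Laplace transform of
\<open>r\<^sup>b\<^sup>-\<^sup>1 E\<^sub>a(- l r\<^sup>a)\<close> with \<open>b = n - \<gamma>\<close>. Termwise integration identifies it with the hypergeometric series only
when \<open>l / \<theta>\<^sup>a < 1\<close>. For the remaining parameters one needs that the series has an analytic extension to the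
slit plane: it does for \<open>b \<le> 1\<close> by an Euler integral, and raising \<open>b\<close> by one is a first-order
differential operator. The identity theorem in the Laplace variable on the right half-plane then
extends the formula to all \<open>\<theta> > 0\<close> (\<open>laplace_mittag_leffler_hyp_2R1\<close>).\<close>

section \<open>Differentiation under the integral sign\<close>

text \<open>Dominated convergence of the difference quotients: the Lipschitz bound at \<open>t0\<close> and the bound on the
derivative dominate their error by \<open>2 h\<close>.\<close>

lemma has_derivative_lebesgue_integral:
  fixes f :: "'v::real_normed_vector \<Rightarrow> 'x \<Rightarrow> 'b::{banach, second_countable_topology}"
  assumes e: "0 < e"
    and int: "\<And>t. t \<in> ball t0 e \<Longrightarrow> integrable M (f t)"
    and int': "\<And>v. integrable M (\<lambda>x. D x v)"
    and der: "\<And>x. x \<in> space M \<Longrightarrow> ((\<lambda>t. f t x) has_derivative D x) (at t0)"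
    and lip: "\<And>t x. t \<in> ball t0 e \<Longrightarrow> x \<in> space M \<Longrightarrow> norm (f t x - f t0 x) \<le> h x * norm (t - t0)"
    and bnd: "\<And>v x. x \<in> space M \<Longrightarrow> norm (D x v) \<le> h x * norm v"
    and h: "integrable M h"
  shows "((\<lambda>t. LINT x|M. f t x) has_derivative (\<lambda>v. LINT x|M. D x v)) (at t0)"
proof -
  have lin: "linear (D x)" if "x \<in> space M" for x
    using der[OF that] by (simp add: has_derivative_bounded_linear bounded_linear.linear)
  have bl: "bounded_linear (\<lambda>v. LINT x|M. D x v)"
  proof (rule bounded_linear_intro)
    show "(LINT x|M. D x (u + v)) = (LINT x|M. D x u) + (LINT x|M. D x v)" for u v
      by (subst Bochner_Integration.integral_add[symmetric]) (auto intro!: int' Bochner_Integration.integral_cong simp: linear_add[OF lin])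
    show "(LINT x|M. D x (r *\<^sub>R v)) = r *\<^sub>R (LINT x|M. D x v)" for r v
    proof -
      have "(LINT x|M. D x (r *\<^sub>R v)) = (LINT x|M. r *\<^sub>R D x v)"
        by (intro Bochner_Integration.integral_cong refl) (simp add: linear_scale[OF lin])
      then show ?thesis by simp
    qed
    show "norm (LINT x|M. D x v) \<le> norm v * (LINT x|M. h x)" for v
    proof -
      have "norm (LINT x|M. D x v) \<le> (LINT x|M. norm (D x v))" by (rule integral_norm_bound)
      also have "\<dots> \<le> (LINT x|M. h x * norm v)"
        by (intro integral_mono integrable_norm int' integrable_mult_left h bnd)
      finally show ?thesis by (simp add: mult.commute)
    qed
  qed
  have t0: "t0 \<in> ball t0 e" using e by simp
  have "((\<lambda>y. norm ((LINT x|M. f y x) - (LINT x|M. f t0 x) - (LINT x|M. D x (y - t0))) / norm (y - t0)) \<longlongrightarrow> 0) (at t0)"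
    unfolding tendsto_at_iff_sequentially
  proof (intro allI impI)
    fix Y :: "nat \<Rightarrow> 'v" assume Y: "\<forall>i. Y i \<in> UNIV - {t0}" and lim: "Y \<longlonglongrightarrow> t0"
    then have "\<forall>\<^sub>F i in sequentially. Y i \<in> ball t0 e"
      using topological_tendstoD[OF lim open_ball t0] by simp
    then obtain N where N: "\<And>i. Y (i + N) \<in> ball t0 e"
      unfolding eventually_sequentially by (metis le_add2)
    define X where "X = (\<lambda>i. Y (i + N))"
    have X: "X i \<in> ball t0 e" "X i \<noteq> t0" for i using N Y unfolding X_def by auto
    have limX: "X \<longlonglongrightarrow> t0" unfolding X_def using lim by (rule LIMSEQ_ignore_initial_segment)
    define r where "r = (\<lambda>i x. norm (f (X i) x - f t0 x - D x (X i - t0)) / norm (X i - t0))"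
    have "(\<lambda>i. LINT x|M. r i x) \<longlonglongrightarrow> (LINT x|M. 0)"
    proof (rule integral_dominated_convergence)
      show "integrable M (\<lambda>x. 2 * h x)" using h by simp
      show "r i \<in> borel_measurable M" for i
        unfolding r_def using int[OF X(1)] int[OF t0] int' by (intro borel_measurable_divide borel_measurable_norm borel_measurable_diff) auto
      show "AE x in M. norm (r i x) \<le> 2 * h x" for i
      proof (rule AE_I2)
        fix x assume x: "x \<in> space M"
        have p: "norm (X i - t0) > 0" using X by simp
        have "norm (f (X i) x - f t0 x - D x (X i - t0)) \<le> norm (f (X i) x - f t0 x) + norm (D x (X i - t0))"
          by (rule norm_triangle_ineq4)
        also have "\<dots> \<le> 2 * h x * norm (X i - t0)"
          using add_mono[OF lip[OF X(1) x] bnd[OF x, of "X i - t0"]] by (simp only: mult_2 distrib_right)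
        finally show "norm (r i x) \<le> 2 * h x" unfolding r_def using p by (simp add: divide_le_eq)
      qed
      show "AE x in M. (\<lambda>i. r i x) \<longlonglongrightarrow> 0"
      proof (rule AE_I2)
        fix x assume x: "x \<in> space M"
        have "((\<lambda>y. norm (f y x - f t0 x - D x (y - t0)) / norm (y - t0)) \<longlongrightarrow> 0) (at t0)"
          using der[OF x] unfolding has_derivative_iff_norm by simp
        then have "((\<lambda>y. norm (f y x - f t0 x - D x (y - t0)) / norm (y - t0)) \<circ> X) \<longlonglongrightarrow> 0"
          unfolding tendsto_at_iff_sequentially using X limX by auto
        then show "(\<lambda>i. r i x) \<longlonglongrightarrow> 0" by (simp add: o_def r_def)
      qed
    qed simp
    then have R0: "(\<lambda>i. LINT x|M. r i x) \<longlonglongrightarrow> 0" by simp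
    have "\<forall>i. norm (norm ((LINT x|M. f (X i) x) - (LINT x|M. f t0 x) - (LINT x|M. D x (X i - t0))) / norm (X i - t0)) \<le> (LINT x|M. r i x)"
    proof
      fix i
      have "(LINT x|M. f (X i) x) - (LINT x|M. f t0 x) - (LINT x|M. D x (X i - t0)) = (LINT x|M. f (X i) x - f t0 x - D x (X i - t0))"
        using int[OF X(1)] int[OF t0] int' by simp
      also have "norm \<dots> \<le> (LINT x|M. norm (f (X i) x - f t0 x - D x (X i - t0)))" by (rule integral_norm_bound)
      finally have "norm ((LINT x|M. f (X i) x) - (LINT x|M. f t0 x) - (LINT x|M. D x (X i - t0))) / norm (X i - t0) \<le> (LINT x|M. norm (f (X i) x - f t0 x - D x (X i - t0))) / norm (X i - t0)"
        by (rule divide_right_mono) simp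
      then show "norm (norm ((LINT x|M. f (X i) x) - (LINT x|M. f t0 x) - (LINT x|M. D x (X i - t0))) / norm (X i - t0)) \<le> (LINT x|M. r i x)"
        unfolding r_def by simp
    qed
    then have "(\<lambda>i. norm ((LINT x|M. f (X i) x) - (LINT x|M. f t0 x) - (LINT x|M. D x (X i - t0))) / norm (X i - t0)) \<longlonglongrightarrow> 0"
      by (intro Lim_null_comparison[OF always_eventually R0])
    then show "((\<lambda>y. norm ((LINT x|M. f y x) - (LINT x|M. f t0 x) - (LINT x|M. D x (y - t0))) / norm (y - t0)) \<circ> Y) \<longlonglongrightarrow> 0"
      unfolding X_def o_def by (rule LIMSEQ_offset)
  qed
  then show ?thesis unfolding has_derivative_iff_norm using bl by simp
qed

lemma has_field_derivative_lebesgue_integral: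
  fixes f :: "complex \<Rightarrow> 'x \<Rightarrow> complex"
  assumes e: "0 < e"
    and int: "\<And>t. t \<in> ball t0 e \<Longrightarrow> integrable M (f t)"
    and meas: "d \<in> borel_measurable M"
    and der: "\<And>x. x \<in> space M \<Longrightarrow> ((\<lambda>t. f t x) has_field_derivative d x) (at t0)"
    and lip: "\<And>t x. t \<in> ball t0 e \<Longrightarrow> x \<in> space M \<Longrightarrow> norm (f t x - f t0 x) \<le> h x * norm (t - t0)"
    and bnd: "\<And>x. x \<in> space M \<Longrightarrow> norm (d x) \<le> h x"
    and h: "integrable M h"
  shows "((\<lambda>t. LINT x|M. f t x) has_field_derivative (LINT x|M. d x)) (at t0)"
proof -
  have intd: "integrable M d"
    by (rule Bochner_Integration.integrable_bound[OF h meas]) (use bnd in \<open>auto intro!: AE_I2 order_trans[OF _ abs_ge_self]\<close>)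
  have "((\<lambda>t. LINT x|M. f t x) has_derivative (\<lambda>v. LINT x|M. d x * v)) (at t0)"
    by (rule has_derivative_lebesgue_integral[OF e int _ _ lip _ h])
       (use intd der bnd in \<open>auto simp: has_field_derivative_def norm_mult intro!: mult_right_mono\<close>)
  then show ?thesis unfolding has_field_derivative_def by simp
qed

lemma has_vector_derivative_lebesgue_integral:
  fixes f :: "real \<Rightarrow> 'x \<Rightarrow> complex"
  assumes e: "0 < e"
    and int: "\<And>t. t \<in> ball t0 e \<Longrightarrow> integrable M (f t)"
    and meas: "(\<lambda>x. d t0 x) \<in> borel_measurable M"
    and der: "\<And>t x. t \<in> ball t0 e \<Longrightarrow> x \<in> space M \<Longrightarrow> ((\<lambda>t. f t x) has_vector_derivative d t x) (at t)"
    and bnd: "\<And>t x. t \<in> ball t0 e \<Longrightarrow> x \<in> space M \<Longrightarrow> norm (d t x) \<le> h x"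
    and h: "integrable M h"
  shows "((\<lambda>t. LINT x|M. f t x) has_vector_derivative (LINT x|M. d t0 x)) (at t0)"
proof -
  have t0: "t0 \<in> ball t0 e" using e by simp
  have intd: "integrable M (\<lambda>x. d t0 x)"
    by (rule Bochner_Integration.integrable_bound[OF h meas]) (use bnd[OF t0] in \<open>auto intro!: AE_I2 order_trans[OF _ abs_ge_self]\<close>)
  have "((\<lambda>t. LINT x|M. f t x) has_derivative (\<lambda>v. LINT x|M. v *\<^sub>R d t0 x)) (at t0)"
  proof (rule has_derivative_lebesgue_integral[OF e int _ _ _ _ h])
    show "integrable M (\<lambda>x. v *\<^sub>R d t0 x)" for v using intd by simp
    show "((\<lambda>t. f t x) has_derivative (\<lambda>v. v *\<^sub>R d t0 x)) (at t0)" if "x \<in> space M" for x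
      using der[OF t0 that] unfolding has_vector_derivative_def .
    show "norm (v *\<^sub>R d t0 x) \<le> h x * norm v" if "x \<in> space M" for x v
      using mult_left_mono[OF bnd[OF t0 that], of "\<bar>v\<bar>"] by (simp add: mult.commute)
    show "norm (f t x - f t0 x) \<le> h x * norm (t - t0)" if t: "t \<in> ball t0 e" and x: "x \<in> space M" for t x
    proof (rule differentiable_bound[where S = "ball t0 e" and f' = "\<lambda>t v. v *\<^sub>R d t x"])
      show "((\<lambda>t. f t x) has_derivative (\<lambda>v. v *\<^sub>R d s x)) (at s within ball t0 e)" if "s \<in> ball t0 e" for s
        using der[OF that x] unfolding has_vector_derivative_def by (rule has_derivative_at_withinI)
      show "onorm (\<lambda>v. v *\<^sub>R d s x) \<le> h x" if "s \<in> ball t0 e" for s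
        using bnd[OF that x] by (intro onorm_le) (auto intro: order_trans[OF mult_left_mono] simp: mult.commute)
    qed (use t t0 in auto)
  qed
  then show ?thesis unfolding has_vector_derivative_def by simp
qed

section \<open>The Mittag-Leffler series and termwise Laplace transforms\<close>

text \<open>Integrals over \<open>(0, \<infinity>)\<close> are taken against a restricted measure, so that integrands need no indicator and
the congruence rules supply the positivity of the variable.\<close>

abbreviation half_line :: "real measure" where
  "half_line \<equiv> restrict_space lborel {0<..}"

lemma space_half_line [simp]: "space half_line = {0<..}"
  by (simp add: space_restrict_space)

lemma ident_measurable_half_line [measurable (raw)]: "(\<lambda>x. x) \<in> borel_measurable half_line"
  by (rule measurable_restrict_space1) simp

interpretation half_line: sigma_finite_measure half_line
  by (rule sigma_finite_measure_restrict_space) (auto intro: lborel.sigma_finite_measure_axioms)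

interpretation half_line_pair: pair_sigma_finite half_line half_line ..

interpretation half_line_lborel: pair_sigma_finite half_line lborel ..

lemma borel_measurable_half_line_pair:
  assumes f: "f \<in> borel_measurable (borel \<Otimes>\<^sub>M borel)"
  shows "f \<in> borel_measurable (half_line \<Otimes>\<^sub>M lborel)" "f \<in> borel_measurable (half_line \<Otimes>\<^sub>M half_line)"
proof -
  have 1: "fst \<in> borel_measurable (half_line \<Otimes>\<^sub>M N)" for N :: "real measure"
    by (rule measurable_compose[OF measurable_fst ident_measurable_half_line])
  have 2: "snd \<in> borel_measurable (half_line \<Otimes>\<^sub>M half_line)"
    by (rule measurable_compose[OF measurable_snd ident_measurable_half_line])
  have 3: "snd \<in> borel_measurable (half_line \<Otimes>\<^sub>M lborel)" by simp
  show "f \<in> borel_measurable (half_line \<Otimes>\<^sub>M lborel)"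
    using measurable_compose[OF measurable_Pair[OF 1 3] f] by simp
  show "f \<in> borel_measurable (half_line \<Otimes>\<^sub>M half_line)"
    using measurable_compose[OF measurable_Pair[OF 1 2] f] by simp
qed

lemma nn_integral_half_line:
  "(\<integral>\<^sup>+t. f t \<partial>half_line) = (\<integral>\<^sup>+t. f t * indicator {0<..} t \<partial>lborel)"
  by (subst nn_integral_restrict_space) auto

lemma nn_integral_half_line_scale:
  assumes [measurable]: "f \<in> borel_measurable borel" and c: "0 < c"
  shows "(\<integral>\<^sup>+t. f t \<partial>half_line) = ennreal c * (\<integral>\<^sup>+t. f (c * t) \<partial>half_line)"
  unfolding nn_integral_half_line
  using nn_integral_real_affine[of "\<lambda>t. f t * indicator {0<..} t" c 0] c
  by (simp add: indicator_def zero_less_mult_iff)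

lemma nn_integral_Gamma_unit:
  assumes "0 < b"
  shows "(\<integral>\<^sup>+t. ennreal (t powr (b - 1) * exp (- t)) \<partial>half_line) = ennreal (Gamma b)"
proof -
  have "(\<integral>\<^sup>+t. ennreal (t powr (b - 1) * exp (- t)) \<partial>half_line)
      = (\<integral>\<^sup>+t. ennreal (indicator {0..} t * t powr (b - 1) / exp t) \<partial>lborel)"
    unfolding nn_integral_half_line
    by (intro nn_integral_cong_AE AE_I[of _ _ "{0}"])
       (auto simp: indicator_def exp_minus field_simps less_le)
  then show ?thesis using Gamma_conv_nn_integral_real[OF assms] by simp
qed

lemma nn_integral_Gamma:
  assumes b: "0 < b" and p: "0 < p"
  shows "(\<integral>\<^sup>+t. ennreal (t powr (b - 1) * exp (- p * t)) \<partial>half_line) = ennreal (Gamma b * p powr (- b))"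
proof -
  have "ennreal (Gamma b) = ennreal p * (\<integral>\<^sup>+t. ennreal ((p * t) powr (b - 1) * exp (- (p * t))) \<partial>half_line)"
    unfolding nn_integral_Gamma_unit[OF b, symmetric]
    by (rule nn_integral_half_line_scale) (use p in auto)
  also have "(\<integral>\<^sup>+t. ennreal ((p * t) powr (b - 1) * exp (- (p * t))) \<partial>half_line)
     = (\<integral>\<^sup>+t. ennreal (p powr (b - 1)) * ennreal (t powr (b - 1) * exp (- p * t)) \<partial>half_line)"
    by (intro nn_integral_cong) (use p in \<open>auto simp: powr_mult ennreal_mult'[symmetric] mult_ac\<close>)
  also have "\<dots> = ennreal (p powr (b - 1)) * (\<integral>\<^sup>+t. ennreal (t powr (b - 1) * exp (- p * t)) \<partial>half_line)"
    by (rule nn_integral_cmult) measurable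
  also have "ennreal p * \<dots> = ennreal (p powr b) * (\<integral>\<^sup>+t. ennreal (t powr (b - 1) * exp (- p * t)) \<partial>half_line)"
    using p by (simp add: mult.assoc[symmetric] ennreal_mult'[symmetric] powr_diff)
  finally have "ennreal (p powr (-b)) * ennreal (Gamma b)
     = ennreal (p powr (-b)) * ennreal (p powr b) * (\<integral>\<^sup>+t. ennreal (t powr (b - 1) * exp (- p * t)) \<partial>half_line)"
    by (simp add: mult.assoc)
  also have "ennreal (p powr (-b)) * ennreal (p powr b) = 1"
    using p by (simp add: ennreal_mult'[symmetric] powr_minus)
  finally show ?thesis using p Gamma_real_pos[OF b] by (simp add: ennreal_mult'[symmetric] mult.commute)
qed

lemma has_bochner_integral_Gamma:
  assumes b: "0 < b" and p: "0 < p"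
  shows "has_bochner_integral half_line (\<lambda>t. t powr (b - 1) * exp (- p * t)) (Gamma b * p powr (- b))"
  using nn_integral_Gamma[OF assms] Gamma_real_pos[OF b]
  by (intro has_bochner_integral_nn_integral) auto

text \<open>Restricting the Gamma integral to \<open>t \<ge> T\<close> gives \<open>\<Gamma>(s + 1) \<ge> T powr s * exp (- T)\<close> for every
  \<open>T\<close>; a large \<open>T\<close> beats any geometric factor.\<close>

lemma Gamma_ge_powr_exp:
  fixes s T :: real
  assumes s: "0 \<le> s" and T: "0 < T"
  shows "T powr s * exp (- T) \<le> Gamma (s + 1)"
proof -
  have "ennreal (T powr s * exp (- T)) = ennreal (T powr s) * (\<integral>\<^sup>+t. ennreal (exp (- t)) * indicator {T..} t \<partial>lborel)"
  proof -
    have "(\<integral>\<^sup>+t. ennreal (exp (- t)) * indicator {T..} t \<partial>lborel) = 0 - (- exp (- T))"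
    proof (rule nn_integral_FTC_atLeast)
      show "((\<lambda>t::real. - exp (- t)) \<longlongrightarrow> 0) at_top" by real_asymp
    qed (auto intro!: derivative_eq_intros)
    then show ?thesis by (simp add: ennreal_mult')
  qed
  also have "\<dots> = (\<integral>\<^sup>+t. ennreal (T powr s) * (ennreal (exp (- t)) * indicator {T..} t) \<partial>lborel)"
    by (rule nn_integral_cmult[symmetric]) simp
  also have "\<dots> \<le> (\<integral>\<^sup>+t. ennreal (t powr (s + 1 - 1) * exp (- t)) \<partial>half_line)"
    unfolding nn_integral_half_line using s T
    by (intro nn_integral_mono)
       (auto simp: indicator_def ennreal_mult'[symmetric] intro!: ennreal_leI mult_right_mono powr_mono2)
  also have "\<dots> = ennreal (Gamma (s + 1))"
    by (rule nn_integral_Gamma_unit) (use s in auto)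
  finally show ?thesis using Gamma_real_pos[of "s + 1"] s by simp
qed

lemma summable_mittag_leffler:
  fixes x :: real
  assumes a: "0 < a"
  shows "summable (\<lambda>k. norm (x ^ k / Gamma (a * real k + 1)))"
proof -
  \<comment> \<open>With this \<open>T\<close> the terms are dominated by a geometric series of ratio \<open>1 / 2\<close>.\<close>
  define T where "T = (2 * (\<bar>x\<bar> + 1)) powr (1 / a)"
  have T: "T > 0" "T powr a = 2 * (\<bar>x\<bar> + 1)"
    unfolding T_def using a by (auto simp: powr_powr)
  show ?thesis
  proof (rule summable_comparison_test')
    show "summable (\<lambda>k. exp T * (1 / 2) ^ k)"
      by (intro summable_mult summable_geometric) auto
    fix k :: nat
    define g where "g = Gamma (a * real k + 1)"
    have g: "g > 0" unfolding g_def using a by (intro Gamma_real_pos add_nonneg_pos) auto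
    have "\<bar>x\<bar> ^ k * 2 ^ k = (2 * \<bar>x\<bar>) ^ k" by (simp add: power_mult_distrib)
    also have "\<dots> \<le> (T powr a) ^ k" unfolding T(2) by (intro power_mono) auto
    also have "\<dots> = T powr (a * real k)" using T(1) by (simp add: powr_powr[symmetric] powr_realpow)
    also have "\<dots> \<le> exp T * g"
      using Gamma_ge_powr_exp[of "a * real k" T, folded g_def] a T(1) by (simp add: exp_minus field_simps)
    finally show "norm (norm (x ^ k / Gamma (a * real k + 1))) \<le> exp T * (1 / 2) ^ k"
      unfolding g_def[symmetric] using g by (simp add: power_abs field_simps)
  qed
qed

lemma mittag_leffler_sums:
  assumes a: "0 < a"
  shows "(\<lambda>k. x ^ k / Gamma (a * real k + 1)) sums mittag_leffler a x"
  unfolding mittag_leffler_def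
  by (rule summable_sums[OF summable_norm_cancel[OF summable_mittag_leffler[OF a]]])

lemma continuous_mittag_leffler:
  assumes a: "0 < a"
  shows "continuous_on A (mittag_leffler a)"
proof -
  have "isCont (\<lambda>x. \<Sum>k. (1 / Gamma (a * real k + 1)) * x ^ k) x" for x
    by (rule isCont_powser[where K = "\<bar>x\<bar> + 1"])
       (use summable_norm_cancel[OF summable_mittag_leffler[OF a, of "\<bar>x\<bar> + 1"]] in auto)
  then have "isCont (mittag_leffler a) x" for x
    by (simp add: mittag_leffler_def[abs_def])
  then show ?thesis by (intro continuous_at_imp_continuous_on) auto
qed

lemma mittag_leffler_measurable [measurable]:
  assumes a: "0 < a" and f: "f \<in> borel_measurable M"
  shows "(\<lambda>x. mittag_leffler a (f x)) \<in> borel_measurable M"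
  using measurable_compose[OF f borel_measurable_continuous_onI[OF continuous_mittag_leffler[OF a]]] .

lemma mittag_leffler_zero: "mittag_leffler a 0 = 1"
proof -
  have "mittag_leffler a 0 = (\<Sum>k. if k = 0 then 1 else 0)"
    unfolding mittag_leffler_def by (intro suminf_cong) auto
  then show ?thesis using suminf_finite[of "{0}" "\<lambda>k::nat. if k = 0 then 1 else 0::real"] by simp
qed

lemma mittag_leffler_one: "mittag_leffler 1 x = exp x"
proof -
  have "Gamma (1 * real k + 1) = fact k" for k using Gamma_fact[of k, where 'a=real] by (simp add: add.commute)
  then show ?thesis
    using mittag_leffler_sums[of 1 x] exp_converges[of x]
    by (intro sums_unique2) (auto simp: divide_inverse mult.commute scaleR_conv_of_real)
qed

text \<open>Termwise integration of the Mittag-Leffler series: each power of \<open>t\<close> contributes a Gamma integral. The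
exponent \<open>b - 1\<close> is kept general because \<open>b = 1\<close> identifies the function and \<open>b = n - \<gamma>\<close> gives its
moments.\<close>

lemma laplace_mittag_leffler_sums:
  assumes a: "0 < a" and b: "0 < b" and p: "0 < p"
    and summ: "summable (\<lambda>k. \<bar>x\<bar> ^ k * p powr (- (b + a * real k)) * (Gamma (b + a * real k) / Gamma (a * real k + 1)))"
  shows "integrable half_line (\<lambda>t. t powr (b - 1) * exp (- p * t) * mittag_leffler a (x * t powr a))"
    and "(\<lambda>k. x ^ k * p powr (- (b + a * real k)) * (Gamma (b + a * real k) / Gamma (a * real k + 1)))
           sums (LINT t|half_line. t powr (b - 1) * exp (- p * t) * mittag_leffler a (x * t powr a))"
proof -
  define f where "f = (\<lambda>k t. x ^ k / Gamma (a * real k + 1) * (t powr (b + a * real k - 1) * exp (- p * t)))"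
  have bk: "b + a * real k > 0" "a * real k + 1 > 0" for k
    using a b by (auto intro: add_pos_nonneg add_nonneg_pos)
  have G: "Gamma (a * real k + 1) > 0" "Gamma (b + a * real k) > 0" for k
    using bk by (auto intro: Gamma_real_pos)
  have hb: "has_bochner_integral half_line (f k) (x ^ k / Gamma (a * real k + 1) * (Gamma (b + a * real k) * p powr (- (b + a * real k))))" for k
    unfolding f_def by (intro has_bochner_integral_mult_right has_bochner_integral_Gamma bk p)
  have nf: "norm (f k t) = \<bar>x\<bar> ^ k / Gamma (a * real k + 1) * (t powr (b + a * real k - 1) * exp (- p * t))" for k t
    using G(1)[of k] by (simp add: f_def abs_mult power_abs)
  have hbn: "has_bochner_integral half_line (\<lambda>t. norm (f k t)) (\<bar>x\<bar> ^ k / Gamma (a * real k + 1) * (Gamma (b + a * real k) * p powr (- (b + a * real k))))" for k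
    unfolding nf by (intro has_bochner_integral_mult_right has_bochner_integral_Gamma bk p)
  have pt: "f k t = t powr (b - 1) * exp (- p * t) * ((x * t powr a) ^ k / Gamma (a * real k + 1))"
    if "t > 0" for k t
  proof -
    have "t powr (b + a * real k - 1) = t powr ((b - 1) + a * real k)" by (simp add: algebra_simps)
    also have "\<dots> = t powr (b - 1) * (t powr a) powr real k"
      by (simp only: powr_add powr_powr)
    also have "(t powr a) powr real k = (t powr a) ^ k"
      using that by (intro powr_realpow) simp
    finally have "t powr (b + a * real k - 1) = t powr (b - 1) * (t powr a) ^ k" .
    then show ?thesis unfolding f_def by (simp add: power_mult_distrib)
  qed
  have int: "integrable half_line (f k)" for k using hb by (rule integrable.intros)
  have A: "AE t in half_line. summable (\<lambda>k. norm (f k t))"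
  proof (rule AE_I2)
    fix t :: real assume "t \<in> space half_line"
    then have t: "t > 0" by simp
    show "summable (\<lambda>k. norm (f k t))"
      unfolding pt[OF t] norm_mult by (intro summable_mult summable_mittag_leffler a)
  qed
  have S: "summable (\<lambda>k. LINT t|half_line. norm (f k t))"
    unfolding has_bochner_integral_integral_eq[OF hbn] using summ by (simp add: mult_ac)
  have eq: "(\<Sum>k. f k t) = t powr (b - 1) * exp (- p * t) * mittag_leffler a (x * t powr a)" if "t > 0" for t
    unfolding pt[OF that] mittag_leffler_def
    by (rule suminf_mult) (rule summable_norm_cancel[OF summable_mittag_leffler[OF a]])
  have "integrable half_line (\<lambda>t. \<Sum>k. f k t)"
    by (rule integrable_suminf[OF int A S])
  also have "?this \<longleftrightarrow> integrable half_line (\<lambda>t. t powr (b - 1) * exp (- p * t) * mittag_leffler a (x * t powr a))"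
    by (rule Bochner_Integration.integrable_cong[OF refl]) (simp add: eq)
  finally show "integrable half_line (\<lambda>t. t powr (b - 1) * exp (- p * t) * mittag_leffler a (x * t powr a))" .
  have "(\<lambda>k. integral\<^sup>L half_line (f k)) sums (LINT t|half_line. (\<Sum>k. f k t))"
    by (rule sums_integral[OF int A S])
  also have "(LINT t|half_line. (\<Sum>k. f k t)) = (LINT t|half_line. t powr (b - 1) * exp (- p * t) * mittag_leffler a (x * t powr a))"
    by (intro Bochner_Integration.integral_cong refl) (simp add: eq)
  finally show "(\<lambda>k. x ^ k * p powr (- (b + a * real k)) * (Gamma (b + a * real k) / Gamma (a * real k + 1)))
           sums (LINT t|half_line. t powr (b - 1) * exp (- p * t) * mittag_leffler a (x * t powr a))"
    unfolding has_bochner_integral_integral_eq[OF hb] by (simp add: mult_ac)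
qed

text \<open>For \<open>b = 1\<close> the Gamma quotients cancel and the series is geometric.\<close>

lemma laplace_mittag_leffler_large:
  assumes a: "0 < a" and p: "1 < p" and x: "\<bar>x\<bar> = 1"
  shows "integrable half_line (\<lambda>t. exp (- p * t) * mittag_leffler a (x * t powr a))"
    and "(LINT t|half_line. exp (- p * t) * mittag_leffler a (x * t powr a)) = p powr (a - 1) / (p powr a - x)"
proof -
  have pa: "p powr a > 1" using a p by simp
  have trm: "y ^ k * p powr (- (1 + a * real k)) * (Gamma (1 + a * real k) / Gamma (a * real k + 1))
     = (1 / p) * (y / p powr a) ^ k" for k and y :: real
  proof -
    have "Gamma (1 + a * real k) / Gamma (a * real k + 1) = 1"
    proof -
      have "Gamma (1 + a * real k) > 0" using a by (intro Gamma_real_pos add_pos_nonneg) auto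
      then show ?thesis by (simp add: add.commute)
    qed
    moreover have "p powr (- (1 + a * real k)) = 1 / p * (1 / p powr a) ^ k"
    proof -
      have "p powr (- (1 + a * real k)) = 1 / (p * (p powr a) powr real k)"
        using p by (simp only: powr_minus powr_add powr_powr powr_one inverse_eq_divide)
      also have "(p powr a) powr real k = (p powr a) ^ k"
        using p by (intro powr_realpow) simp
      finally show ?thesis by (simp add: power_divide)
    qed
    ultimately show ?thesis by (simp add: power_divide)
  qed
  have xp: "norm (x / p powr a) < 1" using x pa by (simp add: abs_divide divide_less_eq)
  have s: "(\<lambda>k. (1 / p) * (x / p powr a) ^ k) sums ((1 / p) * (1 / (1 - x / p powr a)))"
    by (intro sums_mult geometric_sums xp)
  have s2: "summable (\<lambda>k. (1 / p) * (\<bar>x\<bar> / p powr a) ^ k)"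
    using x pa by (intro summable_mult summable_geometric) (auto simp: divide_less_eq)
  note L = laplace_mittag_leffler_sums[of a 1 p x, unfolded trm]
  have pt: "t powr (1 - 1) = 1" if "t \<in> space half_line" for t :: real using that by simp
  show "integrable half_line (\<lambda>t. exp (- p * t) * mittag_leffler a (x * t powr a))"
  proof -
    have "integrable half_line (\<lambda>t. t powr (1 - 1) * exp (- p * t) * mittag_leffler a (x * t powr a))"
      using L(1)[OF a _ _ s2] p by simp
    also have "?this \<longleftrightarrow> ?thesis"
      by (rule Bochner_Integration.integrable_cong[OF refl]) simp
    finally show ?thesis .
  qed
  have "(LINT t|half_line. exp (- p * t) * mittag_leffler a (x * t powr a))
      = (LINT t|half_line. t powr (1 - 1) * exp (- p * t) * mittag_leffler a (x * t powr a))"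
    by (intro Bochner_Integration.integral_cong refl) (use pt in auto)
  also have "\<dots> = (1 / p) * (1 / (1 - x / p powr a))"
    using L(2)[OF a _ _ s2] p s by (intro sums_unique2[of "\<lambda>k. (1 / p) * (x / p powr a) ^ k"]) auto
  also have "\<dots> = p powr (a - 1) / (p powr a - x)"
    using pa p x by (simp add: powr_diff field_simps)
  finally show "(LINT t|half_line. exp (- p * t) * mittag_leffler a (x * t powr a)) = p powr (a - 1) / (p powr a - x)" .
qed

section \<open>A Stieltjes transform by contour integration\<close>

text \<open>The spectral density of the Mittag-Leffler function in the logarithmic variable \<open>u = ln r\<close> of the decay
rate \<open>r\<close>; up to the factor \<open>1 / \<pi>\<close> it is the imaginary part of \<open>z\<^sup>a / (z\<^sup>a + 1)\<close> on the upper side of the cut,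
\<open>z = exp (u + \<i> \<pi>)\<close>.\<close>

definition ml_kernel :: "real \<Rightarrow> real \<Rightarrow> real" where
  "ml_kernel a u = sin (a * pi) / (2 * pi * (cosh (a * u) + cos (a * pi)))"

lemma ml_kernel_denom_pos:
  assumes "0 < a" "a < 1"
  shows "0 < 1 + cos (a * pi)" "0 < cosh (a * u) + cos (a * pi)"
proof -
  have "cos (a * pi) > cos pi"
    using assms by (intro cos_monotone_0_pi) auto
  then show *: "0 < 1 + cos (a * pi)" by simp
  show "0 < cosh (a * u) + cos (a * pi)"
    using * cosh_real_ge_1[of "a * u"] by linarith
qed

lemma sin_pi_mult_pos: "0 < a \<Longrightarrow> a < 1 \<Longrightarrow> 0 < sin (a * pi)"
  by (intro sin_gt_zero) auto

lemma ml_kernel_pos: "0 < a \<Longrightarrow> a < 1 \<Longrightarrow> 0 < ml_kernel a u"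
  unfolding ml_kernel_def
  using ml_kernel_denom_pos(2)[of a u] sin_pi_mult_pos[of a] by (intro divide_pos_pos mult_pos_pos) auto

lemma ml_kernel_continuous: "0 < a \<Longrightarrow> a < 1 \<Longrightarrow> continuous_on UNIV (ml_kernel a)"
  unfolding ml_kernel_def[abs_def] using ml_kernel_denom_pos(2)[of a]
  by (intro continuous_intros) (auto simp: less_le)

text \<open>After the substitution \<open>z = exp w\<close> the plane cut along the negative axis becomes the strip
\<open>\<bar>Im w\<bar> \<le> \<pi>\<close>, a keyhole contour becomes a rectangle, and the pole at \<open>z = p\<close> sits at \<open>w = ln p\<close>.\<close>

definition stieltjes_integrand :: "real \<Rightarrow> real \<Rightarrow> complex \<Rightarrow> complex" where
  "stieltjes_integrand a p w = exp (of_real a * w) / (exp (of_real a * w) + 1) / (exp w - of_real p)"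

lemma exp_scaled_neq_minus_one:
  assumes "0 < a" "a < 1" "\<bar>Im w\<bar> < pi / a"
  shows "exp (of_real a * w) + 1 \<noteq> 0"
proof
  assume "exp (of_real a * w) + 1 = 0"
  then have e: "exp (of_real a * w) = -1"
    by (simp add: eq_neg_iff_add_eq_0)
  then have "Im (exp (of_real a * w)) = 0" "Re (exp (of_real a * w)) = -1" by simp_all
  then have s: "sin (a * Im w) = 0" and c: "exp (a * Re w) * cos (a * Im w) = -1"
    by (auto simp: Im_exp Re_exp)
  have "\<bar>a * Im w\<bar> < pi"
    using assms by (simp add: abs_mult field_simps)
  then have "a * Im w = 0"
    using s sin_eq_0_pi[of "a * Im w"] by (simp add: abs_less_iff)
  then have "Im w = 0" using assms(1) by simp
  then have "exp (a * Re w) = -1" using c by simp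
  then show False using exp_gt_zero[of "a * Re w"] by linarith
qed

lemma exp_eq_of_real_in_strip:
  assumes "exp w = complex_of_real p" "0 < p" "\<bar>Im w\<bar> < 2 * pi"
  shows "w = of_real (ln p)"
proof -
  have "exp w = exp (of_real (ln p))"
    using assms by (simp add: exp_of_real)
  then obtain n where n: "w = of_real (ln p) + (of_int (2 * n) * pi) * \<i>"
    using exp_eq by blast
  then have "Im w = 2 * of_int n * pi" by simp
  with assms(3) have "\<bar>2 * of_int n * pi\<bar> < 2 * pi" by metis
  then have "\<bar>real_of_int n\<bar> < 1"
    by (simp add: abs_mult)
  then have "n = 0" by linarith
  then show ?thesis using n by simp
qed

text \<open>The values on the two edges of the strip are complex conjugates, so their difference is an imaginary
part, and this is where the kernel comes from.\<close>

lemma stieltjes_integrand_jump: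
  assumes "0 < a" "a < 1" "0 < p"
  shows "stieltjes_integrand a p (Complex u (-pi)) - stieltjes_integrand a p (Complex u pi)
           = 2 * pi * \<i> * of_real (ml_kernel a u / (p + exp u))"
proof -
  define E where "E = exp (a * u)"
  define c where "c = cos (a * pi)"
  define s where "s = sin (a * pi)"
  have E: "E > 0" unfolding E_def by simp
  have cs: "c\<^sup>2 + s\<^sup>2 = 1" unfolding c_def s_def by simp
  have e1: "exp (of_real a * Complex u pi) = E * Complex c s"
    unfolding E_def c_def s_def
    by (simp add: complex_eq_iff Re_exp Im_exp mult.commute)
  have e2: "exp (of_real a * Complex u (-pi)) = E * Complex c (-s)"
    unfolding E_def c_def s_def
    by (simp add: complex_eq_iff Re_exp Im_exp mult.commute)
  have e3: "exp (Complex u pi) = - exp u" "exp (Complex u (-pi)) = - exp u"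
    by (simp_all add: complex_eq_iff Re_exp Im_exp exp_of_real)
  have ch: "cosh (a * u) = (E + 1 / E) / 2"
    unfolding E_def cosh_def by (simp add: exp_minus field_simps)
  have D: "E\<^sup>2 + 2 * c * E + 1 > 0"
  proof -
    have "0 < (cosh (a * u) + cos (a * pi)) * (2 * E)"
      using ml_kernel_denom_pos(2)[of a u] assms E by simp
    also have "\<dots> = E\<^sup>2 + 2 * c * E + 1"
      unfolding ch c_def[symmetric] using E by (simp add: field_simps power2_eq_square)
    finally show ?thesis .
  qed
  have k: "ml_kernel a u = s * E / (pi * (E\<^sup>2 + 2 * c * E + 1))"
  proof -
    have "2 * pi * (cosh (a * u) + cos (a * pi)) = pi * (E\<^sup>2 + 2 * c * E + 1) / E"
      unfolding ch c_def[symmetric] using E by (simp add: field_simps power2_eq_square)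
    then show ?thesis
      unfolding ml_kernel_def s_def[symmetric] by simp
  qed
  have n1: "of_real E * Complex c s + 1 \<noteq> 0" "of_real E * Complex c (-s) + 1 \<noteq> 0"
    using exp_scaled_neq_minus_one[of a "Complex u pi"] exp_scaled_neq_minus_one[of a "Complex u (-pi)"]
      assms e1 e2 by (auto simp: field_simps)
  have prod: "(E * Complex c (-s) + 1) * (E * Complex c s + 1) = of_real (E\<^sup>2 + 2 * c * E + 1)"
  proof -
    have "E * c * (E * c) + E * s * (E * s) = E\<^sup>2 * (c\<^sup>2 + s\<^sup>2)"
      by (simp add: power2_eq_square algebra_simps)
    then show ?thesis using cs by (simp add: complex_eq_iff algebra_simps power2_eq_square)
  qed
  have "E * Complex c (-s) / (E * Complex c (-s) + 1) - E * Complex c s / (E * Complex c s + 1)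
       = (E * Complex c (-s) - E * Complex c s) / ((E * Complex c (-s) + 1) * (E * Complex c s + 1))"
    using n1 by (simp add: field_simps)
  also have "\<dots> = - 2 * \<i> * of_real (E * s / (E\<^sup>2 + 2 * c * E + 1))"
    unfolding prod by (simp add: complex_eq_iff Re_divide_of_real Im_divide_of_real del: of_real_add of_real_mult)
  finally have g: "E * Complex c (-s) / (E * Complex c (-s) + 1) - E * Complex c s / (E * Complex c s + 1)
     = - 2 * \<i> * of_real (E * s / (E\<^sup>2 + 2 * c * E + 1))" .
  have "stieltjes_integrand a p (Complex u (-pi)) - stieltjes_integrand a p (Complex u pi)
     = (E * Complex c (-s) / (E * Complex c (-s) + 1) - E * Complex c s / (E * Complex c s + 1)) / of_real (- (p + exp u))"
  proof -
    have "complex_of_real (- exp u) - of_real p = of_real (- (p + exp u))" by simp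
    then show ?thesis
      unfolding stieltjes_integrand_def e1 e2 e3 by (simp only: diff_divide_distrib of_real_minus)
  qed
  also have "\<dots> = 2 * \<i> * of_real (E * s / (E\<^sup>2 + 2 * c * E + 1) / (p + exp u))"
  proof -
    have "- 2 * \<i> * of_real A / of_real (- q) = 2 * \<i> * of_real (A / q)" for A q :: real by simp
    then show ?thesis unfolding g .
  qed
  also have "E * s / (E\<^sup>2 + 2 * c * E + 1) / (p + exp u) = pi * (ml_kernel a u / (p + exp u))"
    unfolding k by simp
  finally show ?thesis by simp
qed

text \<open>Since \<open>a < 1\<close>, the zeros of \<open>exp (a w) + 1\<close> have \<open>\<bar>Im w\<bar> \<ge> \<pi> / a > \<pi>\<close>; the only pole of the integrand near
the rectangle is the simple one at \<open>ln p\<close>.\<close>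

lemma contour_integral_rectangle_stieltjes:
  assumes a: "0 < a" "a < 1" and p: "0 < p" and R: "\<bar>ln p\<bar> < R"
  defines "f \<equiv> stieltjes_integrand a p"
  shows "contour_integral (rectpath (Complex (-R) (-pi)) (Complex R pi)) f
           = 2 * pi * \<i> * of_real (p powr (a - 1) / (p powr a + 1))"
    and "path_image (rectpath (Complex (-R) (-pi)) (Complex R pi)) \<subseteq> 
          {w. \<bar>Im w\<bar> < min (pi / a) (2 * pi)} - {of_real (ln p)}"
    and "f holomorphic_on {w. \<bar>Im w\<bar> < min (pi / a) (2 * pi)} - {of_real (ln p)}"
proof -
  define S where "S = {w. \<bar>Im w\<bar> < min (pi / a) (2 * pi)}"
  define v where "v = complex_of_real (ln p)"
  let ?r = "rectpath (Complex (-R) (-pi)) (Complex R pi)"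
  have Sbox: "S = {w. - min (pi / a) (2 * pi) < Im w} \<inter> {w. Im w < min (pi / a) (2 * pi)}"
    unfolding S_def by auto
  have oS: "open S" unfolding Sbox by (intro open_Int open_halfspace_Im_gt open_halfspace_Im_lt)
  have cS: "connected S" unfolding Sbox
    by (intro convex_connected convex_Int convex_halfspace_Im_gt convex_halfspace_Im_lt)
  have api: "pi < pi / a" using a by (simp add: field_simps)
  have vS: "v \<in> S" unfolding S_def v_def using a by (simp add: divide_pos_pos)
  have hol1: "(\<lambda>w. exp (of_real a * w) / (exp (of_real a * w) + 1)) holomorphic_on S"
    using exp_scaled_neq_minus_one[OF a] by (intro holomorphic_intros) (auto simp: S_def)
  have hol2: "(\<lambda>w. exp w - of_real p) holomorphic_on S"
    by (intro holomorphic_intros)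
  have nz: "exp w - of_real p \<noteq> 0" if "w \<in> S - {v}" for w
    using that exp_eq_of_real_in_strip[of w p] p unfolding S_def v_def by auto
  have "(\<lambda>w. exp (of_real a * w) / (exp (of_real a * w) + 1) / (exp w - of_real p)) holomorphic_on S - {v}"
    by (intro holomorphic_on_divide holomorphic_on_subset[OF hol1] holomorphic_on_subset[OF hol2]) (use nz in auto)
  then have hol: "f holomorphic_on S - {v}"
    unfolding f_def stieltjes_integrand_def[abs_def] .
  then show "f holomorphic_on {w. \<bar>Im w\<bar> < min (pi / a) (2 * pi)} - {of_real (ln p)}"
    unfolding S_def v_def .
  have R0: "R > 0" using R by linarith
  have img: "path_image ?r \<subseteq> S - {v}"
  proof -
    have "path_image ?r \<subseteq> cbox (Complex (-R) (-pi)) (Complex R pi)"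
      by (rule path_image_rectpath_subset_cbox) (use R0 in auto)
    also have "\<dots> \<subseteq> S"
    proof
      fix z assume "z \<in> cbox (Complex (-R) (-pi)) (Complex R pi)"
      then have "\<bar>Im z\<bar> \<le> pi" by (auto simp: in_cbox_complex_iff abs_le_iff)
      then show "z \<in> S" using api pi_gt_zero unfolding S_def mem_Collect_eq by linarith
    qed
    finally have 1: "path_image ?r \<subseteq> S" .
    have "v \<in> box (Complex (-R) (-pi)) (Complex R pi)"
      using R by (auto simp: in_box_complex_iff v_def)
    then have "v \<notin> path_image ?r"
      using path_image_rectpath_inter_box[of "Complex (-R) (-pi)" "Complex R pi"] R0 by auto
    then show ?thesis using 1 by auto
  qed
  then show "path_image (rectpath (Complex (-R) (-pi)) (Complex R pi)) \<subseteq> 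
          {w. \<bar>Im w\<bar> < min (pi / a) (2 * pi)} - {of_real (ln p)}"
    unfolding S_def v_def .
  have wn0: "winding_number ?r z = 0" if "z \<notin> S" for z
  proof (rule winding_number_rectpath_outside)
    show "z \<notin> cbox (Complex (-R) (-pi)) (Complex R pi)"
    proof
      assume "z \<in> cbox (Complex (-R) (-pi)) (Complex R pi)"
      then have "\<bar>Im z\<bar> \<le> pi" by (auto simp: in_cbox_complex_iff abs_le_iff)
      then show False using that api pi_gt_zero unfolding S_def mem_Collect_eq by linarith
    qed
  qed (use R0 in auto)
  have wn1: "winding_number ?r v = 1"
    using R by (intro winding_number_rectpath) (auto simp: in_box_complex_iff v_def)
  have dv: "((\<lambda>w. exp w - of_real p) has_field_derivative exp v) (at v)"
    by (auto intro!: derivative_eq_intros)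
  have ev: "exp v = of_real p" unfolding v_def using p by (simp add: exp_of_real)
  have eav: "exp (of_real a * v) = of_real (p powr a)"
    unfolding v_def using p by (simp add: powr_def exp_of_real[symmetric])
  have pa: "p powr a > 0" using p by simp
  have res: "residue f v = of_real (p powr a / (p powr a + 1)) / of_real p"
  proof -
    have "residue (\<lambda>w. (exp (of_real a * w) / (exp (of_real a * w) + 1)) / (exp w - of_real p)) v
        = (exp (of_real a * v) / (exp (of_real a * v) + 1)) / exp v"
      by (rule residue_simple_pole_deriv[OF hol1 hol2 oS cS vS dv])
         (use ev eav p exp_scaled_neq_minus_one[OF a, of v] vS in \<open>auto simp: S_def\<close>)
    then show ?thesis unfolding f_def stieltjes_integrand_def[abs_def] eav ev by simp
  qed
  have "contour_integral ?r f = 2 * pi * \<i> * (\<Sum>q\<in>{v}. winding_number ?r q * residue f q)"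
    by (rule Residue_theorem[OF oS cS _ hol _ _ img]) (use wn0 in auto)
  also have "\<dots> = 2 * pi * \<i> * of_real (p powr (a - 1) / (p powr a + 1))"
    using p by (simp add: wn1 res powr_diff)
  finally show "contour_integral ?r f = 2 * pi * \<i> * of_real (p powr (a - 1) / (p powr a + 1))" .
qed

lemma contour_integral_horizontal_segment:
  assumes "0 < R" and cont: "continuous_on {-R..R} (\<lambda>u. f (Complex u y))"
  shows "contour_integral (linepath (Complex (-R) y) (Complex R y)) f
           = integral {-R..R} (\<lambda>u. f (Complex u y))"
proof -
  have "((\<lambda>x. (2 * R) *\<^sub>R f (Complex (- R + 2 * R * x) y)) has_integral
          (integral {- R + 2 * R * 0..- R + 2 * R * 1} (\<lambda>u. f (Complex u y)))) {0..1}"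
    by (rule has_integral_substitution[where c="-R" and d=R])
       (use assms in \<open>auto intro!: derivative_eq_intros mult_left_le\<close>)
  then have "((\<lambda>x. (2 * R) *\<^sub>R f (Complex (- R + 2 * R * x) y)) has_integral
          (integral {- R..R} (\<lambda>u. f (Complex u y)))) {0..1}"
    by simp
  also have "(\<lambda>x. (2 * R) *\<^sub>R f (Complex (- R + 2 * R * x) y)) = 
     (\<lambda>x. f (linepath (Complex (-R) y) (Complex R y) x) * (Complex R y - Complex (-R) y))"
  proof
    fix x :: real
    have 1: "linepath (Complex (-R) y) (Complex R y) x = Complex (- R + 2 * R * x) y"
      unfolding linepath_def by (simp add: complex_eq_iff algebra_simps)
    have 2: "Complex R y - Complex (-R) y = of_real (2 * R)"
      by (simp add: complex_eq_iff)
    show "(2 * R) *\<^sub>R f (Complex (- R + 2 * R * x) y) = f (linepath (Complex (-R) y) (Complex R y) x) * (Complex R y - Complex (-R) y)"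
      unfolding 1 2 by (simp add: scaleR_conv_of_real)
  qed
  finally have "(f has_contour_integral (integral {- R..R} (\<lambda>u. f (Complex u y)))) (linepath (Complex (-R) y) (Complex R y))"
    by (simp add: has_contour_integral_linepath)
  then show ?thesis by (rule contour_integral_unique)
qed

text \<open>Bounds on vertical lines. In the right half-plane numerator and denominator are divided by the exponential, so
that the denominator stays near \<open>1\<close> in both half-planes.\<close>

lemma norm_ml_quotient_le:
  assumes "0 < a" "a * \<bar>Re w\<bar> > 0"
  shows "norm (exp (of_real a * w) / (exp (of_real a * w) + 1)) 
     \<le> (if Re w > 0 then 1 else exp (a * Re w)) / (1 - exp (- a * \<bar>Re w\<bar>))"
proof (cases "Re w > 0")
  case True
  have eq: "exp (of_real a * w) / (exp (of_real a * w) + 1) = 1 / (1 + exp (- (of_real a * w)))"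
    by (simp add: exp_minus field_simps)
  have "norm (1 + exp (- (of_real a * w))) \<ge> 1 - norm (exp (- (of_real a * w)))"
    using norm_diff_ineq[of 1 "exp (- (of_real a * w))"] by simp
  then have "norm (1 + exp (- (of_real a * w))) \<ge> 1 - exp (- a * Re w)"
    by simp
  moreover have "exp (- a * Re w) < 1" using assms True by simp
  ultimately show ?thesis unfolding eq using True
    by (simp add: norm_divide frac_le)
next
  case False
  have "norm (1 + exp (of_real a * w)) \<ge> 1 - norm (exp (of_real a * w))"
    using norm_diff_ineq[of 1 "exp (of_real a * w)"] by simp
  then have "norm (exp (of_real a * w) + 1) \<ge> 1 - exp (a * Re w)"
    by (simp add: add.commute)
  moreover have "exp (a * Re w) < 1" using assms False
    by (smt (verit) exp_less_one_iff mult_pos_neg zero_less_mult_iff)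
  ultimately show ?thesis using False
    by (simp add: norm_divide frac_le)
qed

text \<open>The two vertical sides of the rectangle account for the error.\<close>

lemma integral_stieltjes_error:
  assumes a: "0 < a" "a < 1" and p: "0 < p" and R: "\<bar>ln p\<bar> < R"
  shows "\<bar>integral {-R..R} (\<lambda>u. ml_kernel a u / (p + exp u)) - p powr (a - 1) / (p powr a + 1)\<bar>
           \<le> 1 / (1 - exp (- a * R)) / (exp R - p) + exp (- a * R) / (1 - exp (- a * R)) / (p - exp (- R))"
proof -
  let ?f = "stieltjes_integrand a p"
  let ?h = "\<lambda>u. ml_kernel a u / (p + exp u)"
  define a1 where "a1 = Complex (-R) (-pi)"
  define a2 where "a2 = Complex R (-pi)"
  define a3 where "a3 = Complex R pi"
  define a4 where "a4 = Complex (-R) pi"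
  have R0: "R > 0" using R by linarith
  have "exp (- R) < exp (ln p)" "exp (ln p) < exp R"
    using R by (auto simp only: exp_less_cancel_iff abs_less_iff)
  then have pR: "exp (- R) < p" "p < exp R"
    using p by simp_all
  note rect = contour_integral_rectangle_stieltjes[OF a p R]
  have rp: "rectpath (Complex (-R) (-pi)) (Complex R pi) = 
     linepath a1 a2 +++ linepath a2 a3 +++ linepath a3 a4 +++ linepath a4 a1"
    unfolding rectpath_def Let_def a1_def a2_def a3_def a4_def by simp
  have "continuous_on (path_image (rectpath (Complex (-R) (-pi)) (Complex R pi))) ?f"
    by (rule continuous_on_subset[OF holomorphic_on_imp_continuous_on[OF rect(3)] rect(2)])
  then have cont: "continuous_on (closed_segment a1 a2) ?f" "continuous_on (closed_segment a2 a3) ?f"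
     "continuous_on (closed_segment a3 a4) ?f" "continuous_on (closed_segment a4 a1) ?f"
    unfolding rp by (auto simp: path_image_join elim!: continuous_on_subset)
  have I: "?f contour_integrable_on linepath a1 a2" "?f contour_integrable_on linepath a2 a3"
      "?f contour_integrable_on linepath a3 a4" "?f contour_integrable_on linepath a4 a1"
    using cont by (auto intro: contour_integrable_continuous_linepath)
  have tot: "2 * pi * \<i> * of_real (p powr (a - 1) / (p powr a + 1)) =
     contour_integral (linepath a1 a2) ?f + contour_integral (linepath a2 a3) ?f
     + contour_integral (linepath a3 a4) ?f + contour_integral (linepath a4 a1) ?f"
    unfolding rect(1)[symmetric] rp using I by (simp add: add_ac)
  have rev: "contour_integral (linepath a3 a4) ?f = - contour_integral (linepath a4 a3) ?f"
    using cont(3) by (intro contour_integral_reverse_linepath) (simp add: closed_segment_commute)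
  have seg: "(\<lambda>u. Complex u y) ` {-R..R} \<subseteq> closed_segment (Complex (-R) y) (Complex R y)" for y
    using R0 by (auto simp: closed_segment_same_Im closed_segment_eq_real_ivl)
  have cC: "continuous_on A (\<lambda>u. Complex u y)" for A y
    unfolding Complex_eq by (intro continuous_intros)
  have c12: "continuous_on {-R..R} (\<lambda>u. ?f (Complex u (-pi)))"
    by (rule continuous_on_compose2[OF cont(1) cC]) (use seg in \<open>simp add: a1_def a2_def\<close>)
  have c43: "continuous_on {-R..R} (\<lambda>u. ?f (Complex u pi))"
    by (rule continuous_on_compose2[OF cont(3) cC]) (use seg in \<open>simp add: a3_def a4_def closed_segment_commute\<close>)
  have 12: "contour_integral (linepath a1 a2) ?f = integral {-R..R} (\<lambda>u. ?f (Complex u (-pi)))"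
    unfolding a1_def a2_def by (rule contour_integral_horizontal_segment[OF R0 c12])
  have 43: "contour_integral (linepath a4 a3) ?f = integral {-R..R} (\<lambda>u. ?f (Complex u pi))"
    unfolding a4_def a3_def by (rule contour_integral_horizontal_segment[OF R0 c43])
  have "contour_integral (linepath a1 a2) ?f - contour_integral (linepath a4 a3) ?f
     = integral {-R..R} (\<lambda>u. ?f (Complex u (-pi)) - ?f (Complex u pi))"
    unfolding 12 43 using c12 c43 by (intro integral_diff[symmetric] integrable_continuous_interval)
  also have "\<dots> = integral {-R..R} (\<lambda>u. 2 * pi * \<i> * of_real (?h u))"
    unfolding stieltjes_integrand_jump[OF a p] ..
  also have "\<dots> = 2 * pi * \<i> * of_real (integral {-R..R} ?h)"
  proof -
    have "continuous_on {-R..R} ?h"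
      using add_pos_pos[OF p exp_gt_zero]
      by (intro continuous_intros continuous_on_subset[OF ml_kernel_continuous[OF a]]) (auto simp: less_le)
    then have "integral {-R..R} (complex_of_real \<circ> ?h) = of_real (integral {-R..R} ?h)"
      by (intro integral_linear integrable_continuous_interval bounded_linear_of_real)
    then have "integral {-R..R} (\<lambda>u. complex_of_real (?h u)) = of_real (integral {-R..R} ?h)"
      by (simp only: o_def)
    then show ?thesis by (subst integral_mult_right) (rule arg_cong)
  qed
  finally have eq: "2 * pi * \<i> * of_real (integral {-R..R} ?h - p powr (a - 1) / (p powr a + 1))
     = - (contour_integral (linepath a2 a3) ?f + contour_integral (linepath a4 a1) ?f)"
    using tot rev by (simp add: algebra_simps)
  define B1 where "B1 = 1 / (1 - exp (- a * R)) / (exp R - p)"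
  define B2 where "B2 = exp (- a * R) / (1 - exp (- a * R)) / (p - exp (- R))"
  have eR: "exp (- a * R) < 1" using a R0 by simp
  have B: "B1 \<ge> 0" "B2 \<ge> 0" unfolding B1_def B2_def using eR pR by auto
  have "norm (?f z) \<le> B1" if "z \<in> closed_segment a2 a3" for z
  proof -
    have z: "Re z = R" using that unfolding a2_def a3_def by (auto simp: closed_segment_same_Re)
    have "exp R - p \<le> norm (exp z - of_real p)"
      using norm_triangle_ineq2[of "exp z" "of_real p"] p z by simp
    then show ?thesis unfolding stieltjes_integrand_def B1_def norm_divide[of "_ / _"]
      using norm_ml_quotient_le[of a z] a z R0 pR eR by (intro frac_le) auto
  qed
  then have s1: "norm (contour_integral (linepath a2 a3) ?f) \<le> B1 * norm (a3 - a2)"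
    by (intro contour_integral_bound_linepath I B) auto
  have "norm (?f z) \<le> B2" if "z \<in> closed_segment a4 a1" for z
  proof -
    have z: "Re z = - R" using that unfolding a4_def a1_def by (auto simp: closed_segment_same_Re)
    have "p - exp (- R) \<le> norm (exp z - of_real p)"
      using norm_triangle_ineq2[of "of_real p" "exp z"] p z by (simp add: norm_minus_commute)
    then show ?thesis unfolding stieltjes_integrand_def B2_def norm_divide[of "_ / _"]
      using norm_ml_quotient_le[of a z] a z R0 pR eR by (intro frac_le) auto
  qed
  then have s2: "norm (contour_integral (linepath a4 a1) ?f) \<le> B2 * norm (a1 - a4)"
    by (intro contour_integral_bound_linepath I B) auto
  have d: "a3 - a2 = of_real (2 * pi) * \<i>" "a1 - a4 = - of_real (2 * pi) * \<i>"
    unfolding a1_def a2_def a3_def a4_def by (auto simp: complex_eq_iff)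
  have n: "norm (a3 - a2) = 2 * pi" "norm (a1 - a4) = 2 * pi"
    unfolding d by (simp_all add: norm_mult)
  have "2 * pi * \<bar>integral {-R..R} ?h - p powr (a - 1) / (p powr a + 1)\<bar> =
     norm (2 * pi * \<i> * of_real (integral {-R..R} ?h - p powr (a - 1) / (p powr a + 1)))"
    by (simp add: norm_mult del: of_real_diff)
  also have "\<dots> \<le> B1 * (2 * pi) + B2 * (2 * pi)"
    unfolding eq norm_minus_cancel using s1 s2 unfolding n by (intro norm_triangle_le) linarith
  finally have "2 * pi * \<bar>integral {-R..R} ?h - p powr (a - 1) / (p powr a + 1)\<bar> \<le> 2 * pi * (B1 + B2)"
    by (simp add: algebra_simps)
  then show ?thesis unfolding B1_def B2_def by simp
qed

lemma nn_integral_limit_symmetric_intervals: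
  fixes h :: "real \<Rightarrow> real"
  assumes cont: "continuous_on UNIV h" and nonneg: "\<And>x. 0 \<le> h x"
    and lim: "(\<lambda>n. integral {- real n..real n} h) \<longlonglongrightarrow> I"
  shows "(\<integral>\<^sup>+x. ennreal (h x) \<partial>lborel) = ennreal I"
proof -
  have meas: "h \<in> borel_measurable borel"
    using cont by (rule borel_measurable_continuous_onI)
  have 1: "(\<lambda>n. \<integral>\<^sup>+x. ennreal (h x) * indicator {- real n..real n} x \<partial>lborel) \<longlonglongrightarrow> (\<integral>\<^sup>+x. ennreal (h x) \<partial>lborel)"
  proof (rule nn_integral_LIMSEQ)
    show "incseq (\<lambda>n x. ennreal (h x) * indicator {- real n..real n} x)"
      by (auto simp: incseq_def le_fun_def indicator_def)
    show "(\<lambda>n. ennreal (h x) * indicator {- real n..real n} x) \<longlonglongrightarrow> ennreal (h x)" for x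
    proof (rule tendsto_eventually)
      obtain N where "\<bar>x\<bar> \<le> real N" using real_arch_simple by blast
      then have "\<forall>n\<ge>N. ennreal (h x) * indicator {- real n..real n} x = ennreal (h x)"
        by (auto simp: indicator_def abs_le_iff)
      then show "\<forall>\<^sub>F n in sequentially. ennreal (h x) * indicator {- real n..real n} x = ennreal (h x)"
        unfolding eventually_sequentially by blast
    qed
  qed (use meas in measurable)
  have 2: "(\<integral>\<^sup>+x. ennreal (h x) * indicator {- real n..real n} x \<partial>lborel) = ennreal (integral {- real n..real n} h)" for n
  proof -
    have "(h has_integral integral {- real n..real n} h) {- real n..real n}"
      by (intro integrable_integral integrable_continuous_interval continuous_on_subset[OF cont]) auto
    then have "((\<lambda>x. h x * indicator {- real n..real n} x) has_integral integral {- real n..real n} h) UNIV"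
      by (subst (asm) has_integral_restrict_UNIV[symmetric])
         (simp add: indicator_def of_bool_def if_distrib cong: if_cong)
    then have "(\<integral>\<^sup>+x. ennreal (h x * indicator {- real n..real n} x) \<partial>lborel) = ennreal (integral {- real n..real n} h)"
      using meas nonneg by (intro nn_integral_has_integral_lborel) auto
    then show ?thesis by (simp add: ennreal_mult' nonneg ennreal_indicator)
  qed
  have "(\<lambda>n. ennreal (integral {- real n..real n} h)) \<longlonglongrightarrow> ennreal I"
    using lim by simp
  then show ?thesis using 1 unfolding 2 by (rule LIMSEQ_unique[rotated])
qed

text \<open>The bound for the vertical sides tends to \<open>0\<close> as the rectangle grows.\<close>

lemma nn_integral_ml_kernel_stieltjes:
  assumes a: "0 < a" "a < 1" and p: "0 < p"
  shows "(\<integral>\<^sup>+u. ennreal (ml_kernel a u / (p + exp u)) \<partial>lborel) = ennreal (p powr (a - 1) / (p powr a + 1))"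
proof (rule nn_integral_limit_symmetric_intervals)
  show "continuous_on UNIV (\<lambda>u. ml_kernel a u / (p + exp u))"
    using add_pos_pos[OF p exp_gt_zero] by (intro continuous_intros ml_kernel_continuous[OF a]) (auto simp: less_le)
  show "0 \<le> ml_kernel a u / (p + exp u)" for u
    using ml_kernel_pos[OF a, of u] add_pos_pos[OF p exp_gt_zero, of u] by (intro divide_nonneg_pos) auto
  define B where "B = (\<lambda>R. 1 / (1 - exp (- a * R)) / (exp R - p) + exp (- a * R) / (1 - exp (- a * R)) / (p - exp (- R)))"
  have "(B \<longlongrightarrow> 0) at_top"
    unfolding B_def using a p by real_asymp
  then have B0: "(\<lambda>n. B (real n)) \<longlonglongrightarrow> 0"
    by (rule filterlim_compose[OF _ filterlim_real_sequentially])
  have "\<forall>\<^sub>F n in sequentially. real n > \<bar>ln p\<bar>"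
    using filterlim_real_sequentially unfolding filterlim_at_top_dense by blast
  then have ev: "\<forall>\<^sub>F n in sequentially. norm (integral {- real n..real n} (\<lambda>u. ml_kernel a u / (p + exp u)) - p powr (a - 1) / (p powr a + 1)) \<le> B (real n)"
    by eventually_elim (use integral_stieltjes_error[OF a p] in \<open>simp add: B_def\<close>)
  show "(\<lambda>n. integral {- real n..real n} (\<lambda>u. ml_kernel a u / (p + exp u))) \<longlonglongrightarrow> p powr (a - 1) / (p powr a + 1)"
    by (rule LIM_zero_cancel, rule Lim_null_comparison[OF ev B0])
qed

section \<open>Mixtures of exponentials\<close>

lemma ml_kernel_measurable [measurable]:
  assumes "0 < a" "a < 1" and f: "f \<in> borel_measurable M"
  shows "(\<lambda>x. ml_kernel a (f x)) \<in> borel_measurable M"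
  using measurable_compose[OF f borel_measurable_continuous_onI[OF ml_kernel_continuous[OF assms(1,2)]]] .

text \<open>Multiplying the Stieltjes transform by \<open>p\<close> and letting \<open>p\<close> tend to infinity recovers the total mass, because
\<open>p / (p + exp u)\<close> increases to \<open>1\<close>.\<close>

lemma nn_integral_ml_kernel:
  assumes a: "0 < a" "a < 1"
  shows "(\<integral>\<^sup>+u. ennreal (ml_kernel a u) \<partial>lborel) = 1"
proof -
  note [measurable] = ml_kernel_measurable[OF a]
  define f where "f = (\<lambda>n u. ennreal ((real n + 1) * (ml_kernel a u / ((real n + 1) + exp u))))"
  have kp: "0 \<le> ml_kernel a u" for u using ml_kernel_pos[OF a, of u] by simp
  have "(\<lambda>n. integral\<^sup>N lborel (f n)) \<longlonglongrightarrow> (\<integral>\<^sup>+u. ennreal (ml_kernel a u) \<partial>lborel)"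
  proof (rule nn_integral_LIMSEQ)
    show "incseq f"
      unfolding f_def
    proof (intro incseq_SucI le_funI ennreal_leI)
      fix n u
      define q where "q = real n + 1"
      have q: "q > 0" unfolding q_def by simp
      have "q / (q + exp u) \<le> (q + 1) / ((q + 1) + exp u)"
        using q by (simp add: divide_simps add_pos_pos) (simp add: algebra_simps)
      from mult_left_mono[OF this kp[of u]]
      show "(real n + 1) * (ml_kernel a u / (real n + 1 + exp u)) \<le> (real (Suc n) + 1) * (ml_kernel a u / (real (Suc n) + 1 + exp u))"
        unfolding q_def by (simp add: algebra_simps)
    qed
    show "(\<lambda>n. f n u) \<longlonglongrightarrow> ennreal (ml_kernel a u)" for u
    proof -
      have "(\<lambda>n. (real n + 1) / ((real n + 1) + exp u)) \<longlonglongrightarrow> 1" by real_asymp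
      from tendsto_mult[OF this tendsto_const[of "ml_kernel a u"]]
      have "(\<lambda>n. (real n + 1) * (ml_kernel a u / ((real n + 1) + exp u))) \<longlonglongrightarrow> ml_kernel a u"
        by (simp add: mult_ac)
      then show ?thesis unfolding f_def by (intro tendsto_ennrealI)
    qed
  qed (simp add: f_def)
  moreover have "integral\<^sup>N lborel (f n) = ennreal ((real n + 1) * ((real n + 1) powr (a - 1) / ((real n + 1) powr a + 1)))" for n
  proof -
    have "integral\<^sup>N lborel (f n) = (\<integral>\<^sup>+u. ennreal (real n + 1) * ennreal (ml_kernel a u / ((real n + 1) + exp u)) \<partial>lborel)"
      unfolding f_def by (intro nn_integral_cong ennreal_mult') simp
    also have "\<dots> = ennreal (real n + 1) * (\<integral>\<^sup>+u. ennreal (ml_kernel a u / ((real n + 1) + exp u)) \<partial>lborel)"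
      by (rule nn_integral_cmult) measurable
    also have "\<dots> = ennreal (real n + 1) * ennreal ((real n + 1) powr (a - 1) / ((real n + 1) powr a + 1))"
      by (subst nn_integral_ml_kernel_stieltjes[OF a]) simp_all
    also have "\<dots> = ennreal ((real n + 1) * ((real n + 1) powr (a - 1) / ((real n + 1) powr a + 1)))"
      by (rule ennreal_mult'[symmetric]) simp
    finally show ?thesis .
  qed
  moreover have "(\<lambda>n. ennreal ((real n + 1) * ((real n + 1) powr (a - 1) / ((real n + 1) powr a + 1)))) \<longlonglongrightarrow> ennreal 1"
    using a by (intro tendsto_ennrealI) real_asymp
  ultimately show ?thesis using LIMSEQ_unique by fastforce
qed

lemma has_bochner_integral_ml_kernel:
  assumes a: "0 < a" "a < 1"
  shows "has_bochner_integral lborel (ml_kernel a) 1"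
  using nn_integral_ml_kernel[OF a] ml_kernel_pos[OF a]
  by (intro has_bochner_integral_nn_integral ml_kernel_measurable a) (auto simp: less_imp_le)

definition ml_mixture :: "real \<Rightarrow> real \<Rightarrow> real" where
  "ml_mixture a t = (LINT u|lborel. exp (- t * exp u) * ml_kernel a u)"

context
  fixes a :: real
  assumes a: "0 < a" "a < 1"
begin

lemma ml_mixture_integrable:
  assumes "0 \<le> t"
  shows "integrable lborel (\<lambda>u. exp (- t * exp u) * ml_kernel a u)"
proof (rule Bochner_Integration.integrable_bound)
  note [measurable] = ml_kernel_measurable[OF a]
  show "integrable lborel (ml_kernel a)" using has_bochner_integral_ml_kernel[OF a] by (rule integrable.intros)
  show "AE u in lborel. norm (exp (- t * exp u) * ml_kernel a u) \<le> norm (ml_kernel a u)"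
    using assms by (intro AE_I2) (auto simp: abs_mult intro!: mult_left_le_one_le)
  show "(\<lambda>u. exp (- t * exp u) * ml_kernel a u) \<in> borel_measurable lborel" by measurable
qed

lemma nn_integral_ml_mixture:
  assumes "0 \<le> t"
  shows "(\<integral>\<^sup>+u. ennreal (exp (- t * exp u) * ml_kernel a u) \<partial>lborel) = ennreal (ml_mixture a t)"
  unfolding ml_mixture_def using ml_kernel_pos[OF a]
  by (intro nn_integral_eq_integral ml_mixture_integrable assms) (auto simp: less_imp_le)

lemma ml_mixture_nonneg: "0 \<le> ml_mixture a t"
  unfolding ml_mixture_def using ml_kernel_pos[OF a] by (intro Bochner_Integration.integral_nonneg) (auto simp: less_imp_le)

lemma ml_mixture_zero: "ml_mixture a 0 = 1"
  unfolding ml_mixture_def using has_bochner_integral_ml_kernel[OF a] by (simp add: has_bochner_integral_integral_eq)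

lemma ml_mixture_antimono:
  assumes "0 \<le> s" "s \<le> t"
  shows "ml_mixture a t \<le> ml_mixture a s"
  unfolding ml_mixture_def using assms ml_kernel_pos[OF a]
  by (intro integral_mono ml_mixture_integrable mult_right_mono) (auto simp: less_imp_le)

lemma ml_mixture_le_one: "0 \<le> t \<Longrightarrow> ml_mixture a t \<le> 1"
  using ml_mixture_antimono[of 0 t] ml_mixture_zero by simp

lemma continuous_on_ml_mixture: "continuous_on {0..} (ml_mixture a)"
  unfolding continuous_on_sequentially
proof (intro ballI allI impI, elim conjE)
  note [measurable] = ml_kernel_measurable[OF a]
  fix X :: "nat \<Rightarrow> real" and t assume X: "\<forall>n. X n \<in> {0..}" and lim: "X \<longlonglongrightarrow> t"
  show "(ml_mixture a \<circ> X) \<longlonglongrightarrow> ml_mixture a t"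
    unfolding ml_mixture_def[abs_def] o_def
  proof (rule integral_dominated_convergence)
    show "integrable lborel (ml_kernel a)" using has_bochner_integral_ml_kernel[OF a] by (rule integrable.intros)
    show "AE u in lborel. norm (exp (- X n * exp u) * ml_kernel a u) \<le> ml_kernel a u" for n
      using X ml_kernel_pos[OF a] by (intro AE_I2) (auto simp: abs_mult less_imp_le intro!: mult_left_le_one_le)
    show "AE u in lborel. (\<lambda>n. exp (- X n * exp u) * ml_kernel a u) \<longlonglongrightarrow> exp (- t * exp u) * ml_kernel a u"
      by (intro AE_I2 tendsto_intros lim)
  qed measurable
qed

lemma ml_mixture_measurable: "ml_mixture a \<in> borel_measurable half_line"
proof -
  have "ml_mixture a \<in> borel_measurable (restrict_space borel {0<..})"
    by (rule borel_measurable_continuous_on_restrict[OF continuous_on_subset[OF continuous_on_ml_mixture]]) auto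
  then show ?thesis by (simp add: measurable_def sets_restrict_space space_restrict_space)
qed

text \<open>By Tonelli the Laplace transform of a mixture of exponentials is the Stieltjes transform of the
mixing kernel.\<close>

lemma laplace_ml_mixture:
  assumes p: "0 < p"
  shows "(\<integral>\<^sup>+t. ennreal (exp (- p * t) * ml_mixture a t) \<partial>half_line) = ennreal (p powr (a - 1) / (p powr a + 1))"
proof -
  note [measurable] = ml_kernel_measurable[OF a]
  have kp: "0 \<le> ml_kernel a u" for u using ml_kernel_pos[OF a, of u] by simp
  have "(\<integral>\<^sup>+t. ennreal (exp (- p * t) * ml_mixture a t) \<partial>half_line)
     = (\<integral>\<^sup>+t. \<integral>\<^sup>+u. ennreal (exp (- (p + exp u) * t) * ml_kernel a u) \<partial>lborel \<partial>half_line)"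
  proof (intro nn_integral_cong)
    fix t assume "t \<in> space half_line"
    then have t: "t > 0" by simp
    have "ennreal (exp (- p * t) * ml_mixture a t) = ennreal (exp (- p * t)) * (\<integral>\<^sup>+u. ennreal (exp (- t * exp u) * ml_kernel a u) \<partial>lborel)"
      using t by (subst nn_integral_ml_mixture) (auto simp: ennreal_mult')
    also have "\<dots> = (\<integral>\<^sup>+u. ennreal (exp (- p * t)) * ennreal (exp (- t * exp u) * ml_kernel a u) \<partial>lborel)"
      by (rule nn_integral_cmult[symmetric]) measurable
    also have "\<dots> = (\<integral>\<^sup>+u. ennreal (exp (- (p + exp u) * t) * ml_kernel a u) \<partial>lborel)"
    proof (intro nn_integral_cong)
      fix u :: real
      have "exp (- (p + exp u) * t) = exp (- p * t) * exp (- t * exp u)"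
        by (subst exp_add[symmetric]) (simp add: algebra_simps)
      then show "ennreal (exp (- p * t)) * ennreal (exp (- t * exp u) * ml_kernel a u) = ennreal (exp (- (p + exp u) * t) * ml_kernel a u)"
        by (simp add: ennreal_mult'[symmetric] mult.assoc)
    qed
    finally show "ennreal (exp (- p * t) * ml_mixture a t) = \<dots>" .
  qed
  also have "\<dots> = (\<integral>\<^sup>+u. \<integral>\<^sup>+t. ennreal (exp (- (p + exp u) * t) * ml_kernel a u) \<partial>half_line \<partial>lborel)"
    by (rule half_line_lborel.Fubini'[symmetric], rule borel_measurable_half_line_pair) measurable
  also have "\<dots> = (\<integral>\<^sup>+u. ennreal (ml_kernel a u / (p + exp u)) \<partial>lborel)"
  proof (intro nn_integral_cong)
    fix u :: real
    have q: "p + exp u > 0" using p by (simp add: add_pos_pos)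
    have "(\<integral>\<^sup>+t. ennreal (exp (- (p + exp u) * t) * ml_kernel a u) \<partial>half_line)
       = (\<integral>\<^sup>+t. ennreal (ml_kernel a u) * ennreal (t powr (1 - 1) * exp (- (p + exp u) * t)) \<partial>half_line)"
      by (intro nn_integral_cong) (simp add: ennreal_mult'[symmetric] kp mult.commute)
    also have "\<dots> = ennreal (ml_kernel a u) * (\<integral>\<^sup>+t. ennreal (t powr (1 - 1) * exp (- (p + exp u) * t)) \<partial>half_line)"
      by (rule nn_integral_cmult) measurable
    also have "\<dots> = ennreal (ml_kernel a u / (p + exp u))"
      by (subst nn_integral_Gamma) (use q kp in \<open>auto simp: ennreal_mult'[symmetric] powr_minus divide_inverse\<close>)
    finally show "(\<integral>\<^sup>+t. ennreal (exp (- (p + exp u) * t) * ml_kernel a u) \<partial>half_line) = \<dots>" .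
  qed
  also have "\<dots> = ennreal (p powr (a - 1) / (p powr a + 1))"
    by (rule nn_integral_ml_kernel_stieltjes[OF a p])
  finally show ?thesis .
qed

end

section \<open>Injectivity of the Laplace transform\<close>

lemma continuous_AE_zero_imp_zero:
  fixes h :: "real \<Rightarrow> real"
  assumes cont: "continuous_on {0<..} h" and ae: "AE t in half_line. h t = 0" and t: "0 < t"
  shows "h t = 0"
proof (rule ccontr)
  assume nz: "h t \<noteq> 0"
  define U where "U = {0<..} \<inter> h -` (- {0})"
  have "open U"
    unfolding U_def by (rule continuous_open_preimage[OF cont]) auto
  moreover have "t \<in> U" using nz t unfolding U_def by auto
  ultimately have nn: "\<not> negligible U" using open_not_negligible[of U] by auto
  have "AE t in lborel. t \<in> {0<..} \<longrightarrow> h t = 0"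
    using ae by (subst (asm) AE_restrict_space_iff) auto
  then obtain N where N: "{t \<in> space lborel. \<not> (t \<in> {0<..} \<longrightarrow> h t = 0)} \<subseteq> N" "emeasure lborel N = 0" "N \<in> sets lborel"
    by (rule AE_E)
  then have "N \<in> null_sets lebesgue" by (intro null_sets_completionI) auto
  then have "negligible N" by (simp add: negligible_iff_null_sets)
  moreover have "U \<subseteq> N" using N(1) unfolding U_def by auto
  ultimately show False using nn negligible_subset by blast
qed

text \<open>In the variable \<open>u = exp (- t)\<close> the hypothesis says that \<open>h\<close> is orthogonal to all high powers of \<open>u\<close>. By
Weierstrass approximation it is then orthogonal to (a damped version of) itself.\<close>

lemma laplace_transform_injective:
  fixes h :: "real \<Rightarrow> real"
  assumes cont: "continuous_on {0..} h"
    and bound: "\<And>t. 0 \<le> t \<Longrightarrow> \<bar>h t\<bar> \<le> C * exp (c * t)" and c: "0 \<le> c"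
    and zero: "\<And>p. q < p \<Longrightarrow> (LINT t|half_line. exp (- p * t) * h t) = 0"
    and t: "0 < t"
  shows "h t = 0"
proof -
  have C: "0 \<le> C" using bound[of 0] by simp
  have hm [measurable]: "h \<in> borel_measurable half_line"
  proof -
    have "h \<in> borel_measurable (restrict_space borel {0<..})"
      by (rule borel_measurable_continuous_on_restrict[OF continuous_on_subset[OF cont]]) auto
    then show ?thesis by (simp add: measurable_def sets_restrict_space space_restrict_space)
  qed
  have int: "integrable half_line (\<lambda>t. exp (- p * t) * h t)" if "p > c" for p
  proof (rule Bochner_Integration.integrable_bound)
    have "integrable half_line (\<lambda>t. C * (t powr (1 - 1) * exp (- (p - c) * t)))"
      using that by (intro integrable_mult_right integrable.intros[OF has_bochner_integral_Gamma]) auto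
    also have "?this \<longleftrightarrow> integrable half_line (\<lambda>t. C * exp (- (p - c) * t))"
      by (rule Bochner_Integration.integrable_cong[OF refl]) simp
    finally show "integrable half_line (\<lambda>t. C * exp (- (p - c) * t))" .
    show "AE t in half_line. norm (exp (- p * t) * h t) \<le> norm (C * exp (- (p - c) * t))"
    proof (intro AE_I2)
      fix t assume "t \<in> space half_line"
      then have "\<bar>h t\<bar> * exp (- p * t) \<le> (C * exp (c * t)) * exp (- p * t)"
        using bound[of t] by (intro mult_right_mono) auto
      also have "exp (c * t) * exp (- p * t) = exp (- (p - c) * t)"
        by (subst exp_add[symmetric]) (simp add: algebra_simps)
      then have "(C * exp (c * t)) * exp (- p * t) = C * exp (- (p - c) * t)" by simp
      finally show "norm (exp (- p * t) * h t) \<le> norm (C * exp (- (p - c) * t))"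
        using C by (simp add: abs_mult mult.commute)
    qed
  qed measurable
  \<comment> \<open>The factor \<open>u powr (c + 1)\<close> outweighs the growth of \<open>h\<close>, so \<open>g\<close> extends continuously by \<open>0\<close> to \<open>u = 0\<close>.\<close>
  define g where "g = (\<lambda>u. if u = 0 then 0 else u powr (c + 1) * h (- ln u))"
  have contg: "continuous_on {0..1} g"
    unfolding continuous_on_eq_continuous_within
  proof
    fix u :: real assume u: "u \<in> {0..1}"
    show "continuous (at u within {0..1}) g"
    proof (cases "u = 0")
      case True
      have "\<forall>\<^sub>F v in at 0 within {0..1}. norm (g v) \<le> C * v"
        unfolding eventually_at_filter
      proof (intro always_eventually allI impI)
        fix v :: real assume v: "v \<noteq> 0" "v \<in> {0..1}"
        then have "\<bar>h (- ln v)\<bar> \<le> C * exp (c * (- ln v))" by (intro bound) auto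
        also have "exp (c * (- ln v)) = v powr (- c)" using v by (simp add: powr_def)
        finally have "v powr (c + 1) * \<bar>h (- ln v)\<bar> \<le> v powr (c + 1) * (C * v powr (- c))"
          by (intro mult_left_mono) auto
        also have "\<dots> = C * v" using v by (simp add: powr_add powr_minus)
        finally show "norm (g v) \<le> C * v" using v unfolding g_def by (simp add: abs_mult)
      qed
      moreover have "((\<lambda>v. C * v) \<longlongrightarrow> 0) (at 0 within {0..1})"
        by (rule tendsto_eq_intros tendsto_ident_at refl | simp)+
      ultimately have "(g \<longlongrightarrow> 0) (at 0 within {0..1})" by (rule Lim_null_comparison)
      then show ?thesis using True unfolding continuous_within by (simp add: g_def)
    next
      case False
      have "continuous_on {0<..1} (\<lambda>u. u powr (c + 1) * h (- ln u))"
        by (intro continuous_intros continuous_on_compose2[OF cont]) auto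
      then have "continuous_on {0<..1} g"
        by (rule continuous_on_eq) (auto simp: g_def)
      then have "continuous (at u within {0<..1}) g"
        using u False by (simp add: continuous_on_eq_continuous_within)
      moreover have "at u within {0<..1} = at u within {0..1}"
        using u False by (intro at_within_nhd[of u "{0<..}"]) auto
      ultimately show ?thesis by simp
    qed
  qed
  \<comment> \<open>Beyond \<open>q\<close> the transform vanishes, beyond \<open>c\<close> it converges; all exponents \<open>r + i\<close> qualify.\<close>
  define r where "r = max q c + 1"
  have r: "r > q" "r > c" unfolding r_def by auto
  have g_exp: "g (exp (- t)) = exp (- (c + 1) * t) * h t" for t
    unfolding g_def by (simp add: powr_def algebra_simps)
  define I where "I = (LINT t|half_line. exp (- r * t) * g (exp (- t)) * h t)"
  define K where "K = (LINT t|half_line. norm (exp (- r * t) * h t))"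
  have K0: "K \<ge> 0" unfolding K_def by (rule Bochner_Integration.integral_nonneg) auto
  have gm [measurable]: "(\<lambda>t. g (exp (- t))) \<in> borel_measurable half_line"
    unfolding g_exp by measurable
  have "bounded (g ` {0..1})"
    by (rule compact_imp_bounded[OF compact_continuous_image[OF contg compact_Icc]])
  then obtain G where "\<forall>x\<in>g ` {0..1}. norm x \<le> G"
    unfolding bounded_iff by blast
  then have G: "norm (g u) \<le> G" if "u \<in> {0..1}" for u using that by blast
  have intI: "integrable half_line (\<lambda>t. exp (- r * t) * g (exp (- t)) * h t)"
  proof (rule Bochner_Integration.integrable_bound)
    show "integrable half_line (\<lambda>t. G * (exp (- r * t) * h t))"
      by (intro integrable_mult_right int r)
    have "norm (g (exp (- t))) \<le> \<bar>G\<bar>" if "t > 0" for t using G[of "exp (- t)"] that by simp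
    then show "AE t in half_line. norm (exp (- r * t) * g (exp (- t)) * h t) \<le> norm (G * (exp (- r * t) * h t))"
    proof (intro AE_I2)
      fix t assume "t \<in> space half_line"
      then have "norm (g (exp (- t))) * norm (exp (- r * t) * h t) \<le> \<bar>G\<bar> * norm (exp (- r * t) * h t)"
        using \<open>\<And>t. 0 < t \<Longrightarrow> norm (g (exp (- t))) \<le> \<bar>G\<bar>\<close> by (intro mult_right_mono) auto
      then show "norm (exp (- r * t) * g (exp (- t)) * h t) \<le> norm (G * (exp (- r * t) * h t))"
        by (simp add: abs_mult mult_ac)
    qed
  qed measurable
  have small: "\<bar>I\<bar> \<le> e * K" if e: "e > 0" for e
  proof -
    obtain P where P: "real_polynomial_function P" "\<And>u. u \<in> {0..1} \<Longrightarrow> \<bar>g u - P u\<bar> < e"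
      by (rule Stone_Weierstrass_real_polynomial_function[OF compact_Icc contg e]) blast
    obtain cs n where Pc: "P = (\<lambda>x. \<Sum>i\<le>n. cs i * x ^ i)"
      using P(1) unfolding real_polynomial_function_iff_sum by blast
    have eqP: "exp (- r * t) * P (exp (- t)) * h t = (\<Sum>i\<le>n. cs i * (exp (- (r + real i) * t) * h t))" for t
    proof -
      have "exp (- r * t) * (cs i * exp (- t) ^ i) * h t = cs i * (exp (- (r + real i) * t) * h t)" for i
      proof -
        have "exp (- (r + real i) * t) = exp (- r * t + real i * (- t))" by (simp add: algebra_simps)
        also have "\<dots> = exp (- r * t) * exp (- t) ^ i" by (simp only: exp_add exp_of_nat_mult)
        finally show ?thesis by simp
      qed
      then show ?thesis unfolding Pc sum_distrib_left sum_distrib_right by (intro sum.cong refl)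
    qed
    have intP: "integrable half_line (\<lambda>t. exp (- r * t) * P (exp (- t)) * h t)"
      unfolding eqP by (intro Bochner_Integration.integrable_sum integrable_mult_right int) (use r in auto)
    have "(LINT t|half_line. exp (- r * t) * P (exp (- t)) * h t) = (\<Sum>i\<le>n. cs i * (LINT t|half_line. exp (- (r + real i) * t) * h t))"
      unfolding eqP
    proof (subst Bochner_Integration.integral_sum)
      show "integrable half_line (\<lambda>t. cs i * (exp (- (r + real i) * t) * h t))" for i
        by (intro integrable_mult_right int) (use r in auto)
    qed simp
    also have "\<dots> = 0"
    proof (intro sum.neutral ballI)
      fix i
      have "q < r + real i" using r by simp
      then show "cs i * (LINT t|half_line. exp (- (r + real i) * t) * h t) = 0" by (simp only: zero mult_zero_right)
    qed
    finally have "I = (LINT t|half_line. exp (- r * t) * g (exp (- t)) * h t - exp (- r * t) * P (exp (- t)) * h t)"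
      unfolding I_def using intI intP by simp
    also have "\<bar>\<dots>\<bar> \<le> (LINT t|half_line. e * norm (exp (- r * t) * h t))"
    proof (rule integral_abs_bound_integral)
      show "integrable half_line (\<lambda>t. exp (- r * t) * g (exp (- t)) * h t - exp (- r * t) * P (exp (- t)) * h t)"
        using intI intP by simp
      show "integrable half_line (\<lambda>t. e * norm (exp (- r * t) * h t))"
        by (intro integrable_mult_right integrable_norm int r)
      fix t assume "t \<in> space half_line"
      then have "\<bar>g (exp (- t)) - P (exp (- t))\<bar> \<le> e" using P(2)[of "exp (- t)"] by simp
      then have "\<bar>g (exp (- t)) - P (exp (- t))\<bar> * norm (exp (- r * t) * h t) \<le> e * norm (exp (- r * t) * h t)"
        by (rule mult_right_mono) auto
      also have "\<bar>g (exp (- t)) - P (exp (- t))\<bar> * norm (exp (- r * t) * h t) = \<bar>exp (- r * t) * g (exp (- t)) * h t - exp (- r * t) * P (exp (- t)) * h t\<bar>"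
        unfolding real_norm_def abs_mult[symmetric] by (simp add: algebra_simps)
      finally show "\<bar>exp (- r * t) * g (exp (- t)) * h t - exp (- r * t) * P (exp (- t)) * h t\<bar> \<le> e * norm (exp (- r * t) * h t)" .
    qed
    also have "\<dots> = e * K" unfolding K_def by (rule integral_mult_right_zero)
    finally show ?thesis .
  qed
  have "I = 0"
  proof (rule ccontr)
    assume "I \<noteq> 0"
    then have "\<bar>I\<bar> * (K / (2 * (K + 1))) < \<bar>I\<bar> * 1"
      using K0 by (intro mult_strict_left_mono) (auto simp: divide_less_eq)
    with small[of "\<bar>I\<bar> / (2 * (K + 1))"] \<open>I \<noteq> 0\<close> K0 show False by simp
  qed
  have sq: "exp (- r * t) * g (exp (- t)) * h t = exp (- r * t) * exp (- (c + 1) * t) * (h t)\<^sup>2" for t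
    unfolding g_exp by (simp add: power2_eq_square)
  have "AE t in half_line. exp (- r * t) * g (exp (- t)) * h t = 0"
  proof -
    have "AE t in half_line. 0 \<le> exp (- r * t) * g (exp (- t)) * h t"
      unfolding sq by simp
    from integral_nonneg_eq_0_iff_AE[OF intI this] \<open>I = 0\<close> show ?thesis unfolding I_def by blast
  qed
  then have "AE t in half_line. h t = 0" unfolding sq by simp
  moreover have "continuous_on {0<..} h" by (rule continuous_on_subset[OF cont]) auto
  ultimately show ?thesis by (intro continuous_AE_zero_imp_zero t)
qed

section \<open>The Mittag-Leffler function as a mixture of exponentials\<close>

lemma mittag_leffler_mono:
  assumes "0 < a" "0 \<le> x" "x \<le> y"
  shows "mittag_leffler a x \<le> mittag_leffler a y"
  using assms Gamma_real_pos[of "a * real k + 1" for k]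
  by (intro sums_le[OF _ mittag_leffler_sums mittag_leffler_sums] divide_right_mono power_mono)
     (auto intro!: less_imp_le[OF Gamma_real_pos] add_nonneg_pos)

lemma abs_mittag_leffler_le:
  assumes a: "0 < a"
  shows "\<bar>mittag_leffler a x\<bar> \<le> mittag_leffler a \<bar>x\<bar>"
proof -
  have eq: "norm (x ^ k / Gamma (a * real k + 1)) = \<bar>x\<bar> ^ k / Gamma (a * real k + 1)" for k
    using Gamma_real_pos[OF add_nonneg_pos[of "a * real k" 1]] a by (simp add: power_abs)
  show ?thesis
    using summable_norm[OF summable_mittag_leffler[OF a, of x]] unfolding eq
    by (simp add: mittag_leffler_def)
qed

text \<open>The function increases, so its average over \<open>[t, t + 1]\<close> bounds its value at \<open>t\<close>; the Laplace transform at
\<open>2\<close> bounds the average.\<close>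

lemma mittag_leffler_exponential_growth:
  assumes a: "0 < a"
  obtains C where "\<And>t. 0 \<le> t \<Longrightarrow> \<bar>mittag_leffler a (t powr a)\<bar> \<le> C * exp (2 * t)"
proof
  let ?E = "\<lambda>t. mittag_leffler a (t powr a)"
  let ?K = "LINT s|half_line. exp (- 2 * s) * mittag_leffler a (1 * s powr a)"
  fix t :: real assume t: "0 \<le> t"
  have E0: "0 \<le> ?E s" for s using abs_mittag_leffler_le[OF a, of "s powr a"] by simp
  have int: "integrable half_line (\<lambda>s. exp (- 2 * s) * mittag_leffler a (1 * s powr a))"
    by (rule laplace_mittag_leffler_large) (use a in auto)
  have "exp (- 2 * (t + 1)) * ?E t = (LINT s|half_line. indicator {t<..t + 1} s *\<^sub>R (exp (- 2 * (t + 1)) * ?E t))"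
  proof -
    have "measure half_line {t<..t + 1} = measure lborel {t<..t+1}"
      using t by (intro measure_restrict_space) auto
    then have "measure half_line {t<..t + 1} = 1" by simp
    then show ?thesis using t by (simp add: sets_restrict_space_iff Int_absorb2 subset_eq)
  qed
  also have "\<dots> \<le> ?K"
  proof (rule integral_mono_AE')
    show "integrable half_line (\<lambda>s. exp (- 2 * s) * mittag_leffler a (1 * s powr a))" by (rule int)
    show "AE s in half_line. indicator {t<..t + 1} s *\<^sub>R (exp (- 2 * (t + 1)) * ?E t) \<le> exp (- 2 * s) * mittag_leffler a (1 * s powr a)"
      using t a E0 by (intro AE_I2) (auto simp: indicator_def intro!: mult_mono mittag_leffler_mono powr_mono2)
    show "AE s in half_line. 0 \<le> exp (- 2 * s) * mittag_leffler a (1 * s powr a)"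
      using E0 by simp
  qed
  finally have "exp (2 * (t + 1)) * (exp (- 2 * (t + 1)) * ?E t) \<le> exp (2 * (t + 1)) * ?K"
    by (intro mult_left_mono) auto
  moreover have "exp (2 * (t + 1)) * exp (- 2 * (t + 1)) = 1"
    by (subst exp_add[symmetric]) simp
  ultimately have "?E t \<le> exp (2 * (t + 1)) * ?K"
    by (simp only: mult.assoc[symmetric] mult_1_left)
  also have "\<dots> = ?K * exp 2 * exp (2 * t)" by (simp add: exp_add algebra_simps)
  finally show "\<bar>?E t\<bar> \<le> ?K * exp 2 * exp (2 * t)" using E0[of t] by simp
qed

text \<open>The difference of the two sides is continuous, grows at most exponentially, and has vanishing Laplace
transform on \<open>(1, \<infinity>)\<close>.\<close>

theorem mittag_leffler_eq_ml_mixture: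
  assumes a: "0 < a" "a < 1" and t: "0 \<le> t"
  shows "mittag_leffler a (- (t powr a)) = ml_mixture a t"
proof (cases "t = 0")
  case True
  then show ?thesis using ml_mixture_zero[OF a] by (simp add: mittag_leffler_zero)
next
  case False
  with t have t: "0 < t" by simp
  define h where "h = (\<lambda>t. mittag_leffler a (- (t powr a)) - ml_mixture a t)"
  obtain C where C: "\<And>t. 0 \<le> t \<Longrightarrow> \<bar>mittag_leffler a (t powr a)\<bar> \<le> C * exp (2 * t)"
    using mittag_leffler_exponential_growth[OF a(1)] by blast
  have "h t = 0"
  proof (rule laplace_transform_injective[where h = h and t = t and C = "C + 1" and c = 2 and q = 1])
    show "continuous_on {0..} h"
    proof -
      have "continuous_on {0..} (\<lambda>t::real. - (t powr a))"
        by (intro continuous_intros continuous_on_powr') (use a in auto)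
      then have "continuous_on {0..} (\<lambda>t. mittag_leffler a (- (t powr a)))"
        by (rule continuous_on_compose2[OF continuous_mittag_leffler[OF a(1), of UNIV]]) auto
      then show ?thesis unfolding h_def by (intro continuous_on_diff continuous_on_ml_mixture a)
    qed
    show "\<bar>h t\<bar> \<le> (C + 1) * exp (2 * t)" if t: "0 \<le> t" for t
    proof -
      have "\<bar>mittag_leffler a (- (t powr a))\<bar> \<le> mittag_leffler a (t powr a)"
        using abs_mittag_leffler_le[OF a(1), of "- (t powr a)"] by simp
      also have "\<dots> \<le> C * exp (2 * t)" using C[OF t] by simp
      finally have "\<bar>mittag_leffler a (- (t powr a))\<bar> \<le> C * exp (2 * t)" .
      moreover have "\<bar>ml_mixture a t\<bar> \<le> exp (2 * t)"
        using ml_mixture_nonneg[OF a, of t] ml_mixture_le_one[OF a t] t one_le_exp_iff[of "2 * t"] by linarith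
      ultimately show ?thesis unfolding h_def by (simp add: algebra_simps)
    qed
    show "(LINT t|half_line. exp (- p * t) * h t) = 0" if p: "1 < p" for p
    proof -
      have p0: "0 < p" using p by simp
      have hb: "has_bochner_integral half_line (\<lambda>t. exp (- p * t) * ml_mixture a t) (p powr (a - 1) / (p powr a + 1))"
        using laplace_ml_mixture[OF a p0] ml_mixture_nonneg[OF a] ml_mixture_measurable[OF a]
        by (intro has_bochner_integral_nn_integral) (auto intro!: divide_nonneg_pos add_nonneg_pos)
      have eq: "exp (- p * t) * h t = exp (- p * t) * mittag_leffler a (-1 * t powr a) - exp (- p * t) * ml_mixture a t" for t
        unfolding h_def by (simp add: algebra_simps)
      show ?thesis unfolding eq
        using laplace_mittag_leffler_large[OF a(1) p, of "-1"] has_bochner_integral_integral_eq[OF hb] integrable.intros[OF hb]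
        by (subst Bochner_Integration.integral_diff) auto
    qed
  qed (use t in auto)
  then show ?thesis unfolding h_def by simp
qed

text \<open>The consequences below hold up to and including \<open>a = 1\<close>, where the mixture degenerates to the
  exponential function.\<close>

lemma mittag_leffler_neg_cases:
  assumes a: "0 < a" "a \<le> 1" and t: "0 \<le> t"
  shows "mittag_leffler a (- (t powr a)) = (if a = 1 then exp (- t) else ml_mixture a t)"
  using mittag_leffler_eq_ml_mixture[of a t] assms by (auto simp: mittag_leffler_one)

lemma neg_eq_neg_powr_powr:
  fixes x :: real
  assumes "0 < a" "0 \<le> x"
  shows "- x = - ((x powr (1 / a)) powr a)"
  using assms by (simp add: powr_powr)

lemma mittag_leffler_neg_bounds:
  assumes a: "0 < a" "a \<le> 1" and x: "0 \<le> x"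
  shows "0 \<le> mittag_leffler a (- x)" "mittag_leffler a (- x) \<le> 1"
  unfolding neg_eq_neg_powr_powr[OF a(1) x] mittag_leffler_neg_cases[OF a powr_ge_zero]
  using ml_mixture_nonneg[of a "x powr (1 / a)"] ml_mixture_le_one[of a "x powr (1 / a)"] a by (auto simp: less_le)

lemma mittag_leffler_neg_antimono:
  assumes a: "0 < a" "a \<le> 1" and x: "0 \<le> x" "x \<le> y"
  shows "mittag_leffler a (- y) \<le> mittag_leffler a (- x)"
proof -
  have "x powr (1 / a) \<le> y powr (1 / a)" using x a by (intro powr_mono2) auto
  moreover have y: "0 \<le> y" using x by simp
  ultimately show ?thesis
    unfolding neg_eq_neg_powr_powr[OF a(1) x(1)] neg_eq_neg_powr_powr[OF a(1) y] mittag_leffler_neg_cases[OF a powr_ge_zero]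
    using a ml_mixture_antimono[of a "x powr (1 / a)" "y powr (1 / a)"] by (auto simp: less_le)
qed

lemma laplace_mittag_leffler:
  assumes a: "0 < a" "a \<le> 1" and p: "0 < p"
  shows "(\<integral>\<^sup>+t. ennreal (exp (- p * t) * mittag_leffler a (- (t powr a))) \<partial>half_line) = ennreal (p powr (a - 1) / (p powr a + 1))"
proof (cases "a = 1")
  case False
  have "(\<integral>\<^sup>+t. ennreal (exp (- p * t) * mittag_leffler a (- (t powr a))) \<partial>half_line)
     = (\<integral>\<^sup>+t. ennreal (exp (- p * t) * ml_mixture a t) \<partial>half_line)"
    using False a by (intro nn_integral_cong) (auto simp: mittag_leffler_neg_cases)
  then show ?thesis using laplace_ml_mixture[of a p] False a p by simp
next
  case True
  have "(\<integral>\<^sup>+t. ennreal (exp (- p * t) * mittag_leffler a (- (t powr a))) \<partial>half_line)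
     = (\<integral>\<^sup>+t. ennreal (t powr (1 - 1) * exp (- (p + 1) * t)) \<partial>half_line)"
    using True by (intro nn_integral_cong) (auto simp: mittag_leffler_one exp_add[symmetric] algebra_simps)
  also have "\<dots> = ennreal (Gamma 1 * (p + 1) powr (- 1))"
    using p by (intro nn_integral_Gamma) auto
  finally show ?thesis using p True by (simp add: powr_minus divide_inverse)
qed

text \<open>On \<open>[0, t]\<close> the decreasing function \<open>s \<mapsto> E(- s powr a)\<close> is at least its value at \<open>t\<close> and the
  weight \<open>exp (- s / t)\<close> is at least \<open>exp (- 1)\<close>, so the Laplace transform at \<open>1 / t\<close> bounds
  that value.\<close>

lemma mittag_leffler_neg_upper:
  assumes a: "0 < a" "a \<le> 1" and t: "0 < t"
  shows "mittag_leffler a (- (t powr a)) \<le> exp 1 * t powr (- a)"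
proof -
  let ?E = "\<lambda>t. mittag_leffler a (- (t powr a))"
  have E0: "0 \<le> ?E s" for s using mittag_leffler_neg_bounds[OF a] by simp
  have "ennreal (exp (- 1) * ?E t * t) = (\<integral>\<^sup>+s. ennreal (exp (- 1) * ?E t) * indicator {0<..t} s \<partial>half_line)"
  proof -
    have "emeasure half_line {0<..t} = emeasure lborel {0<..t}"
      using t by (intro emeasure_restrict_space) auto
    then show ?thesis using t E0 by (subst nn_integral_cmult_indicator) (auto simp: sets_restrict_space_iff ennreal_mult'[symmetric] ennreal_mult''[symmetric])
  qed
  also have "\<dots> \<le> (\<integral>\<^sup>+s. ennreal (exp (- (1 / t) * s) * ?E s) \<partial>half_line)"
  proof (intro nn_integral_mono)
    fix s assume "s \<in> space half_line"
    then have s: "s > 0" by simp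
    have "exp (- 1) * ?E t \<le> exp (- (1 / t) * s) * ?E s" if "s \<le> t"
      using that s t E0 a by (intro mult_mono mittag_leffler_neg_antimono a powr_mono2) auto
    then show "ennreal (exp (- 1) * ?E t) * indicator {0<..t} s \<le> ennreal (exp (- (1 / t) * s) * ?E s)"
      by (auto simp: indicator_def intro!: ennreal_leI)
  qed
  also have "\<dots> = ennreal ((1 / t) powr (a - 1) / ((1 / t) powr a + 1))"
    by (rule laplace_mittag_leffler) (use a t in auto)
  also have "\<dots> \<le> ennreal ((1 / t) powr (a - 1))"
    by (intro ennreal_leI) (simp add: divide_le_eq mult_le_cancel_left1 add_nonneg_pos)
  also have "(1 / t) powr (a - 1) = t powr (- a) * t"
    using t by (simp add: powr_divide powr_diff powr_minus field_simps)
  finally have "exp (- 1) * ?E t * t \<le> t powr (- a) * t" using t by (subst (asm) ennreal_le_iff) auto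
  then have "exp (- 1) * ?E t \<le> t powr (- a)" using t by simp
  then have "exp 1 * (exp (- 1) * ?E t) \<le> exp 1 * t powr (- a)" by (intro mult_left_mono) auto
  then show ?thesis by (simp add: mult.assoc[symmetric] exp_minus)
qed

text \<open>The left tail of the kernel governs the decay of the mixture at infinity.\<close>

lemma ml_kernel_lower:
  assumes a: "0 < a" "a < 1" and u: "u \<le> 0"
  shows "sin (a * pi) / (4 * pi) * exp (a * u) \<le> ml_kernel a u"
proof -
  have "cosh (a * u) \<le> exp (- (a * u))"
    using a u by (simp add: cosh_def mult_nonneg_nonpos)
  moreover have "cos (a * pi) \<le> exp (- (a * u))"
    using cos_le_one[of "a * pi"] one_le_exp_iff[of "- (a * u)"] a u mult_nonneg_nonpos[of a u] by linarith
  ultimately have "cosh (a * u) + cos (a * pi) \<le> 2 * exp (- (a * u))" by simp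
  then have "sin (a * pi) / (2 * pi * (2 * exp (- (a * u)))) \<le> ml_kernel a u"
    unfolding ml_kernel_def using ml_kernel_denom_pos(2)[OF a, of u] sin_pi_mult_pos[OF a]
    by (intro divide_left_mono mult_left_mono mult_pos_pos) auto
  then show ?thesis by (simp add: exp_minus field_simps)
qed

text \<open>Only kernel values at \<open>u\<close> near \<open>- ln t\<close> are needed: there \<open>exp (- t * exp u)\<close> is bounded below
  and the kernel is of size \<open>t powr - a\<close>.\<close>

lemma mittag_leffler_neg_lower:
  assumes a: "0 < a" "a < 1"
  obtains c where "0 < c" "\<And>t. 1 \<le> t \<Longrightarrow> c * t powr (- a) \<le> mittag_leffler a (- (t powr a))"
proof
  define c where "c = exp (- 1) * (sin (a * pi) / (4 * pi) * exp (- a))"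
  show "0 < c" unfolding c_def using sin_pi_mult_pos[OF a] by simp
  fix t :: real assume t: "1 \<le> t"
  then have t0: "0 < t" by simp
  define I where "I = {- ln t - 1..- ln t}"
  have "c * t powr (- a) = (LINT u|lborel. indicator I u *\<^sub>R (c * t powr (- a)))"
    unfolding I_def by simp
  also have "\<dots> \<le> (LINT u|lborel. exp (- t * exp u) * ml_kernel a u)"
  proof (rule integral_mono_AE')
    show "integrable lborel (\<lambda>u. exp (- t * exp u) * ml_kernel a u)"
      using t by (intro ml_mixture_integrable a) auto
    show "AE u in lborel. 0 \<le> exp (- t * exp u) * ml_kernel a u"
      using ml_kernel_pos[OF a] by (simp add: less_imp_le)
    show "AE u in lborel. indicator I u *\<^sub>R (c * t powr (- a)) \<le> exp (- t * exp u) * ml_kernel a u"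
    proof (intro AE_I2)
      fix u
      show "indicator I u *\<^sub>R (c * t powr (- a)) \<le> exp (- t * exp u) * ml_kernel a u"
      proof (cases "u \<in> I")
        case True
        then have u: "- ln t - 1 \<le> u" "u \<le> - ln t" unfolding I_def by auto
        have "exp u \<le> exp (- ln t)" using u by simp
        then have "t * exp u \<le> 1" using t0 by (simp add: exp_minus field_simps)
        then have e: "exp (- 1) \<le> exp (- t * exp u)" by simp
        have u0: "u \<le> 0" using u t ln_ge_zero[OF t] by linarith
        have "exp (- a) * t powr (- a) = exp (a * (- ln t - 1))"
          using t0 by (simp add: powr_def exp_add[symmetric] algebra_simps)
        also have "\<dots> \<le> exp (a * u)" using u a by simp
        finally have "sin (a * pi) / (4 * pi) * (exp (- a) * t powr (- a)) \<le> sin (a * pi) / (4 * pi) * exp (a * u)"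
          using sin_pi_mult_pos[OF a] by (intro mult_left_mono) auto
        also have "\<dots> \<le> ml_kernel a u" by (rule ml_kernel_lower[OF a u0])
        finally have "exp (- 1) * (sin (a * pi) / (4 * pi) * (exp (- a) * t powr (- a))) \<le> exp (- t * exp u) * ml_kernel a u"
          using e sin_pi_mult_pos[OF a] by (intro mult_mono) auto
        then show ?thesis using True unfolding c_def by (simp add: mult.assoc)
      qed (use ml_kernel_pos[OF a, of u] in auto)
    qed
  qed
  also have "\<dots> = mittag_leffler a (- (t powr a))"
    using t mittag_leffler_eq_ml_mixture[OF a, of t] by (simp add: ml_mixture_def)
  finally show "c * t powr (- a) \<le> mittag_leffler a (- (t powr a))" .
qed

section \<open>The Mellin transform of the Mittag-Leffler function\<close>

text \<open>The Gamma integral after the substitution \<open>q = p\<^sup>a\<close>.\<close>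

lemma nn_integral_powr_exp_powr:
  assumes b: "0 < b" and a: "0 < a" and y: "0 < y"
  shows "(\<integral>\<^sup>+p. ennreal (p powr (b - 1) * exp (- y * p powr a)) \<partial>half_line) = ennreal (Gamma (b / a) * y powr (- (b / a)) / a)"
proof -
  let ?f = "\<lambda>q. q powr (b / a - 1) * exp (- y * q)"
  have hb: "has_bochner_integral half_line ?f (Gamma (b / a) * y powr (- (b / a)))"
    by (rule has_bochner_integral_Gamma) (use assms in auto)
  have "has_bochner_integral lborel (\<lambda>q. indicator {0<..} q *\<^sub>R ?f q) (Gamma (b / a) * y powr (- (b / a)))"
    using hb by (simp add: has_bochner_integral_restrict_space)
  then have si: "set_integrable lborel {0<..} ?f" and sv: "(LINT q:{0<..}|lborel. ?f q) = Gamma (b / a) * y powr (- (b / a))"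
    unfolding set_integrable_def set_lebesgue_integral_def by (auto simp: has_bochner_integral_iff)
  have img: "(\<lambda>p. p powr a) ` {0<..} = {0<..}"
  proof (intro equalityI subsetI)
    fix q :: real assume "q \<in> {0<..}"
    then show "q \<in> (\<lambda>p. p powr a) ` {0<..}"
      using a by (intro image_eqI[of _ _ "q powr (1 / a)"]) (auto simp: powr_powr)
  qed auto
  have "(\<lambda>p. \<bar>a * p powr (a - 1)\<bar> * ?f (p powr a)) absolutely_integrable_on {0<..} \<and>
         integral {0<..} (\<lambda>p. \<bar>a * p powr (a - 1)\<bar> * ?f (p powr a)) = Gamma (b / a) * y powr (- (b / a))"
  proof (rule has_absolute_integral_change_of_variables_1'[where S = "{0<..}" and g = "\<lambda>p. p powr a"
        and g' = "\<lambda>p. a * p powr (a - 1)" and f = ?f, THEN iffD2])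
    show "((\<lambda>p. p powr a) has_real_derivative a * p powr (a - 1)) (at p within {0<..})" if "p \<in> {0<..}" for p :: real
      using that by (auto intro!: derivative_eq_intros)
    show "inj_on (\<lambda>p::real. p powr a) {0<..}"
      using a by (intro inj_onI) (metis greaterThan_iff powr_powr powr_one less_imp_le mult.commute nonzero_mult_div_cancel_left times_divide_eq_right mult.right_neutral less_irrefl)
    show "?f absolutely_integrable_on (\<lambda>p. p powr a) ` {0<..} \<and> integral ((\<lambda>p. p powr a) ` {0<..}) ?f = Gamma (b / a) * y powr (- (b / a))"
    proof
      show "?f absolutely_integrable_on (\<lambda>p. p powr a) ` {0<..}"
        unfolding img using si unfolding set_integrable_def
        by (subst integrable_completion) auto
      show "integral ((\<lambda>p. p powr a) ` {0<..}) ?f = Gamma (b / a) * y powr (- (b / a))"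
        unfolding img using set_borel_integral_eq_integral(2)[OF si] sv by simp
    qed
  qed auto
  then have "((\<lambda>p. \<bar>a * p powr (a - 1)\<bar> * ?f (p powr a)) has_integral Gamma (b / a) * y powr (- (b / a))) {0<..}"
    unfolding has_integral_integrable_integral absolutely_integrable_on_def by blast
  then have "(\<integral>\<^sup>+p. ennreal (\<bar>a * p powr (a - 1)\<bar> * ?f (p powr a)) * indicator {0<..} p \<partial>lborel) = ennreal (Gamma (b / a) * y powr (- (b / a)))"
    by (intro nn_integral_has_integral_lebesgue') auto
  then have "ennreal (Gamma (b / a) * y powr (- (b / a))) = (\<integral>\<^sup>+p. ennreal (\<bar>a * p powr (a - 1)\<bar> * ?f (p powr a)) \<partial>half_line)"
    unfolding nn_integral_half_line by simp
  also have "\<dots> = (\<integral>\<^sup>+p. ennreal a * ennreal (p powr (b - 1) * exp (- y * p powr a)) \<partial>half_line)"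
  proof (intro nn_integral_cong)
    fix p assume "p \<in> space half_line"
    then have p: "p > 0" by simp
    have "p powr (a - 1) * (p powr a) powr (b / a - 1) = p powr (b - 1)"
      using a p by (simp add: powr_powr powr_add[symmetric] algebra_simps)
    then have eq: "\<bar>a * p powr (a - 1)\<bar> * ?f (p powr a) = a * (p powr (b - 1) * exp (- y * p powr a))"
      using a by (simp add: abs_mult)
    show "ennreal (\<bar>a * p powr (a - 1)\<bar> * ?f (p powr a)) = ennreal a * ennreal (p powr (b - 1) * exp (- y * p powr a))"
      unfolding eq by (rule ennreal_mult') (use a in simp)
  qed
  also have "\<dots> = ennreal a * (\<integral>\<^sup>+p. ennreal (p powr (b - 1) * exp (- y * p powr a)) \<partial>half_line)"
    by (rule nn_integral_cmult) measurable
  finally have "ennreal (1 / a) * ennreal (Gamma (b / a) * y powr (- (b / a))) = ennreal (1 / a) * (ennreal a * (\<integral>\<^sup>+p. ennreal (p powr (b - 1) * exp (- y * p powr a)) \<partial>half_line))"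
    by simp
  moreover have "ennreal (1 / a) * ennreal a = 1" using a by (simp add: ennreal_mult'[symmetric])
  ultimately have "(\<integral>\<^sup>+p. ennreal (p powr (b - 1) * exp (- y * p powr a)) \<partial>half_line)
     = ennreal (1 / a) * ennreal (Gamma (b / a) * y powr (- (b / a)))"
    by (simp only: mult.assoc[symmetric] mult_1_left)
  also have "\<dots> = ennreal (1 / a * (Gamma (b / a) * y powr (- (b / a))))"
    using a by (intro ennreal_mult'[symmetric]) simp
  finally show ?thesis by simp
qed

text \<open>Writing \<open>1 / (p\<^sup>a + 1)\<close> as the integral of \<open>exp (- (1 + p\<^sup>a) y)\<close> over \<open>y > 0\<close> splits the beta integral into two
Gamma integrals.\<close>

lemma nn_integral_beta_half_line:
  assumes a: "0 < a" and b: "0 < b" "b < a"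
  shows "(\<integral>\<^sup>+p. ennreal (p powr (b - 1) / (p powr a + 1)) \<partial>half_line) = ennreal (Gamma (b / a) * Gamma (1 - b / a) / a)"
proof -
  have "(\<integral>\<^sup>+p. ennreal (p powr (b - 1) / (p powr a + 1)) \<partial>half_line)
     = (\<integral>\<^sup>+p. \<integral>\<^sup>+y. ennreal (p powr (b - 1) * exp (- (1 + p powr a) * y)) \<partial>half_line \<partial>half_line)"
  proof (intro nn_integral_cong)
    fix p :: real
    have q: "1 + p powr a > 0" by (simp add: add_pos_nonneg)
    have "(\<integral>\<^sup>+y. ennreal (p powr (b - 1) * exp (- (1 + p powr a) * y)) \<partial>half_line)
       = (\<integral>\<^sup>+y. ennreal (p powr (b - 1)) * ennreal (y powr (1 - 1) * exp (- (1 + p powr a) * y)) \<partial>half_line)"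
      by (intro nn_integral_cong) (simp add: ennreal_mult'[symmetric])
    also have "\<dots> = ennreal (p powr (b - 1)) * ennreal (Gamma 1 * (1 + p powr a) powr (- 1))"
      by (subst nn_integral_cmult, measurable) (use q in \<open>simp only: nn_integral_Gamma[OF zero_less_one q]\<close>)
    also have "\<dots> = ennreal (p powr (b - 1) / (p powr a + 1))"
      using q by (simp add: ennreal_mult'[symmetric] powr_minus divide_inverse add.commute)
    finally show "ennreal (p powr (b - 1) / (p powr a + 1)) = (\<integral>\<^sup>+y. ennreal (p powr (b - 1) * exp (- (1 + p powr a) * y)) \<partial>half_line)" ..
  qed
  also have "\<dots> = (\<integral>\<^sup>+y. \<integral>\<^sup>+p. ennreal (p powr (b - 1) * exp (- (1 + p powr a) * y)) \<partial>half_line \<partial>half_line)"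
    by (rule half_line_pair.Fubini', rule borel_measurable_half_line_pair) measurable
  also have "\<dots> = (\<integral>\<^sup>+y. ennreal (Gamma (b / a) / a) * ennreal (y powr ((1 - b / a) - 1) * exp (- 1 * y)) \<partial>half_line)"
  proof (intro nn_integral_cong)
    fix y assume "y \<in> space half_line"
    then have y: "y > 0" by simp
    have "(\<integral>\<^sup>+p. ennreal (p powr (b - 1) * exp (- (1 + p powr a) * y)) \<partial>half_line)
       = (\<integral>\<^sup>+p. ennreal (exp (- y)) * ennreal (p powr (b - 1) * exp (- y * p powr a)) \<partial>half_line)"
    proof (intro nn_integral_cong)
      fix p :: real
      have "exp (- (1 + p powr a) * y) = exp (- y) * exp (- y * p powr a)"
        by (subst exp_add[symmetric]) (simp add: algebra_simps)
      then show "ennreal (p powr (b - 1) * exp (- (1 + p powr a) * y)) = ennreal (exp (- y)) * ennreal (p powr (b - 1) * exp (- y * p powr a))"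
        by (simp add: ennreal_mult'[symmetric])
    qed
    also have "\<dots> = ennreal (exp (- y)) * ennreal (Gamma (b / a) * y powr (- (b / a)) / a)"
      by (subst nn_integral_cmult, measurable) (simp only: nn_integral_powr_exp_powr[OF b(1) a y])
    also have "\<dots> = ennreal (Gamma (b / a) / a) * ennreal (y powr ((1 - b / a) - 1) * exp (- 1 * y))"
      using a b Gamma_real_pos[of "b / a"] by (simp add: ennreal_mult'[symmetric] mult_ac)
    finally show "(\<integral>\<^sup>+p. ennreal (p powr (b - 1) * exp (- (1 + p powr a) * y)) \<partial>half_line) = \<dots>" .
  qed
  also have "\<dots> = ennreal (Gamma (b / a) / a) * ennreal (Gamma (1 - b / a) * 1 powr (- (1 - b / a)))"
    by (subst nn_integral_cmult, measurable, subst nn_integral_Gamma) (use a b in auto)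
  also have "\<dots> = ennreal (Gamma (b / a) * Gamma (1 - b / a) / a)"
    using a b Gamma_real_pos[of "b / a"] by (simp add: ennreal_mult'[symmetric])
  finally show ?thesis .
qed

text \<open>Writing \<open>t powr (s - 1)\<close> itself as a Laplace transform turns the Mellin transform into an
  integral of the Laplace transform, which is a beta integral.\<close>

lemma mellin_mittag_leffler:
  assumes a: "0 < a" "a \<le> 1" and s: "0 < s" "s < a"
  shows "(\<integral>\<^sup>+t. ennreal (t powr (s - 1) * mittag_leffler a (- (t powr a))) \<partial>half_line)
           = ennreal (pi / (sin (pi * s / a) * a * Gamma (1 - s)))"
proof -
  let ?E = "\<lambda>t. mittag_leffler a (- (t powr a))"
  let ?I = "\<integral>\<^sup>+t. ennreal (t powr (s - 1) * ?E t) \<partial>half_line"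
  note [measurable] = mittag_leffler_measurable[OF a(1)]
  have E0: "0 \<le> ?E t" for t using mittag_leffler_neg_bounds[OF a] by simp
  have s1: "1 - s > 0" using s a by simp
  have G: "Gamma (1 - s) > 0" using s1 by (rule Gamma_real_pos)
  have "ennreal (Gamma (1 - s)) * ?I = (\<integral>\<^sup>+t. ennreal (Gamma (1 - s)) * ennreal (t powr (s - 1) * ?E t) \<partial>half_line)"
    by (rule nn_integral_cmult[symmetric]) measurable
  also have "\<dots> = (\<integral>\<^sup>+t. \<integral>\<^sup>+p. ennreal (p powr (- s) * exp (- p * t) * ?E t) \<partial>half_line \<partial>half_line)"
  proof (intro nn_integral_cong)
    fix t assume "t \<in> space half_line"
    then have t: "t > 0" by simp
    have "(\<integral>\<^sup>+p. ennreal (p powr (- s) * exp (- p * t) * ?E t) \<partial>half_line)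
       = (\<integral>\<^sup>+p. ennreal (?E t) * ennreal (p powr ((1 - s) - 1) * exp (- t * p)) \<partial>half_line)"
      using E0[of t] by (intro nn_integral_cong) (simp add: ennreal_mult'[symmetric] mult_ac)
    also have "\<dots> = ennreal (?E t) * ennreal (Gamma (1 - s) * t powr (- (1 - s)))"
      by (subst nn_integral_cmult, measurable) (simp only: nn_integral_Gamma[OF s1 t])
    also have "\<dots> = ennreal (Gamma (1 - s)) * ennreal (t powr (s - 1) * ?E t)"
      using E0[of t] G by (simp add: ennreal_mult'[symmetric] mult_ac)
    finally show "ennreal (Gamma (1 - s)) * ennreal (t powr (s - 1) * ?E t) = (\<integral>\<^sup>+p. ennreal (p powr (- s) * exp (- p * t) * ?E t) \<partial>half_line)" ..
  qed
  also have "\<dots> = (\<integral>\<^sup>+p. \<integral>\<^sup>+t. ennreal (p powr (- s) * exp (- p * t) * ?E t) \<partial>half_line \<partial>half_line)"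
    by (rule half_line_pair.Fubini', rule borel_measurable_half_line_pair) measurable
  also have "\<dots> = (\<integral>\<^sup>+p. ennreal (p powr ((a - s) - 1) / (p powr a + 1)) \<partial>half_line)"
  proof (intro nn_integral_cong)
    fix p assume "p \<in> space half_line"
    then have p: "p > 0" by simp
    have "(\<integral>\<^sup>+t. ennreal (p powr (- s) * exp (- p * t) * ?E t) \<partial>half_line)
       = (\<integral>\<^sup>+t. ennreal (p powr (- s)) * ennreal (exp (- p * t) * ?E t) \<partial>half_line)"
      by (intro nn_integral_cong) (simp add: ennreal_mult'[symmetric] mult_ac)
    also have "\<dots> = ennreal (p powr (- s)) * ennreal (p powr (a - 1) / (p powr a + 1))"
      by (subst nn_integral_cmult, measurable) (simp only: laplace_mittag_leffler[OF a p])
    also have "\<dots> = ennreal (p powr ((a - s) - 1) / (p powr a + 1))"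
      by (simp add: ennreal_mult'[symmetric] powr_add[symmetric] algebra_simps)
    finally show "(\<integral>\<^sup>+t. ennreal (p powr (- s) * exp (- p * t) * ?E t) \<partial>half_line) = \<dots>" .
  qed
  also have "\<dots> = ennreal (Gamma ((a - s) / a) * Gamma (1 - (a - s) / a) / a)"
    by (rule nn_integral_beta_half_line) (use s a in auto)
  also have "Gamma ((a - s) / a) * Gamma (1 - (a - s) / a) = pi / sin (pi * s / a)"
  proof -
    have 1: "1 - (a - s) / a = s / a" "(a - s) / a = 1 - s / a" using a by (auto simp: field_simps)
    have "complex_of_real (Gamma (s / a) * Gamma (1 - s / a)) = complex_of_real (pi / sin (pi * (s / a)))"
      using Gamma_reflection_complex[of "complex_of_real (s / a)"]
      by (simp only: Gamma_complex_of_real[symmetric] of_real_mult of_real_divide of_real_diff of_real_1 sin_of_real[symmetric])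
    then have "Gamma (s / a) * Gamma (1 - s / a) = pi / sin (pi * (s / a))" by (simp only: of_real_eq_iff)
    moreover have "1 - (1 - s / a) = s / a" by simp
    ultimately show ?thesis unfolding 1(2) by (simp only: mult.commute times_divide_eq_right)
  qed
  finally have "ennreal (1 / Gamma (1 - s)) * (ennreal (Gamma (1 - s)) * ?I) = ennreal (1 / Gamma (1 - s)) * ennreal (pi / sin (pi * s / a) / a)"
    by simp
  moreover have "ennreal (1 / Gamma (1 - s)) * ennreal (Gamma (1 - s)) = 1"
    using G by (simp add: ennreal_mult'[symmetric])
  ultimately have "?I = ennreal (1 / Gamma (1 - s)) * ennreal (pi / sin (pi * s / a) / a)"
    by (simp only: mult.assoc[symmetric] mult_1_left)
  also have "\<dots> = ennreal (1 / Gamma (1 - s) * (pi / sin (pi * s / a) / a))"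
    using G by (intro ennreal_mult'[symmetric]) simp
  finally show ?thesis by (simp add: mult_ac)
qed

section \<open>The analytic extension of the hypergeometric series\<close>

text \<open>The domain of the analytic extension in \<open>hyp_2R1\<close>.\<close>

definition slit_plane :: "complex set" where
  "slit_plane = - (complex_of_real ` {1..})"

lemma slit_plane_iff: "w \<in> slit_plane \<longleftrightarrow> \<not> (Im w = 0 \<and> 1 \<le> Re w)"
proof -
  have "w \<in> complex_of_real ` {1..} \<longleftrightarrow> Im w = 0 \<and> 1 \<le> Re w"
    by (auto simp: image_iff complex_eq_iff intro!: bexI[of _ "Re w"])
  then show ?thesis unfolding slit_plane_def by simp
qed

lemma open_slit_plane: "open slit_plane"
proof -
  have eq: "- slit_plane = {w. Im w = 0} \<inter> {w. Re w \<ge> 1}" by (auto simp: slit_plane_iff)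
  have "closed (- slit_plane)" unfolding eq
    by (intro closed_Int closed_Collect_eq closed_Collect_le continuous_intros)
  then show ?thesis by (simp add: closed_def)
qed

lemma ball_subset_slit_plane: "ball 0 1 \<subseteq> slit_plane"
proof
  fix w :: complex assume "w \<in> ball 0 1"
  then have "norm w < 1" by simp
  then show "w \<in> slit_plane" using complex_Re_le_cmod[of w] by (auto simp: slit_plane_iff)
qed

text \<open>For \<open>a = c = 1\<close> the Pochhammer symbol cancels the factorial, and up to the factor \<open>1 / \<Gamma>(b)\<close> these
are the Taylor coefficients of the hypergeometric function.\<close>

definition ratio_coeff :: "real \<Rightarrow> real \<Rightarrow> nat \<Rightarrow> real" where
  "ratio_coeff a b k = Gamma (b + a * real k) / Gamma (a * real k + 1)"

lemma ratio_coeff_pos: "0 < a \<Longrightarrow> 0 < b \<Longrightarrow> 0 < ratio_coeff a b k"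
  unfolding ratio_coeff_def
  by (intro divide_pos_pos Gamma_real_pos add_pos_nonneg add_nonneg_pos) auto

abbreviation unit_interval :: "real measure" where
  "unit_interval \<equiv> restrict_space lborel {0<..<1}"

lemma space_unit_interval [simp]: "space unit_interval = {0<..<1}"
  by (simp add: space_restrict_space)

lemma ident_measurable_unit_interval [measurable (raw)]: "(\<lambda>x. x) \<in> borel_measurable unit_interval"
  by (rule measurable_restrict_space1) simp

lemma has_bochner_integral_Beta:
  assumes "0 < x" "0 < y"
  shows "has_bochner_integral unit_interval (\<lambda>t. t powr (x - 1) * (1 - t) powr (y - 1)) (Beta x y)"
proof (rule has_bochner_integral_nn_integral)
  have "(\<integral>\<^sup>+t. ennreal (t powr (x - 1) * (1 - t) powr (y - 1)) * indicator {0..1} t \<partial>lborel) = ennreal (Beta x y)"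
    using has_integral_Beta_real[OF assms] by (intro nn_integral_has_integral_lebesgue') auto
  also have "(\<integral>\<^sup>+t. ennreal (t powr (x - 1) * (1 - t) powr (y - 1)) * indicator {0..1} t \<partial>lborel)
      = (\<integral>\<^sup>+t. ennreal (t powr (x - 1) * (1 - t) powr (y - 1)) * indicator {0<..<1} t \<partial>lborel)"
    by (intro nn_integral_cong) (auto simp: indicator_def)
  finally show "(\<integral>\<^sup>+t. ennreal (t powr (x - 1) * (1 - t) powr (y - 1)) \<partial>unit_interval) = ennreal (Beta x y)"
    by (subst nn_integral_restrict_space) auto
  show "0 \<le> Beta x y" using assms by (auto simp: Beta_def intro!: divide_nonneg_nonneg mult_nonneg_nonneg less_imp_le[OF Gamma_real_pos])
qed (use assms in auto)

text \<open>For \<open>b < 1\<close> the coefficients are beta integrals, \<open>\<Gamma>(b + a k) / \<Gamma>(1 + a k) = B(b + a k, 1 - b) / \<Gamma>(1 - b)\<close>,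
and summing the geometric series inside the integral gives this integrand.\<close>

definition euler_integrand :: "real \<Rightarrow> real \<Rightarrow> complex \<Rightarrow> real \<Rightarrow> complex" where
  "euler_integrand a b w t = of_real (t powr (b - 1) * (1 - t) powr ((1 - b) - 1)) / (1 - w * of_real (t powr a))"

lemma euler_integral_sums:
  assumes a: "0 < a" and b: "0 < b" "b < 1" and w: "norm w < 1"
  shows "(\<lambda>k. of_real (ratio_coeff a b k) * w ^ k) sums ((LINT t|unit_interval. euler_integrand a b w t) / of_real (Gamma (1 - b)))"
proof -
  define f where "f = (\<lambda>k t. w ^ k * of_real (t powr (b + a * real k - 1) * (1 - t) powr ((1 - b) - 1)))"
  have bk: "b + a * real k > 0" "1 - b > 0" for k using a b by (auto intro: add_pos_nonneg)
  have G: "Gamma (1 - b) > 0" using b by (intro Gamma_real_pos) auto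
  have beta: "Beta (b + a * real k) (1 - b) = Gamma (1 - b) * ratio_coeff a b k" for k
    unfolding Beta_def ratio_coeff_def by (simp add: algebra_simps)
  have hb: "has_bochner_integral unit_interval (f k) (w ^ k * of_real (Beta (b + a * real k) (1 - b)))" for k
    unfolding f_def by (intro has_bochner_integral_mult_right has_bochner_integral_of_real has_bochner_integral_Beta bk)
  have hbn: "has_bochner_integral unit_interval (\<lambda>t. norm (f k t)) (norm w ^ k * Beta (b + a * real k) (1 - b))" for k
  proof -
    have "norm (f k t) = norm w ^ k * (t powr (b + a * real k - 1) * (1 - t) powr ((1 - b) - 1))" for t
      unfolding f_def by (simp add: norm_mult norm_power)
    then show ?thesis by (simp only:) (intro has_bochner_integral_mult_right has_bochner_integral_Beta bk)
  qed
  have mono: "Beta (b + a * real k) (1 - b) \<le> Beta b (1 - b)" for k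
    using a b by (intro Beta_real_mono) auto
  have pt: "f k t = of_real (t powr (b - 1) * (1 - t) powr ((1 - b) - 1)) * (w * of_real (t powr a)) ^ k" if t: "t \<in> {0<..<1}" for k t
  proof -
    have "t powr (b + a * real k - 1) = t powr ((b - 1) + a * real k)" by (simp add: algebra_simps)
    also have "\<dots> = t powr (b - 1) * (t powr a) powr real k" by (simp only: powr_add powr_powr)
    also have "(t powr a) powr real k = (t powr a) ^ k" using t by (intro powr_realpow) simp
    finally show ?thesis unfolding f_def by (simp add: power_mult_distrib)
  qed
  have ta: "norm (w * of_real (t powr a)) < 1" if t: "t \<in> {0<..<1}" for t
  proof -
    have "t powr a \<le> 1" using t a by (intro powr_le1) auto
    then have "norm w * t powr a \<le> norm w" by (intro mult_left_le) auto
    then show ?thesis using w by (simp add: norm_mult)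
  qed
  have A: "AE t in unit_interval. summable (\<lambda>k. norm (f k t))"
    using ta by (intro AE_I2) (auto simp: pt norm_mult norm_power intro!: summable_mult summable_geometric)
  have S: "summable (\<lambda>k. LINT t|unit_interval. norm (f k t))"
    unfolding has_bochner_integral_integral_eq[OF hbn]
  proof (rule summable_comparison_test')
    show "summable (\<lambda>k. norm w ^ k * Beta b (1 - b))" using w by (intro summable_mult2 summable_geometric) auto
    show "norm (norm w ^ k * Beta (b + a * real k) (1 - b)) \<le> norm w ^ k * Beta b (1 - b)" for k
      using mono[of k] beta[of k] G ratio_coeff_pos[OF a b(1), of k] by (simp add: abs_mult mult_left_mono)
  qed
  have "(\<lambda>k. integral\<^sup>L unit_interval (f k)) sums (LINT t|unit_interval. (\<Sum>k. f k t))"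
    by (rule sums_integral[OF integrable.intros[OF hb] A S])
  also have "(LINT t|unit_interval. (\<Sum>k. f k t)) = (LINT t|unit_interval. euler_integrand a b w t)"
  proof (intro Bochner_Integration.integral_cong refl)
    fix t assume "t \<in> space unit_interval"
    then have t: "t \<in> {0<..<1}" by simp
    show "(\<Sum>k. f k t) = euler_integrand a b w t"
      unfolding pt[OF t] euler_integrand_def
      using suminf_mult[OF summable_geometric[OF ta[OF t]]] suminf_geometric[OF ta[OF t]] by simp
  qed
  finally have "(\<lambda>k. integral\<^sup>L unit_interval (f k) / of_real (Gamma (1 - b))) sums ((LINT t|unit_interval. euler_integrand a b w t) / of_real (Gamma (1 - b)))"
    by (rule sums_divide)
  then show ?thesis unfolding has_bochner_integral_integral_eq[OF hb] beta using G by (simp add: mult_ac)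
qed

text \<open>For \<open>w\<close> off the slit, \<open>1 - w y\<close> is bounded away from \<open>0\<close> uniformly in \<open>y \<in> [0, 1]\<close>, and locally uniformly
in \<open>w\<close>.\<close>

lemma euler_integral_holomorphic:
  assumes a: "0 < a" and b: "0 < b" "b < 1"
  shows "(\<lambda>w. LINT t|unit_interval. euler_integrand a b w t) holomorphic_on slit_plane"
  unfolding holomorphic_on_def field_differentiable_def
proof (intro ballI exI)
  fix w0 assume w0: "w0 \<in> slit_plane"
  define \<beta> where "\<beta> = (\<lambda>t. t powr (b - 1) * (1 - t) powr ((1 - b) - 1))"
  have eu: "euler_integrand a b w t = of_real (\<beta> t) / (1 - w * of_real (t powr a))" for w t
    unfolding euler_integrand_def \<beta>_def ..
  have \<beta>int: "integrable unit_interval \<beta>" unfolding \<beta>_def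
    by (rule integrable.intros[OF has_bochner_integral_Beta]) (use b in auto)
  have \<beta>0: "\<beta> t \<ge> 0" for t unfolding \<beta>_def by simp
  have "\<exists>y\<in>{0..1}. \<forall>z\<in>{0..1}. norm (1 - w0 * of_real y) \<le> norm (1 - w0 * complex_of_real z)"
    by (rule continuous_attains_inf) (auto intro!: continuous_intros)
  then obtain y where y: "y \<in> {0..1}" "\<And>z. z \<in> {0..1} \<Longrightarrow> norm (1 - w0 * of_real y) \<le> norm (1 - w0 * complex_of_real z)"
    by blast
  define d where "d = norm (1 - w0 * of_real y)"
  have "1 - w0 * of_real y \<noteq> 0"
  proof
    assume z: "1 - w0 * of_real y = 0"
    then have "y \<noteq> 0" by auto
    then have "w0 = of_real (1 / y)" using z by (simp add: field_simps)
    moreover have "1 / y \<ge> 1" using y(1) \<open>y \<noteq> 0\<close> by simp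
    ultimately show False using w0 by (simp add: slit_plane_iff)
  qed
  then have d: "d > 0" unfolding d_def by simp
  have ta: "t powr a \<in> {0..1}" if "t \<in> {0<..<1}" for t
    using that a by (auto intro!: powr_le1)
  have low0: "d \<le> norm (1 - w0 * of_real (t powr a))" if "t \<in> {0<..<1}" for t
    unfolding d_def using y(2)[OF ta[OF that]] .
  have low: "d / 2 \<le> norm (1 - w * of_real (t powr a))" if t: "t \<in> {0<..<1}" and w: "w \<in> ball w0 (d / 2)" for t w
  proof -
    have "1 - w0 * of_real (t powr a) = (1 - w * of_real (t powr a)) + (w - w0) * of_real (t powr a)"
      by (simp add: algebra_simps)
    then have "norm (1 - w0 * of_real (t powr a)) \<le> norm (1 - w * of_real (t powr a)) + norm (w - w0) * t powr a"
      by (metis norm_triangle_ineq norm_mult norm_of_real abs_of_nonneg powr_ge_zero)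
    moreover have "norm (w - w0) * t powr a \<le> norm (w - w0)" using ta[OF t] by (intro mult_left_le) auto
    moreover have "norm (w - w0) < d / 2" using w by (simp add: dist_norm norm_minus_commute)
    ultimately show ?thesis using low0[OF t] by linarith
  qed
  define h where "h = (\<lambda>t. 2 / d\<^sup>2 * \<beta> t)"
  have meas: "(\<lambda>t. euler_integrand a b w t) \<in> borel_measurable unit_interval" for w
    unfolding euler_integrand_def by measurable
  show "((\<lambda>w. LINT t|unit_interval. euler_integrand a b w t) has_field_derivative
      (LINT t|unit_interval. of_real (\<beta> t) * of_real (t powr a) / (1 - w0 * of_real (t powr a))\<^sup>2)) (at w0 within slit_plane)"
  proof (rule has_field_derivative_at_within, rule has_field_derivative_lebesgue_integral[where e = "d / 2" and h = h])
    show "0 < d / 2" using d by simp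
    show "integrable unit_interval h" unfolding h_def by (intro integrable_mult_right \<beta>int)
    show "(\<lambda>t. of_real (\<beta> t) * of_real (t powr a) / (1 - w0 * of_real (t powr a))\<^sup>2) \<in> borel_measurable unit_interval"
      unfolding \<beta>_def by measurable
    show "integrable unit_interval (euler_integrand a b w)" if w: "w \<in> ball w0 (d / 2)" for w
    proof (rule Bochner_Integration.integrable_bound[OF _ meas])
      show "integrable unit_interval (\<lambda>t. 2 / d * \<beta> t)" by (intro integrable_mult_right \<beta>int)
      show "AE t in unit_interval. norm (euler_integrand a b w t) \<le> norm (2 / d * \<beta> t)"
      proof (rule AE_I2)
        fix t assume "t \<in> space unit_interval"
        then have t: "t \<in> {0<..<1}" by simp
        have "\<beta> t / norm (1 - w * of_real (t powr a)) \<le> \<beta> t / (d / 2)"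
          using low[OF t w] d \<beta>0 by (intro divide_left_mono mult_pos_pos) auto
        then show "norm (euler_integrand a b w t) \<le> norm (2 / d * \<beta> t)"
          unfolding eu norm_divide using \<beta>0[of t] d
          by (simp add: abs_mult mult.commute)
      qed
    qed
    fix t assume "t \<in> space unit_interval"
    then have t: "t \<in> {0<..<1}" by simp
    have n0: "1 - w0 * of_real (t powr a) \<noteq> 0" using low0[OF t] d by auto
    show "((\<lambda>w. euler_integrand a b w t) has_field_derivative of_real (\<beta> t) * of_real (t powr a) / (1 - w0 * of_real (t powr a))\<^sup>2) (at w0)"
      unfolding eu by (rule derivative_eq_intros refl n0 | simp add: power2_eq_square)+
    have tt: "0 \<le> t powr a" "t powr a \<le> 1" using ta[OF t] by auto
    show "norm (of_real (\<beta> t) * of_real (t powr a) / (1 - w0 * of_real (t powr a))\<^sup>2) \<le> h t"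
    proof -
      have "norm (of_real (\<beta> t) * of_real (t powr a) / (1 - w0 * of_real (t powr a))\<^sup>2)
          = \<beta> t * t powr a / (norm (1 - w0 * of_real (t powr a)))\<^sup>2"
        using \<beta>0[of t] by (simp add: norm_mult norm_divide norm_power)
      also have "\<dots> \<le> \<beta> t * 1 / d\<^sup>2"
        using low0[OF t] d \<beta>0[of t] tt by (intro frac_le mult_left_mono power_mono mult_nonneg_nonneg) auto
      also have "\<dots> \<le> h t" unfolding h_def using \<beta>0[of t] d by (simp add: field_simps)
      finally show ?thesis .
    qed
    fix w assume w: "w \<in> ball w0 (d / 2)"
    have n1: "1 - w * of_real (t powr a) \<noteq> 0" using low[OF t w] d by auto
    have "euler_integrand a b w t - euler_integrand a b w0 t =
       of_real (\<beta> t) * (of_real (t powr a) * (w - w0)) / ((1 - w * of_real (t powr a)) * (1 - w0 * of_real (t powr a)))"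
      unfolding eu using n0 n1 by (simp add: divide_simps) (simp add: algebra_simps)
    also have "norm \<dots> = \<beta> t * (t powr a * norm (w - w0)) / (norm (1 - w * of_real (t powr a)) * norm (1 - w0 * of_real (t powr a)))"
      using \<beta>0[of t] by (simp add: norm_mult norm_divide)
    also have "\<dots> \<le> \<beta> t * (1 * norm (w - w0)) / (d / 2 * d)"
      using low0[OF t] low[OF t w] d \<beta>0[of t] tt by (intro frac_le mult_left_mono mult_right_mono mult_mono mult_nonneg_nonneg) auto
    also have "\<dots> = h t * norm (w - w0)" unfolding h_def using d by (simp add: power2_eq_square)
    finally show "norm (euler_integrand a b w t - euler_integrand a b w0 t) \<le> h t * norm (w - w0)" .
  qed
qed

text \<open>The convergence of the series on the unit disc is part of the notion: it is inherited along the
induction on \<open>b\<close>, which spares growth estimates of Gamma quotients for large \<open>b\<close>.\<close>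

definition slit_extension :: "(nat \<Rightarrow> real) \<Rightarrow> (complex \<Rightarrow> complex) \<Rightarrow> bool" where
  "slit_extension c F \<longleftrightarrow> F holomorphic_on slit_plane \<and> (\<forall>w\<in>ball 0 1. (\<lambda>k. of_real (c k) * w ^ k) sums F w)"

lemma slit_extension_ratio_coeff_base:
  assumes a: "0 < a" and b: "0 < b" "b \<le> 1"
  shows "\<exists>F. slit_extension (ratio_coeff a b) F"
proof (cases "b = 1")
  case True
  have "ratio_coeff a b k = 1" for k
  proof -
    have "Gamma (1 + a * real k) > 0" using a by (intro Gamma_real_pos add_pos_nonneg) auto
    then show ?thesis using True by (simp add: ratio_coeff_def add.commute)
  qed
  moreover have "(\<lambda>w. 1 / (1 - w)) holomorphic_on slit_plane"
    by (intro holomorphic_intros) (auto simp: slit_plane_iff)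
  ultimately have "slit_extension (ratio_coeff a b) (\<lambda>w. 1 / (1 - w))"
    unfolding slit_extension_def using geometric_sums[where 'a = complex] by auto
  then show ?thesis by blast
next
  case False
  then have "b < 1" using b by simp
  then have "slit_extension (ratio_coeff a b) (\<lambda>w. (LINT t|unit_interval. euler_integrand a b w t) / of_real (Gamma (1 - b)))"
    unfolding slit_extension_def using euler_integral_sums[OF a b(1)] euler_integral_holomorphic[OF a b(1)] Gamma_real_pos[of "1 - b"]
    by (auto intro!: holomorphic_intros)
  then show ?thesis by blast
qed

text \<open>The functional equation of the Gamma function multiplies the \<open>k\<close>-th coefficient by \<open>b + a k\<close>, which is the action of
\<open>b + a w d/dw\<close> on the series; this operator preserves holomorphy on the slit plane.\<close>

lemma slit_extension_ratio_coeff_step: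
  assumes a: "0 < a" and b: "0 < b" and F: "slit_extension (ratio_coeff a b) F"
  shows "slit_extension (ratio_coeff a (b + 1)) (\<lambda>w. of_real b * F w + of_real a * (w * deriv F w))"
  unfolding slit_extension_def
proof
  have hol: "F holomorphic_on slit_plane" and sums: "\<And>w. norm w < 1 \<Longrightarrow> (\<lambda>k. of_real (ratio_coeff a b k) * w ^ k) sums F w"
    using F unfolding slit_extension_def by auto
  show "(\<lambda>w. of_real b * F w + of_real a * (w * deriv F w)) holomorphic_on slit_plane"
    by (intro holomorphic_intros hol holomorphic_deriv open_slit_plane)
  show "\<forall>w\<in>ball 0 1. (\<lambda>k. of_real (ratio_coeff a (b + 1) k) * w ^ k) sums (of_real b * F w + of_real a * (w * deriv F w))"
  proof
    fix w :: complex assume "w \<in> ball 0 1"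
    then have w: "norm w < 1" by simp
    define c where "c = (\<lambda>k. complex_of_real (ratio_coeff a b k))"
    have "(F has_field_derivative deriv F w) (at w)"
      using ball_subset_slit_plane w by (intro holomorphic_derivI[OF hol open_slit_plane]) auto
    then have "(\<lambda>k. diffs c k * w ^ k) sums deriv F w"
      using sums w unfolding c_def by (intro termdiffs_sums_strong[where K = 1])
    then have "(\<lambda>k. w * (diffs c k * w ^ k)) sums (w * deriv F w)" by (rule sums_mult)
    also have "(\<lambda>k. w * (diffs c k * w ^ k)) = (\<lambda>k. of_nat (Suc k) * c (Suc k) * w ^ Suc k)"
      by (simp add: diffs_def mult_ac)
    finally have "(\<lambda>k. of_nat k * c k * w ^ k) sums (w * deriv F w)"
      using sums_Suc[of "\<lambda>k. of_nat k * c k * w ^ k" "w * deriv F w"] by simp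
    then have "(\<lambda>k. of_real b * (c k * w ^ k) + of_real a * (of_nat k * c k * w ^ k)) sums (of_real b * F w + of_real a * (w * deriv F w))"
      using sums[OF w] unfolding c_def by (intro sums_add sums_mult)
    also have "(\<lambda>k. of_real b * (c k * w ^ k) + of_real a * (of_nat k * c k * w ^ k)) = (\<lambda>k. of_real (ratio_coeff a (b + 1) k) * w ^ k)"
    proof
      fix k
      have "b + a * real k > 0" using a b by (intro add_pos_nonneg) auto
      then have "Gamma (b + 1 + a * real k) = (b + a * real k) * Gamma (b + a * real k)"
        using Gamma_plus1[of "b + a * real k"] by (force simp: add_ac elim!: nonpos_Ints_cases)
      then have "ratio_coeff a (b + 1) k = (b + a * real k) * ratio_coeff a b k"
        unfolding ratio_coeff_def by simp
      then show "of_real b * (c k * w ^ k) + of_real a * (of_nat k * c k * w ^ k) = of_real (ratio_coeff a (b + 1) k) * w ^ k"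
        unfolding c_def by (simp add: algebra_simps)
    qed
    finally show "(\<lambda>k. of_real (ratio_coeff a (b + 1) k) * w ^ k) sums (of_real b * F w + of_real a * (w * deriv F w))" .
  qed
qed

lemma slit_extension_ratio_coeff_exists:
  assumes a: "0 < a" and b: "0 < b"
  shows "\<exists>F. slit_extension (ratio_coeff a b) F"
proof -
  have *: "\<exists>F. slit_extension (ratio_coeff a (b' + real n)) F" if "0 < b'" "b' \<le> 1" for b' n
  proof (induction n)
    case 0
    then show ?case using slit_extension_ratio_coeff_base[OF a that] by simp
  next
    case (Suc n)
    then obtain F where "slit_extension (ratio_coeff a (b' + real n)) F" by blast
    from slit_extension_ratio_coeff_step[OF a _ this] that show ?case by (auto simp: add_ac)
  qed
  \<comment> \<open>The integer part is rounded so that \<open>b - n\<close> falls into \<open>(0, 1]\<close>.\<close>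
  define n where "n = nat (\<lceil>b\<rceil> - 1)"
  have "\<lceil>b\<rceil> \<ge> 1" using b by simp
  then have n: "real n = of_int \<lceil>b\<rceil> - 1" unfolding n_def by simp
  have "0 < b - real n" "b - real n \<le> 1" unfolding n by linarith+
  from *[OF this, of n] show ?thesis by simp
qed

lemma hyp_2R1_series_eq:
  assumes a: "0 < a" and b: "0 < b" and s: "(\<lambda>k. of_real (ratio_coeff a b k) * w ^ k) sums S"
  shows "hyp_2R1_series 1 (of_real b) 1 a w = S / of_real (Gamma b)"
proof -
  have "pochhammer 1 k * Gamma (of_real b + of_real (a * real k)) / Gamma (1 + of_real (a * real k)) * (w ^ k / fact k)
     = of_real (ratio_coeff a b k) * w ^ k" for k
  proof -
    have "Gamma (complex_of_real b + of_real (a * real k)) = of_real (Gamma (b + a * real k))"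
      by (simp only: of_real_add[symmetric] Gamma_complex_of_real)
    moreover have "Gamma (1 + complex_of_real (a * real k)) = of_real (Gamma (a * real k + 1))"
    proof -
      have "1 + complex_of_real (a * real k) = of_real (a * real k + 1)" by simp
      then show ?thesis by (simp only: Gamma_complex_of_real)
    qed
    moreover have "pochhammer (1::complex) k = fact k" by (simp add: pochhammer_fact)
    ultimately show ?thesis by (simp add: ratio_coeff_def)
  qed
  then have "hyp_2R1_series 1 (of_real b) 1 a w = 1 / of_real (Gamma b) * (\<Sum>k. of_real (ratio_coeff a b k) * w ^ k)"
    unfolding hyp_2R1_series_def by (simp add: Gamma_complex_of_real)
  then show ?thesis using sums_unique[OF s] by simp
qed

text \<open>The choice in \<open>hyp_2R1\<close> ranges over a nonempty set of extensions, so the chosen function is one of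
them.\<close>

lemma hyp_2R1_slit_extension:
  assumes a: "0 < a" and b: "0 < b"
  obtains F where "slit_extension (ratio_coeff a b) F"
    and "\<And>w. w \<in> slit_plane \<Longrightarrow> of_real (Gamma b) * hyp_2R1 1 (of_real b) 1 a w = F w"
proof -
  obtain F where F: "slit_extension (ratio_coeff a b) F"
    using slit_extension_ratio_coeff_exists[OF a b] by blast
  have Gb: "complex_of_real (Gamma b) \<noteq> 0" using Gamma_real_pos[OF b] by simp
  define P where "P = (\<lambda>f. f holomorphic_on slit_plane \<and> (\<forall>v\<in>ball 0 1. f v = hyp_2R1_series 1 (of_real b) 1 a v))"
  have ser: "hyp_2R1_series 1 (of_real b) 1 a v = F v / of_real (Gamma b)" if "v \<in> ball 0 1" for v
    using F that unfolding slit_extension_def by (intro hyp_2R1_series_eq[OF a b]) auto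
  have "P (\<lambda>w. F w / of_real (Gamma b))"
    unfolding P_def using F Gb ser unfolding slit_extension_def by (auto intro!: holomorphic_intros)
  then have PS: "P (SOME f. P f)" by (rule someI[of P])
  define H where "H = (\<lambda>w. of_real (Gamma b) * (SOME f. P f) w)"
  have "slit_extension (ratio_coeff a b) H"
    unfolding slit_extension_def
  proof
    show "H holomorphic_on slit_plane" unfolding H_def using PS unfolding P_def by (intro holomorphic_intros) auto
    show "\<forall>w\<in>ball 0 1. (\<lambda>k. of_real (ratio_coeff a b k) * w ^ k) sums H w"
    proof
      fix w :: complex assume w: "w \<in> ball 0 1"
      have "(SOME f. P f) w = hyp_2R1_series 1 (of_real b) 1 a w" using PS w unfolding P_def by blast
      then have "H w = F w" unfolding H_def using ser[OF w] Gb by simp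
      then show "(\<lambda>k. of_real (ratio_coeff a b k) * w ^ k) sums H w" using F w unfolding slit_extension_def by simp
    qed
  qed
  moreover have "of_real (Gamma b) * hyp_2R1 1 (of_real b) 1 a w = H w" if "w \<in> slit_plane" for w
    using that unfolding hyp_2R1_def H_def P_def slit_plane_def by simp
  ultimately show ?thesis by (rule that)
qed

text \<open>On a ball of radius \<open>p = Re z0 / 2\<close> around \<open>z0\<close> one has \<open>Re z > p\<close>, so \<open>t exp (- p t)\<close> dominates the
derivative of the exponential.\<close>

lemma laplace_holomorphic:
  assumes b: "0 < b" and gm: "g \<in> borel_measurable half_line" and gb: "\<And>t. 0 < t \<Longrightarrow> \<bar>g t\<bar> \<le> 1"
  shows "(\<lambda>z. LINT t|half_line. of_real (t powr (b - 1) * g t) * exp (- z * of_real t)) holomorphic_on {z. 0 < Re z}"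
  unfolding holomorphic_on_def field_differentiable_def
proof (intro ballI exI)
  note [measurable] = gm
  fix z0 :: complex assume "z0 \<in> {z. 0 < Re z}"
  then have z0: "0 < Re z0" by simp
  define p where "p = Re z0 / 2"
  have p: "0 < p" using z0 unfolding p_def by simp
  have reb: "p < Re z" if "z \<in> ball z0 p" for z
  proof -
    have "\<bar>Re z0 - Re z\<bar> \<le> norm (z0 - z)" using abs_Re_le_cmod[of "z0 - z"] by simp
    then show ?thesis using that unfolding p_def by (simp add: dist_norm)
  qed
  define h where "h = (\<lambda>t::real. t powr ((b + 1) - 1) * exp (- p * t))"
  have ex: "norm (exp (- z * of_real t)) \<le> exp (- p * t)" if "z \<in> ball z0 p" "0 < t" for z t
    using reb[OF that(1)] that(2) by (simp add: mult_right_mono less_imp_le)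
  have coeff: "\<bar>t powr (b - 1) * g t\<bar> \<le> t powr (b - 1)" if "0 < t" for t
    using gb[OF that] by (simp add: abs_mult mult_left_le)
  have z0b: "z0 \<in> ball z0 p" using p by simp
  show "((\<lambda>z. LINT t|half_line. of_real (t powr (b - 1) * g t) * exp (- z * of_real t)) has_field_derivative
     (LINT t|half_line. of_real (t powr (b - 1) * g t) * (- of_real t * exp (- z0 * of_real t)))) (at z0 within {z. 0 < Re z})"
  proof (rule has_field_derivative_at_within, rule has_field_derivative_lebesgue_integral[where e = p and h = h])
    show "0 < p" by (rule p)
    show "integrable half_line h"
      unfolding h_def using b p by (intro integrable.intros[OF has_bochner_integral_Gamma]) auto
    show "integrable half_line (\<lambda>t. of_real (t powr (b - 1) * g t) * exp (- z * of_real t))" if z: "z \<in> ball z0 p" for z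
    proof (rule Bochner_Integration.integrable_bound)
      show "integrable half_line (\<lambda>t. t powr (b - 1) * exp (- p * t))"
        by (rule integrable.intros[OF has_bochner_integral_Gamma[OF b p]])
      show "AE t in half_line. norm (of_real (t powr (b - 1) * g t) * exp (- z * of_real t)) \<le> norm (t powr (b - 1) * exp (- p * t))"
      proof (rule AE_I2)
        fix t assume "t \<in> space half_line"
        then have t: "0 < t" by simp
        have "\<bar>t powr (b - 1) * g t\<bar> * norm (exp (- z * of_real t)) \<le> t powr (b - 1) * exp (- p * t)"
          using coeff[OF t] ex[OF z t] by (intro mult_mono) auto
        then show "norm (of_real (t powr (b - 1) * g t) * exp (- z * of_real t)) \<le> norm (t powr (b - 1) * exp (- p * t))"
          by (simp add: norm_mult abs_mult)
      qed
    qed measurable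
    show "(\<lambda>t. of_real (t powr (b - 1) * g t) * (- of_real t * exp (- z0 * of_real t))) \<in> borel_measurable half_line"
      by measurable
    fix t assume "t \<in> space half_line"
    then have t: "0 < t" by simp
    show "((\<lambda>z. of_real (t powr (b - 1) * g t) * exp (- z * of_real t)) has_field_derivative of_real (t powr (b - 1) * g t) * (- of_real t * exp (- z0 * of_real t))) (at z0)"
      by (auto intro!: derivative_eq_intros)
    have ht: "h t = t powr (b - 1) * (t * exp (- p * t))"
      unfolding h_def using t powr_add[of t "b - 1" 1] by simp
    have dex: "norm (- of_real t * exp (- z * of_real t)) \<le> t * exp (- p * t)" if z: "z \<in> ball z0 p" for z
      unfolding norm_mult norm_minus_cancel using ex[OF z t] t by (auto intro: mult_left_mono)
    show "norm (of_real (t powr (b - 1) * g t) * (- of_real t * exp (- z0 * of_real t))) \<le> h t"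
      unfolding ht norm_mult[of "of_real _"] norm_of_real
      using coeff[OF t] dex[OF z0b] t by (intro mult_mono) auto
    fix z assume z: "z \<in> ball z0 p"
    have "norm (exp (- z * of_real t) - exp (- z0 * of_real t)) \<le> (t * exp (- p * t)) * norm (z - z0)"
    proof (rule field_differentiable_bound[where S = "ball z0 p" and f' = "\<lambda>z. - of_real t * exp (- z * of_real t)"])
      show "((\<lambda>z. exp (- z * of_real t)) has_field_derivative - of_real t * exp (- z * of_real t)) (at z within ball z0 p)" for z
        by (auto intro!: derivative_eq_intros)
    qed (use dex z z0b in auto)
    then have "\<bar>t powr (b - 1) * g t\<bar> * norm (exp (- z * of_real t) - exp (- z0 * of_real t)) \<le> t powr (b - 1) * ((t * exp (- p * t)) * norm (z - z0))"
      using coeff[OF t] by (intro mult_mono) auto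
    then show "norm (of_real (t powr (b - 1) * g t) * exp (- z * of_real t) - of_real (t powr (b - 1) * g t) * exp (- z0 * of_real t)) \<le> h t * norm (z - z0)"
      unfolding ht by (simp only: right_diff_distrib[symmetric] norm_mult norm_of_real mult.assoc)
  qed
qed

text \<open>Both sides are holomorphic in \<open>p\<close> on the right half-plane, since \<open>- l / p powr a\<close> stays in the
  left half-plane there. They agree for large real \<open>p\<close>, where the Mittag-Leffler series can be
  integrated termwise.\<close>

theorem laplace_mittag_leffler_hyp_2R1:
  assumes a: "0 < a" "a \<le> 1" and b: "0 < b" and l: "0 < l" and p: "0 < p"
  shows "complex_of_real (LINT t|half_line. t powr (b - 1) * exp (- p * t) * mittag_leffler a (- l * t powr a))
     = of_real (Gamma b / p powr b) * hyp_2R1 1 (of_real b) 1 a (of_real (- (l / p powr a)))"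
proof -
  obtain F where F: "slit_extension (ratio_coeff a b) F"
    and hypF: "\<And>w. w \<in> slit_plane \<Longrightarrow> of_real (Gamma b) * hyp_2R1 1 (of_real b) 1 a w = F w"
    using hyp_2R1_slit_extension[OF a(1) b] by blast
  define g where "g = (\<lambda>t. mittag_leffler a (- l * t powr a))"
  define J where "J = (\<lambda>z::complex. LINT t|half_line. of_real (t powr (b - 1) * g t) * exp (- z * of_real t))"
  define H where "H = (\<lambda>z::complex. z powr (- of_real b) * F (- of_real l * z powr (- of_real a)))"
  define S where "S = {z. 0 < Re z}"
  have oS: "open S" and cS: "connected S"
    unfolding S_def by (auto intro: open_halfspace_Re_gt convex_connected convex_halfspace_Re_gt)
  have gm: "g \<in> borel_measurable half_line"
    unfolding g_def by (intro mittag_leffler_measurable[OF a(1)]) measurable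
  have gb: "\<bar>g t\<bar> \<le> 1" for t
    unfolding g_def using mittag_leffler_neg_bounds[OF a, of "l * t powr a"] l by simp
  have Jhol: "J holomorphic_on S"
    unfolding J_def S_def by (rule laplace_holomorphic[OF b gm gb])
  have slit: "- of_real l * z powr (- of_real a) \<in> slit_plane" if "z \<in> S" for z
  proof -
    have z: "0 < Re z" "z \<noteq> 0" using that unfolding S_def by auto
    have "\<bar>Im (Ln z)\<bar> < pi / 2" using Re_Ln_pos_lt[OF z(2)] z(1) by simp
    then have "\<bar>a * Im (Ln z)\<bar> < pi / 2"
      using a mult_left_le_one_le[of "\<bar>Im (Ln z)\<bar>" a] by (simp add: abs_mult)
    then have "0 < cos (a * Im (Ln z))" by (intro cos_gt_zero_pi) auto
    then have "0 < Re (z powr (- of_real a))"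
      using z by (simp add: powr_def Re_exp)
    then have "Re (- of_real l * z powr (- of_real a)) < 0" using l by simp
    then show ?thesis by (simp add: slit_plane_iff)
  qed
  have Hhol: "H holomorphic_on S"
  proof -
    have nn: "z \<notin> \<real>\<^sub>\<le>\<^sub>0" if "z \<in> S" for z using that by (auto simp: S_def complex_nonpos_Reals_iff)
    have "(\<lambda>z. - of_real l * z powr (- of_real a)) holomorphic_on S"
      using nn by (intro holomorphic_intros) auto
    then have "(F \<circ> (\<lambda>z. - of_real l * z powr (- of_real a))) holomorphic_on S"
      using F slit unfolding slit_extension_def by (intro holomorphic_on_compose_gen[where t = slit_plane]) auto
    then show ?thesis using nn unfolding H_def o_def by (intro holomorphic_intros) auto
  qed
  have powr_real: "complex_of_real q powr (- of_real x) = of_real (q powr (- x))" if "0 < q" for q x :: real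
    using that powr_of_real[of q "- x"] by simp
  have Jreal: "J (of_real q) = of_real (LINT t|half_line. t powr (b - 1) * exp (- q * t) * g t)" for q
  proof -
    have "J (of_real q) = (LINT t|half_line. complex_of_real (t powr (b - 1) * exp (- q * t) * g t))"
      unfolding J_def by (intro Bochner_Integration.integral_cong refl) (simp add: exp_of_real[symmetric])
    then show ?thesis unfolding integral_complex_of_real .
  qed
  have large: "J (of_real q) = H (of_real q)" if q: "l powr (1 / a) < q" for q
  proof -
    have q0: "0 < q" using q powr_ge_zero[of l "1 / a"] by linarith
    have "(l powr (1 / a)) powr a < q powr a" using q a by (intro powr_less_mono2) auto
    then have "l < q powr a" using a l by (simp add: powr_powr)
    then have lq: "l * q powr (- a) < 1" using q0 by (simp add: powr_minus field_simps)
    define y where "y = l * q powr (- a)"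
    have y: "0 < y" "y < 1" unfolding y_def using l q0 lq by auto
    have trm: "x ^ k * q powr (- (b + a * real k)) * (Gamma (b + a * real k) / Gamma (a * real k + 1))
        = q powr (- b) * (ratio_coeff a b k * (x * q powr (- a)) ^ k)" for x k
    proof -
      have "q powr (- (b + a * real k)) = q powr ((- b) + (- a) * real k)" by (simp add: algebra_simps)
      also have "\<dots> = q powr (- b) * (q powr (- a)) powr real k" by (simp only: powr_add powr_powr)
      also have "(q powr (- a)) powr real k = (q powr (- a)) ^ k" using q0 by (intro powr_realpow) simp
      finally show ?thesis unfolding ratio_coeff_def by (simp add: power_mult_distrib)
    qed
    have ser: "(\<lambda>k. of_real (ratio_coeff a b k) * w ^ k) sums F w" if "norm w < 1" for w
      using F that unfolding slit_extension_def by auto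
    have "summable (\<lambda>k. complex_of_real (ratio_coeff a b k * y ^ k))"
      using sums_summable[OF ser[of "of_real y"]] y by simp
    then have sm: "summable (\<lambda>k. ratio_coeff a b k * y ^ k)" by (simp only: summable_complex_of_real)
    have "summable (\<lambda>k. \<bar>- l\<bar> ^ k * q powr (- (b + a * real k)) * (Gamma (b + a * real k) / Gamma (a * real k + 1)))"
      unfolding trm using sm l by (intro summable_mult) (simp add: y_def)
    from laplace_mittag_leffler_sums(2)[OF a(1) b q0 this]
    have "(\<lambda>k. q powr (- b) * (ratio_coeff a b k * (- l * q powr (- a)) ^ k)) sums (LINT t|half_line. t powr (b - 1) * exp (- q * t) * g t)"
      unfolding trm g_def .
    then have "(\<lambda>k. complex_of_real (q powr (- b) * (ratio_coeff a b k * (- l * q powr (- a)) ^ k))) sums J (of_real q)"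
      unfolding Jreal by (rule sums_of_real)
    moreover have "(\<lambda>k. of_real (q powr (- b)) * (of_real (ratio_coeff a b k) * (of_real (- l * q powr (- a))) ^ k)) sums (of_real (q powr (- b)) * F (of_real (- l * q powr (- a))))"
      using y by (intro sums_mult ser) (simp add: y_def norm_mult)
    ultimately have "J (of_real q) = of_real (q powr (- b)) * F (of_real (- l * q powr (- a)))"
      by (intro sums_unique2[of "\<lambda>k. complex_of_real (q powr (- b) * (ratio_coeff a b k * (- l * q powr (- a)) ^ k))"]) (simp_all del: of_real_minus)
    also have "\<dots> = H (of_real q)"
      unfolding H_def powr_real[OF q0] by (simp only: of_real_mult of_real_minus)
    finally show ?thesis .
  qed
  \<comment> \<open>Beyond \<open>q0\<close> the argument of the hypergeometric series lies in the unit disc.\<close>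
  define q0 where "q0 = l powr (1 / a)"
  define U where "U = complex_of_real ` {q0<..}"
  have q00: "0 < q0" unfolding q0_def using l by simp
  have "J (of_real p) - H (of_real p) = 0"
  proof (rule analytic_continuation[where f = "\<lambda>z. J z - H z" and S = S and U = U and \<xi> = "of_real (q0 + 1)"])
    show "(\<lambda>z. J z - H z) holomorphic_on S" by (intro holomorphic_on_diff Jhol Hhol)
    show "U \<subseteq> S" using q00 unfolding U_def S_def by auto
    show "complex_of_real (q0 + 1) \<in> S" using q00 unfolding S_def by simp
    show "complex_of_real (q0 + 1) islimpt U"
      unfolding islimpt_approachable
    proof (intro allI impI)
      fix e :: real assume e: "0 < e"
      have "complex_of_real (q0 + 1 + e / 2) \<in> U" unfolding U_def using e by (intro imageI) simp
      moreover have "dist (complex_of_real (q0 + 1 + e / 2)) (of_real (q0 + 1)) < e"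
        unfolding dist_of_real using e by (simp add: dist_real_def)
      moreover have "complex_of_real (q0 + 1 + e / 2) \<noteq> of_real (q0 + 1)" unfolding of_real_eq_iff using e by simp
      ultimately show "\<exists>x'\<in>U. x' \<noteq> complex_of_real (q0 + 1) \<and> dist x' (complex_of_real (q0 + 1)) < e" by blast
    qed
    show "J z - H z = 0" if "z \<in> U" for z using that large unfolding U_def q0_def by auto
    show "complex_of_real p \<in> S" using p unfolding S_def by simp
  qed (rule oS cS)+
  then have "J (of_real p) = H (of_real p)" by simp
  also have "H (of_real p) = of_real (p powr (- b)) * F (of_real (- (l * p powr (- a))))"
    unfolding H_def powr_real[OF p] by (simp only: of_real_mult of_real_minus mult_minus_left)
  also have "l * p powr (- a) = l / p powr a" by (simp add: powr_minus divide_inverse)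
  also have "F (of_real (- (l / p powr a))) = of_real (Gamma b) * hyp_2R1 1 (of_real b) 1 a (of_real (- (l / p powr a)))"
  proof (rule hypF[symmetric])
    have "- (l / p powr a) < 1" using l p by (smt (verit) divide_pos_pos powr_gt_zero)
    then show "complex_of_real (- (l / p powr a)) \<in> slit_plane" by (simp add: slit_plane_iff del: of_real_minus of_real_divide)
  qed
  finally show ?thesis unfolding Jreal g_def by (simp add: powr_minus divide_inverse)
qed

section \<open>Differentiable characteristic functions and even moments\<close>

text \<open>Differentiability of a given order everywhere on the line. A recursive predicate makes closure under
products and exponentials a short induction, without formulas for higher derivatives.\<close>

primrec times_differentiable :: "nat \<Rightarrow> (real \<Rightarrow> complex) \<Rightarrow> bool" where
  "times_differentiable 0 f = True"
| "times_differentiable (Suc k) f = (\<exists>f'. (\<forall>t. (f has_vector_derivative f' t) (at t)) \<and> times_differentiable k f')"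

lemma times_differentiable_Suc_imp: "times_differentiable (Suc k) f \<Longrightarrow> times_differentiable k f"
proof (induction k arbitrary: f)
  case (Suc k)
  then obtain f' where "\<forall>t. (f has_vector_derivative f' t) (at t)" "times_differentiable (Suc k) f'" by auto
  with Suc.IH[of f'] show ?case by auto
qed simp

lemma times_differentiable_add:
  "times_differentiable k f \<Longrightarrow> times_differentiable k g \<Longrightarrow> times_differentiable k (\<lambda>t. f t + g t)"
proof (induction k arbitrary: f g)
  case (Suc k)
  then obtain f' g' where "\<forall>t. (f has_vector_derivative f' t) (at t)" "times_differentiable k f'"
     "\<forall>t. (g has_vector_derivative g' t) (at t)" "times_differentiable k g'" by auto
  with Suc.IH[of f' g'] show ?case by (auto intro!: exI[of _ "\<lambda>t. f' t + g' t"] has_vector_derivative_add)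
qed simp

lemma times_differentiable_mult:
  "times_differentiable k f \<Longrightarrow> times_differentiable k g \<Longrightarrow> times_differentiable k (\<lambda>t. f t * g t)"
proof (induction k arbitrary: f g)
  case (Suc k)
  obtain f' where f': "\<forall>t. (f has_vector_derivative f' t) (at t)" "times_differentiable k f'"
    using Suc.prems(1) by auto
  obtain g' where g': "\<forall>t. (g has_vector_derivative g' t) (at t)" "times_differentiable k g'"
    using Suc.prems(2) by auto
  have "\<forall>t. ((\<lambda>t. f t * g t) has_vector_derivative (f t * g' t + f' t * g t)) (at t)"
    using f' g' by (auto intro!: has_vector_derivative_mult)
  moreover have "times_differentiable k (\<lambda>t. f t * g' t + f' t * g t)"
    by (intro times_differentiable_add Suc.IH f'(2) g'(2) Suc.prems[THEN times_differentiable_Suc_imp])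
  ultimately show ?case by (auto intro!: exI[of _ "\<lambda>t. f t * g' t + f' t * g t"])
qed simp

lemma has_vector_derivative_exp_comp:
  assumes "(f has_vector_derivative f') (at t)"
  shows "((\<lambda>t. exp (f t :: complex)) has_vector_derivative f' * exp (f t)) (at t)"
  using field_vector_diff_chain_at[OF assms DERIV_exp] by (simp add: o_def)

lemma times_differentiable_exp:
  "times_differentiable k f \<Longrightarrow> times_differentiable k (\<lambda>t. exp (f t))"
proof (induction k)
  case (Suc k)
  then obtain f' where f': "\<forall>t. (f has_vector_derivative f' t) (at t)" "times_differentiable k f'" by auto
  have "\<forall>t. ((\<lambda>t. exp (f t)) has_vector_derivative f' t * exp (f t)) (at t)"
    using f' by (auto intro!: has_vector_derivative_exp_comp)
  moreover have "times_differentiable k (\<lambda>t. f' t * exp (f t))"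
    by (intro times_differentiable_mult f'(2) Suc.IH Suc.prems[THEN times_differentiable_Suc_imp])
  ultimately show ?case by (auto intro!: exI[of _ "\<lambda>t. f' t * exp (f t)"])
qed simp

lemma integrable_iexp_weight:
  fixes c :: "'x \<Rightarrow> complex" and X :: "'x \<Rightarrow> real"
  assumes "integrable M c" "X \<in> borel_measurable M"
  shows "integrable M (\<lambda>x. c x * iexp (t * X x))"
proof (rule Bochner_Integration.integrable_bound[OF assms(1)])
  note [measurable] = assms(2) borel_measurable_integrable[OF assms(1)]
  show "(\<lambda>x. c x * iexp (t * X x)) \<in> borel_measurable M" by measurable
qed (simp add: norm_mult)

lemma has_vector_derivative_fourier_integral:
  fixes c :: "'x \<Rightarrow> complex" and X :: "'x \<Rightarrow> real"
  assumes c: "integrable M c" and X: "X \<in> borel_measurable M" and cX: "integrable M (\<lambda>x. c x * of_real (X x))"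
  shows "((\<lambda>t. LINT x|M. c x * iexp (t * X x)) has_vector_derivative
           (LINT x|M. (c x * (\<i> * of_real (X x))) * iexp (t * X x))) (at t)"
proof (rule has_vector_derivative_lebesgue_integral[where e = 1 and h = "\<lambda>x. norm (c x * of_real (X x))"
     and d = "\<lambda>t x. (c x * (\<i> * of_real (X x))) * iexp (t * X x)"])
  note [measurable] = X borel_measurable_integrable[OF c]
  show "integrable M (\<lambda>x. c x * iexp (s * X x))" for s by (rule integrable_iexp_weight[OF c X])
  show "(\<lambda>x. (c x * (\<i> * of_real (X x))) * iexp (t * X x)) \<in> borel_measurable M" by measurable
  show "integrable M (\<lambda>x. norm (c x * of_real (X x)))" using cX by simp
  show "((\<lambda>t. c x * iexp (t * X x)) has_vector_derivative (c x * (\<i> * of_real (X x))) * iexp (s * X x)) (at s)" for s x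
  proof -
    have "((\<lambda>t. \<i> * of_real (t * X x)) has_vector_derivative \<i> * of_real (X x)) (at s)"
      by (auto intro!: derivative_eq_intros simp: has_vector_derivative_def scaleR_conv_of_real)
    from has_vector_derivative_mult_right[OF has_vector_derivative_exp_comp[OF this], of "c x"]
    show ?thesis by (simp add: mult_ac)
  qed
qed (simp_all add: norm_mult)

lemma one_minus_cos_scaled_tendsto:
  fixes x e :: real
  assumes e: "0 < e"
  shows "(\<lambda>n. (1 - cos (e / (real n + 1) * x)) / (e / (real n + 1))\<^sup>2) \<longlonglongrightarrow> x\<^sup>2 / 2"
proof -
  define y where "y = e * x"
  have "(\<lambda>n. (1 - cos (y / (real n + 1))) * (real n + 1)\<^sup>2) \<longlonglongrightarrow> y * y / 2"
  proof -
    consider "y = 0" | "y > 0" | "y < 0" by linarith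
    then show ?thesis
    proof cases
      case 1
      then show ?thesis by simp
    next
      case 2
      then show ?thesis by real_asymp
    next
      case 3
      then show ?thesis by real_asymp
    qed
  qed
  then have "(\<lambda>n. (1 - cos (y / (real n + 1))) * (real n + 1)\<^sup>2 / e\<^sup>2) \<longlonglongrightarrow> y * y / 2 / e\<^sup>2"
    using e by (intro tendsto_divide tendsto_const) auto
  also have "y * y / 2 / e\<^sup>2 = x\<^sup>2 / 2" unfolding y_def using e by (simp add: power2_eq_square)
  also have "(\<lambda>n. (1 - cos (y / (real n + 1))) * (real n + 1)\<^sup>2 / e\<^sup>2) = (\<lambda>n. (1 - cos (e / (real n + 1) * x)) / (e / (real n + 1))\<^sup>2)"
    unfolding y_def by (simp add: power_divide)
  finally show ?thesis .
qed

text \<open>Fatou's lemma along \<open>h = e / (n + 1)\<close>. The weight \<open>f\<close> may have infinite mass, as Levy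
  densities do.\<close>

lemma nn_integral_square_le_of_cos_bound:
  fixes X f :: "'x \<Rightarrow> real"
  assumes [measurable]: "X \<in> borel_measurable M" "f \<in> borel_measurable M" and f0: "\<And>x. 0 \<le> f x"
    and e: "0 < e"
    and bnd: "\<And>h. 0 < h \<Longrightarrow> h \<le> e \<Longrightarrow> (\<integral>\<^sup>+x. ennreal ((1 - cos (h * X x)) * f x) \<partial>M) \<le> ennreal (C * h\<^sup>2)"
  shows "(\<integral>\<^sup>+x. ennreal (f x * (X x)\<^sup>2 / 2) \<partial>M) \<le> ennreal C"
proof -
  define h where "h = (\<lambda>n. e / (real n + 1))"
  have h: "0 < h n" "h n \<le> e" for n unfolding h_def using e by (auto simp: field_simps)
  define u where "u = (\<lambda>n x. ennreal ((1 - cos (h n * X x)) / (h n)\<^sup>2 * f x))"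
  have "liminf (\<lambda>n. u n x) = ennreal (f x * (X x)\<^sup>2 / 2)" for x
  proof -
    have "(\<lambda>n. (1 - cos (h n * X x)) / (h n)\<^sup>2 * f x) \<longlonglongrightarrow> (X x)\<^sup>2 / 2 * f x"
      unfolding h_def by (intro tendsto_mult_right one_minus_cos_scaled_tendsto e)
    then have "(\<lambda>n. u n x) \<longlonglongrightarrow> ennreal ((X x)\<^sup>2 / 2 * f x)" unfolding u_def by (rule tendsto_ennrealI)
    then show ?thesis by (simp add: lim_imp_Liminf mult.commute)
  qed
  then have "(\<integral>\<^sup>+x. ennreal (f x * (X x)\<^sup>2 / 2) \<partial>M) = (\<integral>\<^sup>+x. liminf (\<lambda>n. u n x) \<partial>M)" by simp
  also have "\<dots> \<le> liminf (\<lambda>n. \<integral>\<^sup>+x. u n x \<partial>M)"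
    by (rule nn_integral_liminf) (simp add: u_def)
  also have "\<dots> \<le> liminf (\<lambda>n::nat. ennreal C)"
  proof (intro Liminf_mono always_eventually allI)
    fix n
    have "(\<integral>\<^sup>+x. u n x \<partial>M) = (\<integral>\<^sup>+x. ennreal (1 / (h n)\<^sup>2) * ennreal ((1 - cos (h n * X x)) * f x) \<partial>M)"
      unfolding u_def by (intro nn_integral_cong) (simp add: ennreal_mult'[symmetric])
    also have "\<dots> = ennreal (1 / (h n)\<^sup>2) * (\<integral>\<^sup>+x. ennreal ((1 - cos (h n * X x)) * f x) \<partial>M)"
      by (rule nn_integral_cmult) measurable
    also have "\<dots> \<le> ennreal (1 / (h n)\<^sup>2) * ennreal (C * (h n)\<^sup>2)"
      by (intro mult_left_mono bnd h) auto
    also have "\<dots> = ennreal C" using h(1)[of n] by (subst ennreal_mult'[symmetric]) auto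
    finally show "(\<integral>\<^sup>+x. u n x \<partial>M) \<le> ennreal C" .
  qed
  also have "\<dots> = ennreal C" by (rule Liminf_const) simp
  finally show ?thesis .
qed

text \<open>Since \<open>G'\<close> is differentiable at \<open>0\<close>, the derivative \<open>G'(s) - G'(- s)\<close> of \<open>G(s) + G(- s)\<close> is of order \<open>s\<close>.\<close>

lemma second_difference_bound:
  fixes G :: "real \<Rightarrow> complex"
  assumes G1: "\<And>t. (G has_vector_derivative G' t) (at t)" and G2: "(G' has_vector_derivative L) (at 0)"
  obtains C e where "0 < e" "\<And>h. 0 < h \<Longrightarrow> h \<le> e \<Longrightarrow> norm (G h + G (- h) - 2 * G 0) \<le> C * h\<^sup>2"
proof -
  have "\<exists>e>0. \<forall>s. norm (s - 0) < e \<longrightarrow> norm (G' s - G' 0 - (s - 0) *\<^sub>R L) \<le> 1 * norm (s - 0)"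
    using G2 unfolding has_vector_derivative_def has_derivative_at_alt by (metis zero_less_one)
  then obtain e where e: "0 < e" "\<And>s. \<bar>s\<bar> < e \<Longrightarrow> norm (G' s - G' 0 - s *\<^sub>R L) \<le> \<bar>s\<bar>" by auto
  define K where "K = 1 + norm L"
  have K: "norm (G' s - G' 0) \<le> K * \<bar>s\<bar>" if "\<bar>s\<bar> < e" for s
  proof -
    have "norm (G' s - G' 0) \<le> norm (G' s - G' 0 - s *\<^sub>R L) + norm (s *\<^sub>R L)"
      using norm_triangle_ineq[of "G' s - G' 0 - s *\<^sub>R L" "s *\<^sub>R L"] by simp
    also have "\<dots> \<le> \<bar>s\<bar> + \<bar>s\<bar> * norm L" using e(2)[OF that] by simp
    finally show ?thesis unfolding K_def by (simp add: algebra_simps)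
  qed
  have "norm (G h + G (- h) - 2 * G 0) \<le> (2 * K) * h\<^sup>2" if h: "0 < h" "h \<le> e / 2" for h
  proof -
    have "norm ((G h + G (- h)) - (G 0 + G (- 0))) \<le> (2 * K * h) * norm (h - 0)"
    proof (rule differentiable_bound[where S = "{0..h}" and f = "\<lambda>s. G s + G (- s)" and f' = "\<lambda>s v. v *\<^sub>R (G' s - G' (- s))"])
      show "((\<lambda>s. G s + G (- s)) has_derivative (\<lambda>v. v *\<^sub>R (G' s - G' (- s)))) (at s within {0..h})" for s
      proof -
        have "((\<lambda>s. G (- s)) has_vector_derivative (-1) *\<^sub>R G' (- s)) (at s)"
        proof -
          have "((\<lambda>s::real. - s) has_vector_derivative - 1) (at s)"
            by (auto intro!: derivative_eq_intros)
          from vector_diff_chain_at[where g = G and g' = "G' (- s)", OF this G1] show ?thesis by (simp add: o_def)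
        qed
        from has_vector_derivative_add[OF G1[of s] this]
        show ?thesis unfolding has_vector_derivative_def by (rule has_derivative_at_withinI[OF has_derivative_eq_rhs]) simp
      qed
      show "onorm (\<lambda>v. v *\<^sub>R (G' s - G' (- s))) \<le> 2 * K * h" if s: "s \<in> {0..h}" for s
      proof (rule onorm_le)
        fix v :: real
        have "norm (G' s - G' (- s)) \<le> norm (G' s - G' 0) + norm (G' (- s) - G' 0)"
          using norm_triangle_ineq4[of "G' s - G' 0" "G' (- s) - G' 0"] by simp
        also have "\<dots> \<le> K * s + K * s" using K[of s] K[of "- s"] s h e(1) by simp
        also have "\<dots> = 2 * K * s" by simp
        also have "\<dots> \<le> 2 * K * h" using s unfolding K_def by (intro mult_left_mono) auto
        finally have "\<bar>v\<bar> * norm (G' s - G' (- s)) \<le> \<bar>v\<bar> * (2 * K * h)" by (rule mult_left_mono) simp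
        then show "norm (v *\<^sub>R (G' s - G' (- s))) \<le> 2 * K * h * norm v"
          by (simp only: norm_scaleR real_norm_def mult.commute)
      qed
    qed (use h in auto)
    then show ?thesis using h by (simp add: power2_eq_square mult_ac)
  qed
  then show ?thesis using e(1) by (intro that[of "e / 2" "2 * K"]) auto
qed

text \<open>The second difference at \<open>0\<close> of the weighted characteristic function is minus the integral of
\<open>2 f (1 - cos (h X))\<close>.\<close>

lemma integrable_square_of_twice_differentiable:
  fixes X f :: "'x \<Rightarrow> real"
  assumes X [measurable]: "X \<in> borel_measurable M" and f: "integrable M f" and f0: "\<And>x. 0 \<le> f x"
    and G1: "\<And>t. ((\<lambda>t. LINT x|M. of_real (f x) * iexp (t * X x)) has_vector_derivative G' t) (at t)"
    and G2: "(G' has_vector_derivative L) (at 0)"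
  shows "integrable M (\<lambda>x. f x * (X x)\<^sup>2)"
proof -
  note [measurable] = borel_measurable_integrable[OF f]
  define G where "G = (\<lambda>t. LINT x|M. of_real (f x) * iexp (t * X x))"
  have fc: "integrable M (\<lambda>x. complex_of_real (f x))" using f by simp
  note gint = integrable_iexp_weight[OF fc X]
  have G1': "(G has_vector_derivative G' t) (at t)" for t using G1[of t] unfolding G_def .
  obtain C e where e: "0 < e" and C: "\<And>h. 0 < h \<Longrightarrow> h \<le> e \<Longrightarrow> norm (G h + G (- h) - 2 * G 0) \<le> C * h\<^sup>2"
    using second_difference_bound[of G, OF G1' G2] by metis
  have cosint: "integrable M (\<lambda>x. 2 * ((1 - cos (h * X x)) * f x))" for h
  proof (rule Bochner_Integration.integrable_bound[of _ "\<lambda>x. 4 * f x"])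
    show "AE x in M. norm (2 * ((1 - cos (h * X x)) * f x)) \<le> norm (4 * f x)"
    proof (rule AE_I2)
      fix x
      have "\<bar>1 - cos (h * X x)\<bar> \<le> 2" using abs_cos_le_one[of "h * X x"] by linarith
      then have "\<bar>1 - cos (h * X x)\<bar> * f x \<le> 2 * f x" using f0 by (rule mult_right_mono)
      then show "norm (2 * ((1 - cos (h * X x)) * f x)) \<le> norm (4 * f x)" using f0[of x] by (simp add: abs_mult mult.commute)
    qed
  qed (use f in simp_all)
  have eq: "G h + G (- h) - 2 * G 0 = - of_real (LINT x|M. 2 * ((1 - cos (h * X x)) * f x))" for h
  proof -
    have "G h + G (- h) - 2 * G 0 = (LINT x|M. of_real (f x) * iexp (h * X x) + of_real (f x) * iexp (- h * X x) - 2 * (of_real (f x) * iexp (0 * X x)))"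
      unfolding G_def using gint[of h] gint[of "- h"] gint[of 0] by simp
    also have "\<dots> = (LINT x|M. complex_of_real (- (2 * ((1 - cos (h * X x)) * f x))))"
    proof (intro Bochner_Integration.integral_cong refl)
      fix x
      have "iexp (h * X x) + iexp (- h * X x) = of_real (2 * cos (h * X x))"
        unfolding cis_conv_exp[symmetric] by (simp add: complex_eq_iff)
      then have "of_real (f x) * (iexp (h * X x) + iexp (- h * X x)) - 2 * of_real (f x) = of_real (f x * (2 * cos (h * X x)) - 2 * f x)" by simp
      then show "of_real (f x) * iexp (h * X x) + of_real (f x) * iexp (- h * X x) - 2 * (of_real (f x) * iexp (0 * X x)) = complex_of_real (- (2 * ((1 - cos (h * X x)) * f x)))"
        by (simp add: algebra_simps)
    qed
    also have "\<dots> = - of_real (LINT x|M. 2 * ((1 - cos (h * X x)) * f x))" unfolding integral_complex_of_real by simp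
    finally show ?thesis .
  qed
  have "(\<integral>\<^sup>+x. ennreal (f x * (X x)\<^sup>2 / 2) \<partial>M) \<le> ennreal (C / 2)"
  proof (rule nn_integral_square_le_of_cos_bound[OF X _ f0 e])
    fix h :: real assume h: "0 < h" "h \<le> e"
    have i: "integrable M (\<lambda>x. (1 - cos (h * X x)) * f x)" using cosint[of h] by simp
    have "2 * (LINT x|M. (1 - cos (h * X x)) * f x) \<le> C * h\<^sup>2"
      using C[OF h] unfolding eq norm_minus_cancel norm_of_real by simp
    moreover have "(\<integral>\<^sup>+x. ennreal ((1 - cos (h * X x)) * f x) \<partial>M) = ennreal (LINT x|M. (1 - cos (h * X x)) * f x)"
      using f0 by (intro nn_integral_eq_integral i AE_I2 mult_nonneg_nonneg) auto
    ultimately show "(\<integral>\<^sup>+x. ennreal ((1 - cos (h * X x)) * f x) \<partial>M) \<le> ennreal (C / 2 * h\<^sup>2)"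
      by (auto intro: ennreal_leI)
  qed simp
  then have "integrable M (\<lambda>x. f x * (X x)\<^sup>2 / 2)"
    using f0 by (intro integrableI_nonneg) (auto simp: le_less_trans)
  from integrable_mult_right[OF this, of 2] show ?thesis by simp
qed

lemma integrable_intermediate_power:
  fixes X f :: "'x \<Rightarrow> real"
  assumes X [measurable]: "X \<in> borel_measurable M" and f: "integrable M f" and f0: "\<And>x. 0 \<le> f x"
    and fX: "integrable M (\<lambda>x. f x * X x ^ n)" and n: "even n" "k \<le> n"
  shows "integrable M (\<lambda>x. f x * X x ^ k)"
proof (rule Bochner_Integration.integrable_bound)
  note [measurable] = borel_measurable_integrable[OF f]
  show "(\<lambda>x. f x * X x ^ k) \<in> borel_measurable M" by measurable
  show "integrable M (\<lambda>x. f x + f x * X x ^ n)" using f fX by simp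
  show "AE x in M. norm (f x * X x ^ k) \<le> norm (f x + f x * X x ^ n)"
  proof (rule AE_I2)
    fix x
    have "\<bar>X x\<bar> ^ k \<le> 1 + \<bar>X x\<bar> ^ n"
    proof (cases "\<bar>X x\<bar> \<le> 1")
      case True
      then have "\<bar>X x\<bar> ^ k \<le> 1" by (intro power_le_one) auto
      then show ?thesis by (simp add: add_increasing2)
    next
      case False
      then have "\<bar>X x\<bar> ^ k \<le> \<bar>X x\<bar> ^ n" using n by (intro power_increasing) auto
      then show ?thesis by simp
    qed
    then have "f x * \<bar>X x\<bar> ^ k \<le> f x * (1 + \<bar>X x\<bar> ^ n)" using f0 by (rule mult_left_mono)
    also have "\<bar>X x\<bar> ^ n = X x ^ n" using n by (simp add: power_even_abs)
    finally show "norm (f x * X x ^ k) \<le> norm (f x + f x * X x ^ n)"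
      using f0[of x] zero_le_even_power[OF n(1), of "X x"] by (simp add: abs_mult power_abs algebra_simps)
  qed
qed

text \<open>The weight \<open>f\<close> is general so that the induction can pass from \<open>f\<close> to \<open>f X\<^sup>2\<close>: minus the second derivative of the
transform of \<open>f\<close> is the transform of \<open>f X\<^sup>2\<close>.\<close>

theorem integrable_even_power_of_times_differentiable:
  fixes X f :: "'x \<Rightarrow> real"
  assumes X [measurable]: "X \<in> borel_measurable M" and "integrable M f" "\<And>x. 0 \<le> f x"
    and "times_differentiable (2 * k) (\<lambda>t. LINT x|M. of_real (f x) * iexp (t * X x))"
  shows "integrable M (\<lambda>x. f x * X x ^ (2 * k))"
  using assms(2-4)
proof (induction k arbitrary: f)
  case (Suc k)
  define G where "G = (\<lambda>t. LINT x|M. of_real (f x) * iexp (t * X x))"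
  have "times_differentiable (Suc (Suc (2 * k))) G" using Suc.prems(3) unfolding G_def by simp
  then obtain G' G'' where G': "\<And>t. (G has_vector_derivative G' t) (at t)"
    and G'': "\<And>t. (G' has_vector_derivative G'' t) (at t)" and d: "times_differentiable (2 * k) G''"
    by auto
  note f = Suc.prems(1,2)
  have f2: "integrable M (\<lambda>x. f x * (X x)\<^sup>2)"
    by (rule integrable_square_of_twice_differentiable[OF X f G'[unfolded G_def] G''])
  have f1: "integrable M (\<lambda>x. f x * X x)"
    using integrable_intermediate_power[OF X f f2, of 1] by simp
  have c0: "integrable M (\<lambda>x. complex_of_real (f x))" using f by simp
  have c1: "integrable M (\<lambda>x. complex_of_real (f x) * of_real (X x))"
    using f1 by (simp only: of_real_mult[symmetric] integrable_of_real)
  have c2: "integrable M (\<lambda>x. complex_of_real (f x) * of_real (X x) * of_real (X x))"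
    using f2 by (simp only: of_real_mult[symmetric] integrable_of_real power2_eq_square mult.assoc)
  have e1: "G' = (\<lambda>t. LINT x|M. (of_real (f x) * (\<i> * of_real (X x))) * iexp (t * X x))"
  proof
    fix t
    show "G' t = (LINT x|M. (of_real (f x) * (\<i> * of_real (X x))) * iexp (t * X x))"
      using vector_derivative_unique_at[OF G'[of t] has_vector_derivative_fourier_integral[OF c0 X c1, folded G_def]] .
  qed
  have i1: "integrable M (\<lambda>x. complex_of_real (f x) * (\<i> * of_real (X x)))"
    using integrable_mult_right[OF c1, of \<i>] by (simp add: mult_ac)
  have i2: "integrable M (\<lambda>x. complex_of_real (f x) * (\<i> * of_real (X x)) * of_real (X x))"
    using integrable_mult_right[OF c2, of \<i>] by (simp add: mult_ac)
  have e2: "- 1 * G'' t = (LINT x|M. of_real (f x * (X x)\<^sup>2) * iexp (t * X x))" for t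
  proof -
    have "G'' t = (LINT x|M. (of_real (f x) * (\<i> * of_real (X x)) * (\<i> * of_real (X x))) * iexp (t * X x))"
      using vector_derivative_unique_at[OF G''[of t] has_vector_derivative_fourier_integral[OF i1 X i2, folded e1]] .
    also have "\<dots> = (LINT x|M. - (of_real (f x * (X x)\<^sup>2) * iexp (t * X x)))"
    proof (intro Bochner_Integration.integral_cong refl)
      fix x
      have "(\<i> * complex_of_real (X x))\<^sup>2 = - of_real ((X x)\<^sup>2)" by (simp add: power_mult_distrib)
      then have "of_real (f x) * (\<i> * complex_of_real (X x)) * (\<i> * of_real (X x)) = - of_real (f x * (X x)\<^sup>2)"
        by (simp add: power2_eq_square mult.assoc)
      then show "(of_real (f x) * (\<i> * of_real (X x)) * (\<i> * of_real (X x))) * iexp (t * X x) = - (of_real (f x * (X x)\<^sup>2) * iexp (t * X x))"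
        by simp
    qed
    finally show ?thesis by simp
  qed
  have "times_differentiable (2 * k) (\<lambda>t::real. - 1 :: complex)"
  proof (induction "2 * k")
    case (Suc n)
    have z: "times_differentiable j (\<lambda>t::real. 0 :: complex)" for j
      by (induction j) (auto intro!: exI[of _ "\<lambda>t. 0"])
    then show ?case unfolding Suc(2)[symmetric] by (auto intro!: exI[of _ "\<lambda>t. 0"])
  qed simp
  from times_differentiable_mult[OF this d] have "times_differentiable (2 * k) (\<lambda>t. LINT x|M. of_real (f x * (X x)\<^sup>2) * iexp (t * X x))"
    unfolding e2 .
  from Suc.IH[OF f2 _ this] f have "integrable M (\<lambda>x. f x * (X x)\<^sup>2 * X x ^ (2 * k))" by simp
  then show ?case by (simp add: power_add power2_eq_square mult_ac)
qed simp

section \<open>First moments and the kernel of one minus cosine\<close>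

lemma one_minus_cos_le: "1 - cos y \<le> y\<^sup>2 / 2" for y :: real
proof -
  have "(sin (y / 2))\<^sup>2 \<le> (y / 2)\<^sup>2" using abs_sin_x_le_abs_x[of "y / 2"] by (simp only: abs_le_square_iff)
  then show ?thesis using cos_double_sin[of "y / 2"] by (simp add: power_divide)
qed

lemma one_minus_cos_ge:
  fixes y :: real
  assumes "\<bar>y\<bar> \<le> 1"
  shows "y\<^sup>2 / 4 \<le> 1 - cos y"
proof -
  have half: "1 / 2 \<le> cos z" if "0 \<le> z" "z \<le> 1" for z :: real
  proof -
    have "cos (pi / 3) \<le> cos z" using that pi_gt3 by (intro cos_monotone_0_pi_le) auto
    then show ?thesis by (simp add: cos_60)
  qed
  have s: "z / 2 \<le> sin z" if "0 \<le> z" "z \<le> 1" for z :: real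
  proof -
    have "sin 0 - 0 / 2 \<le> sin z - z / 2"
    proof (rule DERIV_nonneg_imp_nondecreasing[OF that(1)])
      fix x assume "0 \<le> x" "x \<le> z"
      then have "0 \<le> cos x - 1 / 2" using half[of x] that by simp
      then show "\<exists>d. ((\<lambda>x. sin x - x / 2) has_real_derivative d) (at x) \<and> 0 \<le> d"
        by (intro exI[of _ "cos x - 1 / 2"]) (auto intro!: derivative_eq_intros)
    qed
    then show ?thesis by simp
  qed
  have "z\<^sup>2 / 4 \<le> 1 - cos z" if "0 \<le> z" "z \<le> 1" for z :: real
  proof -
    have "1 - cos 0 - 0\<^sup>2 / 4 \<le> 1 - cos z - z\<^sup>2 / 4"
    proof (rule DERIV_nonneg_imp_nondecreasing[OF that(1)])
      fix x assume "0 \<le> x" "x \<le> z"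
      then have "0 \<le> sin x - x / 2" using s[of x] that by simp
      then show "\<exists>d. ((\<lambda>x. 1 - cos x - x\<^sup>2 / 4) has_real_derivative d) (at x) \<and> 0 \<le> d"
        by (intro exI[of _ "sin x - x / 2"]) (auto intro!: derivative_eq_intros)
    qed
    then show ?thesis by simp
  qed
  from this[of "\<bar>y\<bar>"] assms show ?thesis by simp
qed

text \<open>Quadratic in \<open>x\<close> near the origin and comparable with \<open>\<bar>x\<bar>\<close> for \<open>\<bar>x\<bar> \<ge> 1\<close>.\<close>

definition cos_kernel :: "real \<Rightarrow> ennreal" where
  "cos_kernel x = (\<integral>\<^sup>+t. ennreal ((1 - cos (t * x)) / t\<^sup>2) \<partial>unit_interval)"

lemma nn_integral_unit_interval:
  "(\<integral>\<^sup>+t. f t \<partial>unit_interval) = (\<integral>\<^sup>+t. f t * indicator {0<..<1} t \<partial>lborel)"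
  by (subst nn_integral_restrict_space) auto

lemma cos_kernel_small: "cos_kernel x \<le> ennreal (x\<^sup>2)"
proof -
  have "cos_kernel x \<le> (\<integral>\<^sup>+t. ennreal (x\<^sup>2) \<partial>unit_interval)"
    unfolding cos_kernel_def
  proof (intro nn_integral_mono ennreal_leI)
    fix t assume "t \<in> space unit_interval"
    then have t: "t > 0" by simp
    then have "(1 - cos (t * x)) / t\<^sup>2 \<le> ((t * x)\<^sup>2 / 2) / t\<^sup>2"
      using one_minus_cos_le[of "t * x"] by (intro divide_right_mono) auto
    also have "\<dots> \<le> x\<^sup>2" using t by (simp add: power_mult_distrib)
    finally show "(1 - cos (t * x)) / t\<^sup>2 \<le> x\<^sup>2" .
  qed
  also have "\<dots> = ennreal (x\<^sup>2)" by (simp add: emeasure_restrict_space)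
  finally show ?thesis .
qed

text \<open>The bound \<open>x\<^sup>2 / 2\<close> of the integrand is used up to \<open>t = 1 / \<bar>x\<bar>\<close> and the bound \<open>2 / t\<^sup>2\<close> beyond.\<close>

lemma cos_kernel_large:
  assumes x: "1 \<le> \<bar>x\<bar>"
  shows "cos_kernel x \<le> ennreal (3 * \<bar>x\<bar>)"
proof -
  define c where "c = 1 / \<bar>x\<bar>"
  have c: "0 < c" "c \<le> 1" unfolding c_def using x by auto
  have "cos_kernel x \<le> (\<integral>\<^sup>+t. ennreal (x\<^sup>2 / 2) * indicator {0..c} t + ennreal (2 / t\<^sup>2) * indicator {c..1} t \<partial>lborel)"
    unfolding cos_kernel_def nn_integral_unit_interval
  proof (intro nn_integral_mono)
    fix t :: real
    show "ennreal ((1 - cos (t * x)) / t\<^sup>2) * indicator {0<..<1} t \<le> ennreal (x\<^sup>2 / 2) * indicator {0..c} t + ennreal (2 / t\<^sup>2) * indicator {c..1} t"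
    proof (cases "t \<in> {0<..<1}")
      case True
      then have t: "0 < t" "t < 1" by auto
      have 1: "(1 - cos (t * x)) / t\<^sup>2 \<le> x\<^sup>2 / 2"
      proof -
        have "(1 - cos (t * x)) / t\<^sup>2 \<le> ((t * x)\<^sup>2 / 2) / t\<^sup>2"
          using one_minus_cos_le[of "t * x"] by (intro divide_right_mono) auto
        also have "\<dots> = x\<^sup>2 / 2" using t by (simp add: power_mult_distrib)
        finally show ?thesis .
      qed
      have 2: "(1 - cos (t * x)) / t\<^sup>2 \<le> 2 / t\<^sup>2"
        using cos_ge_minus_one[of "t * x"] by (intro divide_right_mono) auto
      show ?thesis
      proof (cases "t \<le> c")
        case True
        then have "ennreal ((1 - cos (t * x)) / t\<^sup>2) * indicator {0<..<1} t \<le> ennreal (x\<^sup>2 / 2) * indicator {0..c} t"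
          using t 1 by (simp add: ennreal_leI)
        then show ?thesis by (rule order_trans) (rule add_increasing2, auto)
      next
        case False
        then have "ennreal ((1 - cos (t * x)) / t\<^sup>2) * indicator {0<..<1} t \<le> ennreal (2 / t\<^sup>2) * indicator {c..1} t"
          using t 2 by (simp add: ennreal_leI)
        then show ?thesis by (rule order_trans) (rule add_increasing, auto)
      qed
    qed simp
  qed
  also have "\<dots> = ennreal (x\<^sup>2 / 2) * ennreal c + (\<integral>\<^sup>+t. ennreal (2 / t\<^sup>2) * indicator {c..1} t \<partial>lborel)"
    using c by (subst nn_integral_add) (auto simp: nn_integral_cmult_indicator)
  also have "(\<integral>\<^sup>+t. ennreal (2 / t\<^sup>2) * indicator {c..1} t \<partial>lborel) = ennreal (- 2 / 1 - (- 2 / c))"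
    by (rule nn_integral_FTC_Icc) (use c in \<open>auto intro!: derivative_eq_intros simp: power2_eq_square\<close>)
  also have "ennreal (x\<^sup>2 / 2) * ennreal c + ennreal (- 2 / 1 - (- 2 / c)) = ennreal (x\<^sup>2 / 2 * c + (2 / c - 2))"
  proof -
    have "0 \<le> 2 / c - 2" using c by (simp add: field_simps)
    then show ?thesis using c by (simp add: ennreal_mult''[symmetric])
  qed
  also have "x\<^sup>2 / 2 * c + (2 / c - 2) \<le> 3 * \<bar>x\<bar>"
  proof -
    have "x\<^sup>2 * c = \<bar>x\<bar>" unfolding c_def using x by (simp add: power2_eq_square divide_simps)
    then show ?thesis unfolding c_def using x by simp
  qed
  finally show ?thesis by (simp add: ennreal_leI)
qed

text \<open>On \<open>0 < t < 1 / \<bar>x\<bar>\<close> the integrand is at least \<open>x\<^sup>2 / 4\<close>.\<close>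

lemma cos_kernel_lower:
  assumes x: "1 \<le> \<bar>x\<bar>"
  shows "ennreal (\<bar>x\<bar> / 4) \<le> cos_kernel x"
proof -
  define c where "c = 1 / \<bar>x\<bar>"
  have c: "0 < c" "c \<le> 1" unfolding c_def using x by auto
  have "ennreal (\<bar>x\<bar> / 4) = ennreal (x\<^sup>2 / 4) * ennreal c"
    unfolding c_def using x by (subst ennreal_mult'[symmetric]) (auto simp: power2_eq_square divide_simps)
  also have "\<dots> = (\<integral>\<^sup>+t. ennreal (x\<^sup>2 / 4) * indicator {0<..<c} t \<partial>lborel)"
    using c by (subst nn_integral_cmult_indicator) auto
  also have "\<dots> \<le> cos_kernel x"
    unfolding cos_kernel_def nn_integral_unit_interval
  proof (intro nn_integral_mono)
    fix t :: real
    show "ennreal (x\<^sup>2 / 4) * indicator {0<..<c} t \<le> ennreal ((1 - cos (t * x)) / t\<^sup>2) * indicator {0<..<1} t"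
    proof (cases "t \<in> {0<..<c}")
      case True
      then have t: "0 < t" "t < 1" "t < c" using c by auto
      have "\<bar>t * x\<bar> \<le> 1" using t x unfolding c_def by (simp add: abs_mult field_simps)
      then have "((t * x)\<^sup>2 / 4) / t\<^sup>2 \<le> (1 - cos (t * x)) / t\<^sup>2"
        by (intro divide_right_mono one_minus_cos_ge) auto
      then have "x\<^sup>2 / 4 \<le> (1 - cos (t * x)) / t\<^sup>2" using t by (simp add: power_mult_distrib)
      then show ?thesis using t by (simp add: ennreal_leI)
    qed simp
  qed
  finally show ?thesis .
qed

interpretation unit_interval: sigma_finite_measure unit_interval
  by (rule sigma_finite_measure_restrict_space) (auto intro: lborel.sigma_finite_measure_axioms)

lemma nn_integral_cos_kernel:
  fixes X f :: "'x \<Rightarrow> real"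
  assumes "sigma_finite_measure M"
    and X [measurable]: "X \<in> borel_measurable M" and f [measurable]: "f \<in> borel_measurable M" and f0: "\<And>x. 0 \<le> f x"
  shows "(\<integral>\<^sup>+t. ennreal (1 / t\<^sup>2) * (\<integral>\<^sup>+x. ennreal ((1 - cos (t * X x)) * f x) \<partial>M) \<partial>unit_interval)
      = (\<integral>\<^sup>+x. ennreal (f x) * cos_kernel (X x) \<partial>M)"
proof -
  interpret M: sigma_finite_measure M by fact
  interpret P: pair_sigma_finite M unit_interval ..
  have [measurable]: "snd \<in> borel_measurable (M \<Otimes>\<^sub>M unit_interval)"
    by (rule measurable_compose[OF measurable_snd ident_measurable_unit_interval])
  have "(\<integral>\<^sup>+t. ennreal (1 / t\<^sup>2) * (\<integral>\<^sup>+x. ennreal ((1 - cos (t * X x)) * f x) \<partial>M) \<partial>unit_interval)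
     = (\<integral>\<^sup>+t. \<integral>\<^sup>+x. ennreal (f x * ((1 - cos (t * X x)) / t\<^sup>2)) \<partial>M \<partial>unit_interval)"
  proof (intro nn_integral_cong)
    fix t
    have "ennreal (1 / t\<^sup>2) * (\<integral>\<^sup>+x. ennreal ((1 - cos (t * X x)) * f x) \<partial>M) = (\<integral>\<^sup>+x. ennreal (1 / t\<^sup>2) * ennreal ((1 - cos (t * X x)) * f x) \<partial>M)"
      by (rule nn_integral_cmult[symmetric]) measurable
    also have "\<dots> = (\<integral>\<^sup>+x. ennreal (f x * ((1 - cos (t * X x)) / t\<^sup>2)) \<partial>M)"
      by (intro nn_integral_cong) (simp add: ennreal_mult'[symmetric] mult.commute)
    finally show "ennreal (1 / t\<^sup>2) * (\<integral>\<^sup>+x. ennreal ((1 - cos (t * X x)) * f x) \<partial>M) = \<dots>" .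
  qed
  also have "\<dots> = (\<integral>\<^sup>+x. \<integral>\<^sup>+t. ennreal (f x * ((1 - cos (t * X x)) / t\<^sup>2)) \<partial>unit_interval \<partial>M)"
    by (rule P.Fubini') measurable
  also have "\<dots> = (\<integral>\<^sup>+x. ennreal (f x) * cos_kernel (X x) \<partial>M)"
  proof (intro nn_integral_cong)
    fix x
    have "(\<integral>\<^sup>+t. ennreal (f x * ((1 - cos (t * X x)) / t\<^sup>2)) \<partial>unit_interval) = (\<integral>\<^sup>+t. ennreal (f x) * ennreal ((1 - cos (t * X x)) / t\<^sup>2) \<partial>unit_interval)"
      using f0[of x] by (intro nn_integral_cong ennreal_mult') auto
    also have "\<dots> = ennreal (f x) * cos_kernel (X x)"
      unfolding cos_kernel_def by (rule nn_integral_cmult) measurable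
    finally show "(\<integral>\<^sup>+t. ennreal (f x * ((1 - cos (t * X x)) / t\<^sup>2)) \<partial>unit_interval) = \<dots>" .
  qed
  finally show ?thesis .
qed

lemma cos_kernel_finite_of_first_moment:
  fixes X f :: "'x \<Rightarrow> real"
  assumes "sigma_finite_measure M"
    and X [measurable]: "X \<in> borel_measurable M" and f [measurable]: "f \<in> borel_measurable M" and f0: "\<And>x. 0 \<le> f x"
    and small: "integrable M (\<lambda>x. min 1 ((X x)\<^sup>2) * f x)"
    and large: "integrable M (\<lambda>x. indicator {x. \<bar>X x\<bar> > 1} x * (\<bar>X x\<bar> * f x))"
  shows "(\<integral>\<^sup>+t. ennreal (1 / t\<^sup>2) * (\<integral>\<^sup>+x. ennreal ((1 - cos (t * X x)) * f x) \<partial>M) \<partial>unit_interval) < \<infinity>"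
proof -
  have "(\<integral>\<^sup>+x. ennreal (f x) * cos_kernel (X x) \<partial>M)
     \<le> (\<integral>\<^sup>+x. ennreal (min 1 ((X x)\<^sup>2) * f x + 3 * (indicator {x. \<bar>X x\<bar> > 1} x * (\<bar>X x\<bar> * f x))) \<partial>M)"
  proof (intro nn_integral_mono)
    fix x
    show "ennreal (f x) * cos_kernel (X x) \<le> ennreal (min 1 ((X x)\<^sup>2) * f x + 3 * (indicator {x. \<bar>X x\<bar> > 1} x * (\<bar>X x\<bar> * f x)))"
    proof (cases "\<bar>X x\<bar> > 1")
      case True
      have "ennreal (f x) * cos_kernel (X x) \<le> ennreal (f x) * ennreal (3 * \<bar>X x\<bar>)"
        using True by (intro mult_left_mono cos_kernel_large) auto
      also have "\<dots> = ennreal (3 * (\<bar>X x\<bar> * f x))" using f0[of x] by (simp add: ennreal_mult'[symmetric] mult_ac)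
      also have "\<dots> \<le> ennreal (min 1 ((X x)\<^sup>2) * f x + 3 * (indicator {x. \<bar>X x\<bar> > 1} x * (\<bar>X x\<bar> * f x)))"
        using True f0[of x] by (intro ennreal_leI) simp
      finally show ?thesis .
    next
      case False
      then have "(X x)\<^sup>2 \<le> 1" by (simp add: abs_square_le_1)
      have "ennreal (f x) * cos_kernel (X x) \<le> ennreal (f x) * ennreal ((X x)\<^sup>2)"
        by (intro mult_left_mono cos_kernel_small) auto
      also have "\<dots> = ennreal (min 1 ((X x)\<^sup>2) * f x)"
        using \<open>(X x)\<^sup>2 \<le> 1\<close> f0[of x] by (simp add: ennreal_mult'[symmetric] mult_ac min_absorb2)
      finally show ?thesis using False by simp
    qed
  qed
  also have "\<dots> < \<infinity>"
    using small large integrableD(2)[of M "\<lambda>x. min 1 ((X x)\<^sup>2) * f x + 3 * (indicator {x. \<bar>X x\<bar> > 1} x * (\<bar>X x\<bar> * f x))"] f0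
    by (simp add: top.not_eq_extremum abs_of_nonneg)
  finally show ?thesis unfolding nn_integral_cos_kernel[OF assms(1-4)] .
qed

lemma first_moment_of_cos_kernel_finite:
  fixes X f :: "'x \<Rightarrow> real"
  assumes "sigma_finite_measure M"
    and X [measurable]: "X \<in> borel_measurable M" and f [measurable]: "f \<in> borel_measurable M" and f0: "\<And>x. 0 \<le> f x"
    and fin: "(\<integral>\<^sup>+t. ennreal (1 / t\<^sup>2) * (\<integral>\<^sup>+x. ennreal ((1 - cos (t * X x)) * f x) \<partial>M) \<partial>unit_interval) < \<infinity>"
  shows "integrable M (\<lambda>x. indicator {x. \<bar>X x\<bar> > 1} x * (\<bar>X x\<bar> * f x))"
proof -
  have "(\<integral>\<^sup>+x. ennreal (indicator {x. \<bar>X x\<bar> > 1} x * (\<bar>X x\<bar> * f x) / 4) \<partial>M) \<le> (\<integral>\<^sup>+x. ennreal (f x) * cos_kernel (X x) \<partial>M)"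
  proof (intro nn_integral_mono)
    fix x
    show "ennreal (indicator {x. \<bar>X x\<bar> > 1} x * (\<bar>X x\<bar> * f x) / 4) \<le> ennreal (f x) * cos_kernel (X x)"
    proof (cases "\<bar>X x\<bar> > 1")
      case True
      then have "ennreal (f x) * ennreal (\<bar>X x\<bar> / 4) \<le> ennreal (f x) * cos_kernel (X x)"
        by (intro mult_left_mono cos_kernel_lower) auto
      moreover have "ennreal (f x) * ennreal (\<bar>X x\<bar> / 4) = ennreal (\<bar>X x\<bar> * f x / 4)"
        using f0[of x] by (simp add: ennreal_mult'[symmetric] mult_ac)
      ultimately show ?thesis using True by simp
    qed simp
  qed
  also have "\<dots> < \<infinity>" using fin unfolding nn_integral_cos_kernel[OF assms(1-4)] .
  finally have fin4: "(\<integral>\<^sup>+x. ennreal (indicator {x. \<bar>X x\<bar> > 1} x * (\<bar>X x\<bar> * f x) / 4) \<partial>M) < \<infinity>" .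
  have "integrable M (\<lambda>x. indicator {x. \<bar>X x\<bar> > 1} x * (\<bar>X x\<bar> * f x) / 4)"
    using f0 fin4 by (intro integrableI_nonneg) auto
  from integrable_mult_right[OF this, of 4] show ?thesis by simp
qed

section \<open>Exponents of infinitely divisible laws without Gaussian part\<close>

lemma iexp_remainder:
  "norm (iexp y - 1 - \<i> * of_real y) \<le> y\<^sup>2 / 2" "norm (iexp y - 1 - \<i> * of_real y) \<le> 2 * \<bar>y\<bar>"
  using iexp_approx1[of y 1] iexp_approx2[of y 1] by (simp_all add: numeral_2_eq_2 diff_diff_eq)

lemma iexp_minus_one: "norm (iexp y - 1) \<le> \<bar>y\<bar>" "norm (iexp y - 1) \<le> 2"
  using iexp_approx1[of y 0] iexp_approx2[of y 0] by simp_all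

locale levy_density =
  fixes m :: "real \<Rightarrow> real"
  assumes m_measurable [measurable]: "m \<in> borel_measurable borel"
    and m_nonneg: "0 \<le> m x"
    and m_integrable: "integrable lborel (\<lambda>x. min 1 (x\<^sup>2) * m x)"
begin

abbreviation psi :: "real \<Rightarrow> real \<Rightarrow> complex" where
  "psi \<mu> \<equiv> levy_exponent \<mu> m"

definition cos_defect :: "real \<Rightarrow> real" where
  "cos_defect z = (LINT x|lborel. (1 - cos (z * x)) * m x)"

lemma one_minus_cos_le_min:
  fixes z x :: real
  shows "1 - cos (z * x) \<le> (2 + z\<^sup>2) * min 1 (x\<^sup>2)"
proof (cases "x\<^sup>2 \<le> 1")
  case True
  have "1 - cos (z * x) \<le> (z * x)\<^sup>2 / 2" by (rule one_minus_cos_le)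
  also have "\<dots> \<le> (2 + z\<^sup>2) * x\<^sup>2" by (simp add: power_mult_distrib algebra_simps add_nonneg_nonneg)
  finally show ?thesis using True by (simp add: min_absorb2)
next
  case False
  have "1 - cos (z * x) \<le> 2" using cos_ge_minus_one[of "z * x"] by linarith
  also have "\<dots> \<le> 2 + z\<^sup>2" by simp
  finally show ?thesis using False by (simp add: min_absorb1)
qed

lemma integrable_one_minus_cos: "integrable lborel (\<lambda>x. (1 - cos (z * x)) * m x)"
proof (rule Bochner_Integration.integrable_bound)
  show "integrable lborel (\<lambda>x. (2 + z\<^sup>2) * (min 1 (x\<^sup>2) * m x))" using m_integrable by (rule integrable_mult_right)
  show "AE x in lborel. norm ((1 - cos (z * x)) * m x) \<le> norm ((2 + z\<^sup>2) * (min 1 (x\<^sup>2) * m x))"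
  proof (rule AE_I2)
    fix x
    have "(1 - cos (z * x)) * m x \<le> ((2 + z\<^sup>2) * min 1 (x\<^sup>2)) * m x"
      by (rule mult_right_mono[OF one_minus_cos_le_min m_nonneg])
    moreover have "0 \<le> (1 - cos (z * x)) * m x" using m_nonneg by simp
    ultimately show "norm ((1 - cos (z * x)) * m x) \<le> norm ((2 + z\<^sup>2) * (min 1 (x\<^sup>2) * m x))"
      by (simp add: mult.assoc)
  qed
qed simp

lemma cos_defect_nonneg: "0 \<le> cos_defect z"
  unfolding cos_defect_def using m_nonneg by (intro Bochner_Integration.integral_nonneg mult_nonneg_nonneg) auto

lemma nn_cos_defect: "(\<integral>\<^sup>+x. ennreal ((1 - cos (z * x)) * m x) \<partial>lborel) = ennreal (cos_defect z)"
  unfolding cos_defect_def using m_nonneg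
  by (intro nn_integral_eq_integral integrable_one_minus_cos AE_I2 mult_nonneg_nonneg) auto

lemma cos_defect_bounded:
  assumes "\<bar>z\<bar> \<le> 1"
  shows "cos_defect z \<le> 3 * (LINT x|lborel. min 1 (x\<^sup>2) * m x)"
proof -
  have "cos_defect z \<le> (LINT x|lborel. 3 * (min 1 (x\<^sup>2) * m x))"
    unfolding cos_defect_def
  proof (intro integral_mono integrable_one_minus_cos integrable_mult_right m_integrable)
    fix x
    have "(2 + z\<^sup>2) * min 1 (x\<^sup>2) \<le> 3 * min 1 (x\<^sup>2)" using assms by (intro mult_right_mono) (auto simp: abs_square_le_1)
    then have "1 - cos (z * x) \<le> 3 * min 1 (x\<^sup>2)" using one_minus_cos_le_min[of z x] by linarith
    from mult_right_mono[OF this m_nonneg] show "(1 - cos (z * x)) * m x \<le> 3 * (min 1 (x\<^sup>2) * m x)" by (simp add: mult.assoc)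
  qed
  then show ?thesis by simp
qed

lemma integrable_exponent:
  "integrable lborel (\<lambda>x. (iexp (z * x) - 1 - \<i> * of_real (z * x * indicator {x. \<bar>x\<bar> < 1} x)) * of_real (m x))"
proof (rule Bochner_Integration.integrable_bound)
  show "integrable lborel (\<lambda>x. (2 + z\<^sup>2) * (min 1 (x\<^sup>2) * m x))" using m_integrable by (rule integrable_mult_right)
  show "AE x in lborel. norm ((iexp (z * x) - 1 - \<i> * of_real (z * x * indicator {x. \<bar>x\<bar> < 1} x)) * of_real (m x)) \<le> norm ((2 + z\<^sup>2) * (min 1 (x\<^sup>2) * m x))"
  proof (rule AE_I2)
    fix x
    have "norm (iexp (z * x) - 1 - \<i> * of_real (z * x * indicator {x. \<bar>x\<bar> < 1} x)) \<le> (2 + z\<^sup>2) * min 1 (x\<^sup>2)"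
    proof (cases "\<bar>x\<bar> < 1")
      case True
      have "norm (iexp (z * x) - 1 - \<i> * of_real (z * x)) \<le> (z * x)\<^sup>2 / 2" by (rule iexp_remainder(1))
      also have "\<dots> \<le> (2 + z\<^sup>2) * x\<^sup>2" by (simp add: power_mult_distrib algebra_simps add_nonneg_nonneg)
      also have "x\<^sup>2 = min 1 (x\<^sup>2)" using True by (simp add: abs_square_le_1 min_absorb2)
      finally show ?thesis using True by simp
    next
      case False
      have "norm (iexp (z * x) - 1) \<le> 2 + z\<^sup>2" by (rule order_trans[OF iexp_minus_one(2)]) simp
      moreover have "min 1 (x\<^sup>2) = 1" using False abs_le_square_iff[of 1 x] by (simp add: min_absorb1)
      ultimately show ?thesis using False by simp
    qed
    from mult_right_mono[OF this m_nonneg[of x]]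
    show "norm ((iexp (z * x) - 1 - \<i> * of_real (z * x * indicator {x. \<bar>x\<bar> < 1} x)) * of_real (m x)) \<le> norm ((2 + z\<^sup>2) * (min 1 (x\<^sup>2) * m x))"
      using m_nonneg[of x] by (simp only: norm_mult norm_of_real mult.assoc) (simp add: abs_of_nonneg)
  qed
qed measurable

lemma Re_psi: "Re (psi \<mu> z) = - cos_defect z"
proof -
  have "Re (psi \<mu> z) = Re (CLINT x|lborel. (iexp (z * x) - 1 - \<i> * of_real (z * x * indicator {x. \<bar>x\<bar> < 1} x)) * of_real (m x))"
    unfolding levy_exponent_def by simp
  also have "\<dots> = (LINT x|lborel. Re ((iexp (z * x) - 1 - \<i> * of_real (z * x * indicator {x. \<bar>x\<bar> < 1} x)) * of_real (m x)))"
    by (rule integral_Re[OF integrable_exponent, symmetric])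
  also have "\<dots> = (LINT x|lborel. - ((1 - cos (z * x)) * m x))"
    by (intro Bochner_Integration.integral_cong refl) (simp add: Re_exp algebra_simps)
  finally show ?thesis unfolding cos_defect_def by simp
qed

lemma norm_exp_psi: "norm (exp (psi \<mu> z)) = exp (- cos_defect z)"
  by (simp add: Re_psi)

lemma psi_zero: "psi \<mu> 0 = 0"
  unfolding levy_exponent_def by simp

end

text \<open>A finite first moment of the large jumps allows full compensation of the integrand, after which the exponent is
differentiable.\<close>

locale levy_density_mean = levy_density +
  assumes large_integrable: "integrable lborel (\<lambda>x. indicator {x. \<bar>x\<bar> > 1} x * (\<bar>x\<bar> * m x))"
begin

text \<open>The exponent compensates the jumps with \<open>\<bar>x\<bar> < 1\<close>, whereas the mean of the large jumps is taken over
\<open>\<bar>x\<bar> > 1\<close>; the two missing points form a null set.\<close>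

lemma large_jumps_integrable: "integrable lborel (\<lambda>x. indicator {x. \<bar>x\<bar> \<ge> 1} x * (x * m x))"
  and large_jumps_integral: "(LINT x|lborel. indicator {x. \<bar>x\<bar> \<ge> 1} x * (x * m x)) = large_jump_mean m"
proof -
  have i: "integrable lborel (\<lambda>x. indicator {x. \<bar>x\<bar> > 1} x * (x * m x))"
    by (rule Bochner_Integration.integrable_bound[OF large_integrable]) (auto simp: abs_mult indicator_def)
  have "AE x in lborel. x \<notin> {-1, 1::real}"
    by (rule AE_I[of _ _ "{-1, 1}"]) (auto simp: emeasure_lborel_countable)
  then have ae: "AE x in lborel. indicator {x. \<bar>x\<bar> > 1} x * (x * m x) = indicator {x. \<bar>x\<bar> \<ge> 1} x * (x * m x)"
    by eventually_elim (auto simp: indicator_def)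
  show "integrable lborel (\<lambda>x. indicator {x. \<bar>x\<bar> \<ge> 1} x * (x * m x))"
    by (rule integrable_cong_AE_imp[OF i]) (use ae in \<open>auto elim: eventually_mono\<close>)
  have "(LINT x|lborel. indicator {x. \<bar>x\<bar> \<ge> 1} x * (x * m x)) = (LINT x|lborel. indicator {x. \<bar>x\<bar> > 1} x * (x * m x))"
    by (rule integral_cong_AE) (use ae in \<open>auto elim: eventually_mono\<close>)
  then show "(LINT x|lborel. indicator {x. \<bar>x\<bar> \<ge> 1} x * (x * m x)) = large_jump_mean m"
    unfolding large_jump_mean_def set_lebesgue_integral_def by simp
qed

lemma psi_mean_form:
  shows "integrable lborel (\<lambda>x. (iexp (z * x) - 1 - \<i> * of_real (z * x)) * of_real (m x))"
    and "psi \<mu> z = of_real z * (\<i> * of_real (large_jump_mean m + \<mu>)) + (LINT x|lborel. (iexp (z * x) - 1 - \<i> * of_real (z * x)) * of_real (m x))"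
proof -
  let ?a = "\<lambda>x. (iexp (z * x) - 1 - \<i> * of_real (z * x * indicator {x. \<bar>x\<bar> < 1} x)) * of_real (m x)"
  let ?b = "\<lambda>x. \<i> * of_real z * of_real (indicator {x. \<bar>x\<bar> \<ge> 1} x * (x * m x))"
  have eq: "(iexp (z * x) - 1 - \<i> * of_real (z * x)) * of_real (m x) = ?a x - ?b x" for x
    by (auto simp: indicator_def algebra_simps)
  have b: "integrable lborel ?b" by (rule integrable_mult_right[OF integrable_of_real[OF large_jumps_integrable]])
  show "integrable lborel (\<lambda>x. (iexp (z * x) - 1 - \<i> * of_real (z * x)) * of_real (m x))"
    unfolding eq by (intro Bochner_Integration.integrable_diff integrable_exponent b)
  have "(LINT x|lborel. (iexp (z * x) - 1 - \<i> * of_real (z * x)) * of_real (m x)) = (LINT x|lborel. ?a x) - (LINT x|lborel. ?b x)"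
    unfolding eq by (intro Bochner_Integration.integral_diff integrable_exponent b)
  also have "(LINT x|lborel. ?b x) = \<i> * of_real z * of_real (large_jump_mean m)"
    by (simp only: integral_mult_right_zero integral_complex_of_real large_jumps_integral)
  finally show "psi \<mu> z = of_real z * (\<i> * of_real (large_jump_mean m + \<mu>)) + (LINT x|lborel. (iexp (z * x) - 1 - \<i> * of_real (z * x)) * of_real (m x))"
    unfolding levy_exponent_def by (simp add: algebra_simps)
qed

definition psi' :: "real \<Rightarrow> real \<Rightarrow> complex" where
  "psi' \<mu> t = \<i> * of_real (large_jump_mean m + \<mu>) + (LINT x|lborel. \<i> * of_real x * (iexp (t * x) - 1) * of_real (m x))"

lemma has_vector_derivative_iexp_mult:
  "((\<lambda>t. iexp (t * x)) has_vector_derivative \<i> * of_real x * iexp (t * x)) (at t)"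
proof -
  have "((\<lambda>t. \<i> * of_real (t * x)) has_vector_derivative \<i> * of_real x) (at t)"
    by (auto intro!: derivative_eq_intros simp: has_vector_derivative_def scaleR_conv_of_real)
  from has_vector_derivative_exp_comp[OF this] show ?thesis .
qed

lemma psi_has_derivative: "(psi \<mu> has_vector_derivative psi' \<mu> t) (at t)"
proof -
  define h where "h = (\<lambda>x. 2 * (indicator {x. \<bar>x\<bar> > 1} x * (\<bar>x\<bar> * m x)) + (\<bar>t\<bar> + 1) * (min 1 (x\<^sup>2) * m x))"
  have "((\<lambda>z. LINT x|lborel. (iexp (z * x) - 1 - \<i> * of_real (z * x)) * of_real (m x)) has_vector_derivative
      (LINT x|lborel. \<i> * of_real x * (iexp (t * x) - 1) * of_real (m x))) (at t)"
  proof (rule has_vector_derivative_lebesgue_integral[where e = 1 and h = h and d = "\<lambda>t x. \<i> * of_real x * (iexp (t * x) - 1) * of_real (m x)"])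
    show "integrable lborel h" unfolding h_def
      by (intro Bochner_Integration.integrable_add integrable_mult_right large_integrable m_integrable)
    fix s x :: real assume s: "s \<in> ball t 1"
    have lin: "((\<lambda>t. \<i> * of_real (t * x)) has_vector_derivative \<i> * of_real x) (at s)"
      by (auto intro!: derivative_eq_intros simp: has_vector_derivative_def scaleR_conv_of_real)
    have "((\<lambda>z. iexp (z * x) - 1 - \<i> * of_real (z * x)) has_vector_derivative (\<i> * of_real x * iexp (s * x) - 0 - \<i> * of_real x)) (at s)"
      by (intro has_vector_derivative_diff has_vector_derivative_const has_vector_derivative_iexp_mult lin)
    from has_vector_derivative_mult_left[OF this, of "of_real (m x)"]
    show "((\<lambda>z. (iexp (z * x) - 1 - \<i> * of_real (z * x)) * of_real (m x)) has_vector_derivative \<i> * of_real x * (iexp (s * x) - 1) * of_real (m x)) (at s)"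
      by (simp add: algebra_simps)
    have "\<bar>s\<bar> \<le> \<bar>t\<bar> + 1" using s by (auto simp: dist_real_def)
    have "\<bar>x\<bar> * norm (iexp (s * x) - 1) \<le> 2 * (indicator {x. \<bar>x\<bar> > 1} x * \<bar>x\<bar>) + (\<bar>t\<bar> + 1) * min 1 (x\<^sup>2)"
    proof (cases "\<bar>x\<bar> > 1")
      case True
      have "\<bar>x\<bar> * norm (iexp (s * x) - 1) \<le> \<bar>x\<bar> * 2" by (intro mult_left_mono iexp_minus_one) auto
      also have "\<dots> \<le> 2 * \<bar>x\<bar> + (\<bar>t\<bar> + 1) * min 1 (x\<^sup>2)" by simp
      finally show ?thesis using True by simp
    next
      case False
      have "\<bar>x\<bar> * norm (iexp (s * x) - 1) \<le> \<bar>x\<bar> * \<bar>s * x\<bar>" by (intro mult_left_mono iexp_minus_one) auto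
      also have "\<dots> = \<bar>s\<bar> * x\<^sup>2" by (simp add: abs_mult power2_eq_square)
      also have "\<dots> \<le> (\<bar>t\<bar> + 1) * x\<^sup>2" using \<open>\<bar>s\<bar> \<le> \<bar>t\<bar> + 1\<close> by (intro mult_right_mono) auto
      also have "x\<^sup>2 = min 1 (x\<^sup>2)" using False by (simp add: abs_square_le_1 min_absorb2)
      finally show ?thesis using False by simp
    qed
    from mult_right_mono[OF this m_nonneg[of x]]
    show "norm (\<i> * of_real x * (iexp (s * x) - 1) * of_real (m x)) \<le> h x"
      unfolding h_def norm_mult norm_of_real norm_ii mult_1_left abs_of_nonneg[OF m_nonneg]
      by (simp add: algebra_simps)
  next
    show "integrable lborel (\<lambda>x. (iexp (s * x) - 1 - \<i> * of_real (s * x)) * of_real (m x))" for s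
      by (rule psi_mean_form(1))
    show "(\<lambda>x. \<i> * of_real x * (iexp (t * x) - 1) * of_real (m x)) \<in> borel_measurable lborel" by measurable
  qed simp
  moreover have "((\<lambda>z. of_real z * (\<i> * of_real (large_jump_mean m + \<mu>))) has_vector_derivative \<i> * of_real (large_jump_mean m + \<mu>)) (at t)"
    by (auto intro!: derivative_eq_intros simp: has_vector_derivative_def scaleR_conv_of_real)
  ultimately show ?thesis unfolding psi_mean_form(2)[abs_def] psi'_def
    by (intro has_vector_derivative_add) auto
qed

lemma psi'_zero: "psi' \<mu> 0 = \<i> * of_real (large_jump_mean m + \<mu>)"
  unfolding psi'_def by simp

lemma norm_psi_le_linear:
  obtains C where "0 \<le> C" "\<And>t. 0 \<le> t \<Longrightarrow> t \<le> 1 \<Longrightarrow> norm (psi \<mu> t) \<le> C * t"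
proof
  define h where "h = (\<lambda>x. 2 * (indicator {x. \<bar>x\<bar> > 1} x * (\<bar>x\<bar> * m x)) + min 1 (x\<^sup>2) * m x)"
  define C where "C = \<bar>large_jump_mean m + \<mu>\<bar> + (LINT x|lborel. h x)"
  have hint: "integrable lborel h" unfolding h_def
    by (intro Bochner_Integration.integrable_add integrable_mult_right large_integrable m_integrable)
  have h0: "0 \<le> h x" for x unfolding h_def using m_nonneg by simp
  show "0 \<le> C" unfolding C_def using h0 by (intro add_nonneg_nonneg Bochner_Integration.integral_nonneg) auto
  fix t :: real assume t: "0 \<le> t" "t \<le> 1"
  have "norm (LINT x|lborel. (iexp (t * x) - 1 - \<i> * of_real (t * x)) * of_real (m x)) \<le> (LINT x|lborel. norm ((iexp (t * x) - 1 - \<i> * of_real (t * x)) * of_real (m x)))"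
    by (rule integral_norm_bound)
  also have "\<dots> \<le> (LINT x|lborel. t * h x)"
  proof (intro integral_mono integrable_norm psi_mean_form(1) integrable_mult_right hint)
    fix x
    have "norm (iexp (t * x) - 1 - \<i> * of_real (t * x)) \<le> t * (2 * (indicator {x. \<bar>x\<bar> > 1} x * \<bar>x\<bar>) + min 1 (x\<^sup>2))"
    proof (cases "\<bar>x\<bar> > 1")
      case True
      have "norm (iexp (t * x) - 1 - \<i> * of_real (t * x)) \<le> 2 * \<bar>t * x\<bar>" by (rule iexp_remainder)
      also have "\<dots> = t * (2 * \<bar>x\<bar>)" using t by (simp add: abs_mult)
      also have "\<dots> \<le> t * (2 * \<bar>x\<bar> + min 1 (x\<^sup>2))" using t by (intro mult_left_mono) auto
      finally show ?thesis using True by simp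
    next
      case False
      have "norm (iexp (t * x) - 1 - \<i> * of_real (t * x)) \<le> (t * x)\<^sup>2 / 2" by (rule iexp_remainder)
      also have "\<dots> \<le> (t * x)\<^sup>2" by simp
      also have "\<dots> = (t * t) * x\<^sup>2" by (simp add: power2_eq_square)
      also have "\<dots> \<le> (t * 1) * x\<^sup>2" using t by (intro mult_right_mono mult_left_mono) auto
      also have "x\<^sup>2 = min 1 (x\<^sup>2)" using False by (simp add: abs_square_le_1 min_absorb2)
      finally show ?thesis using False by simp
    qed
    from mult_right_mono[OF this m_nonneg[of x]]
    show "norm ((iexp (t * x) - 1 - \<i> * of_real (t * x)) * of_real (m x)) \<le> t * h x"
      unfolding h_def norm_mult norm_of_real abs_of_nonneg[OF m_nonneg] by (simp add: algebra_simps)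
  qed
  also have "\<dots> = t * (LINT x|lborel. h x)" by simp
  finally have 1: "norm (LINT x|lborel. (iexp (t * x) - 1 - \<i> * of_real (t * x)) * of_real (m x)) \<le> t * (LINT x|lborel. h x)" .
  have "norm (psi \<mu> t) \<le> norm (of_real t * (\<i> * complex_of_real (large_jump_mean m + \<mu>))) + norm (LINT x|lborel. (iexp (t * x) - 1 - \<i> * of_real (t * x)) * of_real (m x))"
    unfolding psi_mean_form(2) by (rule norm_triangle_ineq)
  also have "norm (of_real t * (\<i> * complex_of_real (large_jump_mean m + \<mu>))) = t * \<bar>large_jump_mean m + \<mu>\<bar>"
    unfolding norm_mult norm_of_real using t by simp
  finally show "norm (psi \<mu> t) \<le> C * t" using 1 unfolding C_def by (simp add: algebra_simps)
qed

end

text \<open>A finite second moment of the whole measure makes the exponent twice differentiable.\<close>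

locale levy_density_square = levy_density_mean +
  assumes square_integrable: "integrable lborel (\<lambda>x. x\<^sup>2 * m x)"

lemma (in levy_density) levy_density_squareI:
  assumes "integrable lborel (\<lambda>x. x\<^sup>2 * m x)"
  shows "levy_density_square m"
proof unfold_locales
  show "integrable lborel (\<lambda>x. indicator {x. \<bar>x\<bar> > 1} x * (\<bar>x\<bar> * m x))"
  proof (rule Bochner_Integration.integrable_bound[OF assms])
    show "AE x in lborel. norm (indicator {x. \<bar>x\<bar> > 1} x * (\<bar>x\<bar> * m x)) \<le> norm (x\<^sup>2 * m x)"
    proof (rule AE_I2)
      fix x
      show "norm (indicator {x. \<bar>x\<bar> > 1} x * (\<bar>x\<bar> * m x)) \<le> norm (x\<^sup>2 * m x)"
      proof (cases "\<bar>x\<bar> > 1")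
        case True
        then have "\<bar>x\<bar> * 1 \<le> \<bar>x\<bar> * \<bar>x\<bar>" by (intro mult_left_mono) auto
        then have "\<bar>x\<bar> \<le> x\<^sup>2" by (simp add: power2_eq_square)
        then show ?thesis using True m_nonneg[of x] by (simp add: abs_mult mult_right_mono)
      qed simp
    qed
  qed measurable
qed (use assms in auto)

context levy_density_square
begin

text \<open>The \<open>n\<close>-th derivative of the exponent, for \<open>n \<ge> 2\<close>: from the second derivative on, drift and compensator have
disappeared.\<close>

definition moment_integral :: "nat \<Rightarrow> real \<Rightarrow> complex" where
  "moment_integral n t = (LINT x|lborel. ((\<i> * of_real x) ^ n * of_real (m x)) * iexp (t * x))"

lemma psi'_has_derivative: "(psi' \<mu> has_vector_derivative moment_integral 2 t) (at t)"
proof -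
  have "((\<lambda>t. LINT x|lborel. \<i> * of_real x * (iexp (t * x) - 1) * of_real (m x)) has_vector_derivative
      (LINT x|lborel. ((\<i> * of_real x) ^ 2 * of_real (m x)) * iexp (t * x))) (at t)"
  proof (rule has_vector_derivative_lebesgue_integral[where e = 1 and h = "\<lambda>x. x\<^sup>2 * m x"
        and d = "\<lambda>t x. ((\<i> * of_real x) ^ 2 * of_real (m x)) * iexp (t * x)"])
    show "integrable lborel (\<lambda>x. x\<^sup>2 * m x)" by (rule square_integrable)
    show "(\<lambda>x. ((\<i> * of_real x) ^ 2 * of_real (m x)) * iexp (t * x)) \<in> borel_measurable lborel" by measurable
    show "((\<lambda>t. \<i> * of_real x * (iexp (t * x) - 1) * of_real (m x)) has_vector_derivative ((\<i> * of_real x) ^ 2 * of_real (m x)) * iexp (s * x)) (at s)" for s x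
    proof -
      have "((\<lambda>t. iexp (t * x) - 1) has_vector_derivative \<i> * of_real x * iexp (s * x) - 0) (at s)"
        by (intro has_vector_derivative_diff has_vector_derivative_const has_vector_derivative_iexp_mult)
      from has_vector_derivative_mult_right[OF this, of "\<i> * of_real x * of_real (m x)"]
      show ?thesis by (simp only: power2_eq_square diff_0_right mult_ac)
    qed
    show "norm (((\<i> * of_real x) ^ 2 * of_real (m x)) * iexp (s * x)) \<le> x\<^sup>2 * m x" for s x
      using m_nonneg[of x] by (simp add: norm_mult norm_power)
    show "integrable lborel (\<lambda>x. \<i> * of_real x * (iexp (s * x) - 1) * of_real (m x))" for s
    proof (rule Bochner_Integration.integrable_bound)
      show "integrable lborel (\<lambda>x. \<bar>s\<bar> * (x\<^sup>2 * m x))" by (rule integrable_mult_right[OF square_integrable])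
      show "AE x in lborel. norm (\<i> * of_real x * (iexp (s * x) - 1) * of_real (m x)) \<le> norm (\<bar>s\<bar> * (x\<^sup>2 * m x))"
      proof (rule AE_I2)
        fix x
        have "\<bar>x\<bar> * norm (iexp (s * x) - 1) * m x \<le> \<bar>x\<bar> * \<bar>s * x\<bar> * m x"
          by (intro mult_right_mono mult_left_mono iexp_minus_one m_nonneg) auto
        also have "\<dots> = norm (\<bar>s\<bar> * (x\<^sup>2 * m x))" using m_nonneg[of x] by (simp add: abs_mult power2_eq_square)
        finally show "norm (\<i> * of_real x * (iexp (s * x) - 1) * of_real (m x)) \<le> norm (\<bar>s\<bar> * (x\<^sup>2 * m x))"
          unfolding norm_mult[of _ "of_real (m x)"] norm_mult[of "\<i> * of_real x"] norm_of_real abs_of_nonneg[OF m_nonneg]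
          by (simp add: norm_mult)
      qed
    qed measurable
  qed simp
  then have "((\<lambda>t. \<i> * of_real (large_jump_mean m + \<mu>) + (LINT x|lborel. \<i> * of_real x * (iexp (t * x) - 1) * of_real (m x))) has_vector_derivative
      0 + (LINT x|lborel. ((\<i> * of_real x) ^ 2 * of_real (m x)) * iexp (t * x))) (at t)"
    by (intro has_vector_derivative_add has_vector_derivative_const)
  then show ?thesis unfolding psi'_def[abs_def] moment_integral_def by simp
qed

lemma integrable_moment_weight:
  assumes "integrable lborel (\<lambda>x. x ^ n * m x)"
  shows "integrable lborel (\<lambda>x. (\<i> * of_real x) ^ n * of_real (m x))"
proof -
  have "integrable lborel (\<lambda>x. \<i> ^ n * of_real (x ^ n * m x))"
    by (rule integrable_mult_right[OF integrable_of_real[OF assms]])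
  then show ?thesis by (simp add: power_mult_distrib mult.assoc)
qed

lemma moment_integral_has_derivative:
  assumes n: "integrable lborel (\<lambda>x. x ^ n * m x)" and Sn: "integrable lborel (\<lambda>x. x ^ Suc n * m x)"
  shows "(moment_integral n has_vector_derivative moment_integral (Suc n) t) (at t)"
proof -
  have "integrable lborel (\<lambda>x. (1 / \<i>) * ((\<i> * of_real x) ^ Suc n * of_real (m x)))"
    by (rule integrable_mult_right[OF integrable_moment_weight[OF Sn]])
  then have "integrable lborel (\<lambda>x. ((\<i> * of_real x) ^ n * of_real (m x)) * complex_of_real x)"
    by (simp add: mult_ac)
  from has_vector_derivative_fourier_integral[OF integrable_moment_weight[OF n] _ this, of t]
  show ?thesis unfolding moment_integral_def[abs_def] by (simp add: mult_ac)
qed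

lemma moment_integral_zero: "moment_integral n 0 = \<i> ^ n * of_real (LINT x|lborel. x ^ n * m x)"
proof -
  have "moment_integral n 0 = (LINT x|lborel. \<i> ^ n * of_real (x ^ n * m x))"
    unfolding moment_integral_def by (intro Bochner_Integration.integral_cong refl) (simp add: power_mult_distrib mult.assoc)
  then show ?thesis by (simp only: integral_mult_right_zero integral_complex_of_real)
qed

lemma times_differentiable_2_psi: "times_differentiable 2 (psi \<mu>)"
  unfolding numeral_2_eq_2 times_differentiable.simps
  using psi_has_derivative[of \<mu>] psi'_has_derivative[of \<mu>] by blast

end

locale levy_density_moments = levy_density_square +
  assumes all_moments: "2 \<le> n \<Longrightarrow> integrable lborel (\<lambda>x. x ^ n * m x)"
begin

definition psi_deriv :: "real \<Rightarrow> nat \<Rightarrow> real \<Rightarrow> complex" where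
  "psi_deriv \<mu> n = (if n = 0 then psi \<mu> else if n = 1 then psi' \<mu> else moment_integral n)"

lemma psi_deriv_has_derivative: "(psi_deriv \<mu> n has_vector_derivative psi_deriv \<mu> (Suc n) t) (at t)"
proof -
  consider "n = 0" | "n = 1" | "2 \<le> n" by linarith
  then show ?thesis
  proof cases
    case 1
    then show ?thesis using psi_has_derivative by (simp add: psi_deriv_def)
  next
    case 2
    then show ?thesis using psi'_has_derivative by (simp add: psi_deriv_def numeral_2_eq_2)
  next
    case 3
    then show ?thesis using moment_integral_has_derivative[OF all_moments all_moments, of n] by (simp add: psi_deriv_def)
  qed
qed

lemma times_differentiable_psi_deriv: "times_differentiable k (psi_deriv \<mu> n)"
proof (induction k arbitrary: n)
  case (Suc k)
  show ?case using psi_deriv_has_derivative[of \<mu> n] Suc.IH[of "Suc n"] unfolding times_differentiable.simps by blast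
qed simp

lemma times_differentiable_psi: "times_differentiable k (psi \<mu>)"
  using times_differentiable_psi_deriv[of k \<mu> 0] by (simp add: psi_deriv_def)

end

section \<open>Moments and cumulants of the law\<close>

text \<open>The cumulant is an iterated derivative of a function known only near the origin. Equality on an open
set is inherited by derivatives.\<close>

lemma funpow_vector_derivative_eq:
  fixes f :: "real \<Rightarrow> complex"
  assumes S: "open S" and f: "\<And>x. x \<in> S \<Longrightarrow> f x = D 0 x"
    and D: "\<And>n x. (D n has_vector_derivative D (Suc n) x) (at x)" and x: "x \<in> S"
  shows "((\<lambda>f t. vector_derivative f (at t)) ^^ n) f x = D n x"
  using x
proof (induction n arbitrary: x)
  case (Suc n)
  let ?g = "((\<lambda>f t. vector_derivative f (at t)) ^^ n) f"
  have "(?g has_vector_derivative D (Suc n) x) (at x)"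
    by (rule has_vector_derivative_transform_within_open[OF D[of n x] S Suc.prems]) (simp add: Suc.IH)
  then show ?case by (simp add: vector_derivative_at)
qed (use f in simp)

locale levy_rv = levy_density m + prob_space M for m and M :: "'a measure" +
  fixes X :: "'a \<Rightarrow> real" and \<mu> :: real
  assumes X_measurable [measurable]: "X \<in> borel_measurable M"
    and char_X: "char (distr M borel X) z = exp (psi \<mu> z)"
begin

lemma fourier_X: "(LINT \<omega>|M. complex_of_real 1 * iexp (t * X \<omega>)) = exp (psi \<mu> t)"
  using char_X[of t] unfolding char_def by (subst (asm) integral_distr) auto

lemma nn_cos_X: "(\<integral>\<^sup>+\<omega>. ennreal ((1 - cos (t * X \<omega>)) * 1) \<partial>M) = ennreal (1 - Re (exp (psi \<mu> t)))"
  and cos_X_le_one: "0 \<le> 1 - Re (exp (psi \<mu> t))"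
  and cos_X: "(LINT \<omega>|M. 1 - cos (t * X \<omega>)) = 1 - Re (exp (psi \<mu> t))"
proof -
  have i: "integrable M (\<lambda>\<omega>. complex_of_real 1 * iexp (t * X \<omega>))"
    by (rule integrable_iexp_weight) auto
  have "Re (exp (psi \<mu> t)) = (LINT \<omega>|M. Re (complex_of_real 1 * iexp (t * X \<omega>)))"
    unfolding fourier_X[symmetric] by (rule integral_Re[OF i, symmetric])
  also have "\<dots> = (LINT \<omega>|M. cos (t * X \<omega>))"
    by (intro Bochner_Integration.integral_cong refl) (simp add: Re_exp)
  finally have c: "Re (exp (psi \<mu> t)) = (LINT \<omega>|M. cos (t * X \<omega>))" .
  have ci: "integrable M (\<lambda>\<omega>. cos (t * X \<omega>))"
    by (rule integrable_const_bound[of _ 1]) auto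
  show e: "(LINT \<omega>|M. 1 - cos (t * X \<omega>)) = 1 - Re (exp (psi \<mu> t))"
    unfolding c using ci by (subst Bochner_Integration.integral_diff) (auto simp: prob_space)
  have "0 \<le> (LINT \<omega>|M. 1 - cos (t * X \<omega>))" by (rule Bochner_Integration.integral_nonneg) simp
  then show "0 \<le> 1 - Re (exp (psi \<mu> t))" unfolding e .
  have "(\<integral>\<^sup>+\<omega>. ennreal (1 - cos (t * X \<omega>)) \<partial>M) = ennreal (LINT \<omega>|M. 1 - cos (t * X \<omega>))"
    using ci by (intro nn_integral_eq_integral) auto
  then show "(\<integral>\<^sup>+\<omega>. ennreal ((1 - cos (t * X \<omega>)) * 1) \<partial>M) = ennreal (1 - Re (exp (psi \<mu> t)))"
    unfolding e by simp
qed

theorem integrable_even_power_X: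
  assumes "times_differentiable (2 * k) (psi \<mu>)"
  shows "integrable M (\<lambda>\<omega>. X \<omega> ^ (2 * k))"
proof -
  have "times_differentiable (2 * k) (\<lambda>t. LINT \<omega>|M. complex_of_real 1 * iexp (t * X \<omega>))"
    unfolding fourier_X using times_differentiable_exp[OF assms] .
  from integrable_even_power_of_times_differentiable[OF X_measurable _ _ this]
  show ?thesis by simp
qed

lemma integrable_power_X:
  assumes "integrable M (\<lambda>\<omega>. X \<omega> ^ (2 * k))" "n \<le> 2 * k"
  shows "integrable M (\<lambda>\<omega>. X \<omega> ^ n)"
  using integrable_intermediate_power[OF X_measurable, of "\<lambda>_. 1" "2 * k" n] assms by simp

text \<open>If \<open>E[X\<^sup>2]\<close> is finite then \<open>\<bar>\<phi>(h)\<bar> \<ge> 1 - h\<^sup>2 E[X\<^sup>2] / 2\<close>, and taking logarithms bounds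
  the real part of the exponent by a multiple of \<open>h\<^sup>2\<close>.\<close>

theorem square_integrable_of_X:
  assumes X2: "integrable M (\<lambda>\<omega>. (X \<omega>)\<^sup>2)"
  shows "integrable lborel (\<lambda>x. x\<^sup>2 * m x)"
proof -
  define V where "V = (LINT \<omega>|M. (X \<omega>)\<^sup>2)"
  have V: "0 \<le> V" unfolding V_def by simp
  \<comment> \<open>For \<open>h \<le> e\<close> one has \<open>h\<^sup>2 V \<le> 1\<close>, which keeps the argument of the logarithm at least \<open>1 / 2\<close>.\<close>
  define e where "e = 1 / (1 + V)"
  have e: "0 < e" "e \<le> 1" unfolding e_def using V by (auto simp: field_simps)
  have "(\<integral>\<^sup>+x. ennreal (m x * x\<^sup>2 / 2) \<partial>lborel) \<le> ennreal V"
  proof (rule nn_integral_square_le_of_cos_bound[OF _ _ m_nonneg e(1)])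
    fix h :: real assume h: "0 < h" "h \<le> e"
    define y where "y = h\<^sup>2 * V / 2"
    have "h\<^sup>2 * V \<le> 1"
    proof -
      have "h\<^sup>2 \<le> e" using h e power_le_one[of h 1] mult_mono[of h e h 1] by (simp add: power2_eq_square)
      then have "h\<^sup>2 * V \<le> e * V" using V by (rule mult_right_mono)
      also have "\<dots> \<le> 1" unfolding e_def using V by (simp add: field_simps)
      finally show ?thesis .
    qed
    then have y: "0 \<le> y" "y \<le> 1 / 2" unfolding y_def using V by auto
    have "1 - Re (exp (psi \<mu> h)) \<le> y"
    proof -
      have "(LINT \<omega>|M. 1 - cos (h * X \<omega>)) \<le> (LINT \<omega>|M. h\<^sup>2 / 2 * (X \<omega>)\<^sup>2)"
      proof (rule integral_mono)
        show "integrable M (\<lambda>\<omega>. 1 - cos (h * X \<omega>))"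
          by (intro Bochner_Integration.integrable_diff integrable_const integrable_const_bound[of _ 1]) auto
        show "1 - cos (h * X \<omega>) \<le> h\<^sup>2 / 2 * (X \<omega>)\<^sup>2" for \<omega>
          using one_minus_cos_le[of "h * X \<omega>"] by (simp add: power_mult_distrib)
      qed (use X2 in auto)
      then show ?thesis unfolding cos_X y_def V_def by simp
    qed
    then have "1 - y \<le> norm (exp (psi \<mu> h))" using complex_Re_le_cmod[of "exp (psi \<mu> h)"] by linarith
    then have "1 - y \<le> exp (- cos_defect h)" unfolding norm_exp_psi .
    then have "ln (1 - y) \<le> - cos_defect h" using y ln_mono[of "1 - y" "exp (- cos_defect h)"] by simp
    moreover have "- y - 2 * y\<^sup>2 \<le> ln (1 - y)" using y by (intro ln_one_minus_pos_lower_bound) auto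
    moreover have "2 * y\<^sup>2 \<le> y" using y mult_left_mono[of y "1/2" y] by (simp add: power2_eq_square)
    ultimately have "cos_defect h \<le> 2 * y" by linarith
    then have "cos_defect h \<le> V * h\<^sup>2" unfolding y_def by (simp add: mult.commute)
    then show "(\<integral>\<^sup>+x. ennreal ((1 - cos (h * x)) * m x) \<partial>lborel) \<le> ennreal (V * h\<^sup>2)"
      unfolding nn_cos_defect by (rule ennreal_leI)
  qed auto
  then have fin: "(\<integral>\<^sup>+x. ennreal (m x * x\<^sup>2 / 2) \<partial>lborel) < \<infinity>" by (simp add: le_less_trans)
  have "integrable lborel (\<lambda>x. m x * x\<^sup>2 / 2)" using m_nonneg fin by (intro integrableI_nonneg) auto
  from integrable_mult_right[OF this, of 2] show ?thesis by (simp add: mult.commute)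
qed

text \<open>Both first moments are finite exactly when the respective integral of \<open>(1 - cos (t * x)) / t\<^sup>2\<close>
  over \<open>0 < t < 1\<close> is. With \<open>u = - Re \<psi>\<close> and bounded \<open>u\<close>, the elementary inequality
  \<open>1 - exp (- u) \<ge> u * exp (- u)\<close> compares the two.\<close>

theorem large_integrable_of_X:
  assumes XI: "integrable M X"
  shows "integrable lborel (\<lambda>x. indicator {x. \<bar>x\<bar> > 1} x * (\<bar>x\<bar> * m x))"
proof (rule first_moment_of_cos_kernel_finite[OF lborel.sigma_finite_measure_axioms _ _ m_nonneg])
  define U where "U = 3 * (LINT x|lborel. min 1 (x\<^sup>2) * m x)"
  have "(\<integral>\<^sup>+t. ennreal (1 / t\<^sup>2) * (\<integral>\<^sup>+x. ennreal ((1 - cos (t * x)) * m x) \<partial>lborel) \<partial>unit_interval)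
      \<le> (\<integral>\<^sup>+t. ennreal (exp U) * (ennreal (1 / t\<^sup>2) * (\<integral>\<^sup>+\<omega>. ennreal ((1 - cos (t * X \<omega>)) * 1) \<partial>M)) \<partial>unit_interval)"
  proof (intro nn_integral_mono)
    fix t assume "t \<in> space unit_interval"
    then have t: "0 < t" "t < 1" by auto
    let ?u = "cos_defect t"
    have uU: "?u \<le> U" unfolding U_def using t by (intro cos_defect_bounded) auto
    have "?u * exp (- U) \<le> ?u * exp (- ?u)" using uU cos_defect_nonneg[of t] by (intro mult_left_mono) auto
    also have "\<dots> \<le> 1 - exp (- ?u)"
    proof -
      have "(1 + ?u) * exp (- ?u) \<le> exp ?u * exp (- ?u)" by (intro mult_right_mono exp_ge_add_one_self) auto
      then show ?thesis by (simp add: exp_minus_inverse algebra_simps)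
    qed
    also have "\<dots> \<le> 1 - Re (exp (psi \<mu> t))"
      using complex_Re_le_cmod[of "exp (psi \<mu> t)"] unfolding norm_exp_psi by linarith
    finally have "exp U * (?u * exp (- U)) \<le> exp U * (1 - Re (exp (psi \<mu> t)))" by (rule mult_left_mono) simp
    then have "?u \<le> exp U * (1 - Re (exp (psi \<mu> t)))" by (simp add: exp_minus field_simps)
    then have "ennreal ?u \<le> ennreal (exp U) * ennreal (1 - Re (exp (psi \<mu> t)))"
      using cos_X_le_one[of t] by (simp add: ennreal_mult'[symmetric] ennreal_leI)
    then have "ennreal (1 / t\<^sup>2) * ennreal ?u \<le> ennreal (1 / t\<^sup>2) * (ennreal (exp U) * ennreal (1 - Re (exp (psi \<mu> t))))"
      by (rule mult_left_mono) simp
    then show "ennreal (1 / t\<^sup>2) * (\<integral>\<^sup>+x. ennreal ((1 - cos (t * x)) * m x) \<partial>lborel) \<le> ennreal (exp U) * (ennreal (1 / t\<^sup>2) * (\<integral>\<^sup>+\<omega>. ennreal ((1 - cos (t * X \<omega>)) * 1) \<partial>M))"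
      unfolding nn_cos_defect nn_cos_X by (simp only: mult.left_commute)
  qed
  also have "\<dots> = ennreal (exp U) * (\<integral>\<^sup>+t. ennreal (1 / t\<^sup>2) * (\<integral>\<^sup>+\<omega>. ennreal ((1 - cos (t * X \<omega>)) * 1) \<partial>M) \<partial>unit_interval)"
  proof (rule nn_integral_cmult)
    have "(\<lambda>t. Re (char (distr M borel X) t)) \<in> borel_measurable borel"
      using real_distribution.char_measurable[OF real_distribution_distr[OF X_measurable]] by simp
    then have [measurable]: "(\<lambda>t. Re (exp (psi \<mu> t))) \<in> borel_measurable unit_interval"
      unfolding char_X by (intro measurable_restrict_space1) simp
    show "(\<lambda>t. ennreal (1 / t\<^sup>2) * (\<integral>\<^sup>+\<omega>. ennreal ((1 - cos (t * X \<omega>)) * 1) \<partial>M)) \<in> borel_measurable unit_interval"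
      unfolding nn_cos_X by measurable
  qed
  also have "\<dots> < \<infinity>"
  proof -
    have mi: "integrable M (\<lambda>\<omega>. min 1 ((X \<omega>)\<^sup>2) * 1)" by (rule integrable_const_bound[of _ 1]) auto
    have "integrable M (\<lambda>\<omega>. indicator {\<omega>. \<bar>X \<omega>\<bar> > 1} \<omega> * (\<bar>X \<omega>\<bar> * 1))"
      by (rule Bochner_Integration.integrable_bound[OF XI]) (auto simp: indicator_def)
    from cos_kernel_finite_of_first_moment[OF sigma_finite_measure_axioms X_measurable _ _ mi this]
    show ?thesis by (simp add: ennreal_mult_less_top)
  qed
  finally show "(\<integral>\<^sup>+t. ennreal (1 / t\<^sup>2) * (\<integral>\<^sup>+x. ennreal ((1 - cos (t * x)) * m x) \<partial>lborel) \<partial>unit_interval) < \<infinity>" .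
qed auto

text \<open>With \<open>\<psi>(t) = - u + \<i> v\<close> one has \<open>1 - Re \<phi>(t) = 1 - exp (- u) cos v \<le> u + v\<^sup>2\<close>. The first term is handled by the
kernel of one minus cosine, and \<open>v\<close> is of order \<open>t\<close>, which \<open>1 / t\<^sup>2\<close> can absorb.\<close>

theorem integrable_X_of_large_integrable:
  assumes "levy_density_mean m"
  shows "integrable M X"
proof -
  interpret mean: levy_density_mean m by fact
  obtain C where C: "0 \<le> C" "\<And>t. 0 \<le> t \<Longrightarrow> t \<le> 1 \<Longrightarrow> norm (psi \<mu> t) \<le> C * t"
    using mean.norm_psi_le_linear[of \<mu>] by blast
  have "(\<integral>\<^sup>+t. ennreal (1 / t\<^sup>2) * (\<integral>\<^sup>+\<omega>. ennreal ((1 - cos (t * X \<omega>)) * 1) \<partial>M) \<partial>unit_interval)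
      \<le> (\<integral>\<^sup>+t. ennreal (1 / t\<^sup>2) * (\<integral>\<^sup>+x. ennreal ((1 - cos (t * x)) * m x) \<partial>lborel) + ennreal (C\<^sup>2) \<partial>unit_interval)"
  proof (intro nn_integral_mono)
    fix t assume "t \<in> space unit_interval"
    then have t: "0 < t" "t < 1" by auto
    let ?u = "cos_defect t" and ?v = "Im (psi \<mu> t)"
    have "\<bar>?v\<bar> \<le> C * t" using C(2)[of t] t abs_Im_le_cmod[of "psi \<mu> t"] by linarith
    then have v: "?v\<^sup>2 \<le> (C * t)\<^sup>2" using C t by (intro abs_le_square_iff[THEN iffD1]) (simp add: abs_mult)
    have "1 - exp (- ?u) * cos ?v = (1 - exp (- ?u)) + exp (- ?u) * (1 - cos ?v)" by (simp add: algebra_simps)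
    also have "\<dots> \<le> ?u + 1 * (1 - cos ?v)"
      using exp_ge_add_one_self[of "- ?u"] cos_defect_nonneg[of t] by (intro add_mono mult_right_mono) auto
    also have "\<dots> \<le> ?u + (C * t)\<^sup>2"
      using order_trans[OF one_minus_cos_le[of ?v] order_trans[OF _ v]] by simp
    finally have "1 - Re (exp (psi \<mu> t)) \<le> ?u + C\<^sup>2 * t\<^sup>2" unfolding Re_exp Re_psi by (simp add: power_mult_distrib)
    then have "1 / t\<^sup>2 * (1 - Re (exp (psi \<mu> t))) \<le> 1 / t\<^sup>2 * (?u + C\<^sup>2 * t\<^sup>2)"
      by (rule mult_left_mono) simp
    also have "\<dots> = 1 / t\<^sup>2 * ?u + C\<^sup>2" using t by (simp add: field_simps)
    finally have "ennreal (1 / t\<^sup>2 * (1 - Re (exp (psi \<mu> t)))) \<le> ennreal (1 / t\<^sup>2 * ?u + C\<^sup>2)" by (rule ennreal_leI)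
    then show "ennreal (1 / t\<^sup>2) * (\<integral>\<^sup>+\<omega>. ennreal ((1 - cos (t * X \<omega>)) * 1) \<partial>M) \<le> ennreal (1 / t\<^sup>2) * (\<integral>\<^sup>+x. ennreal ((1 - cos (t * x)) * m x) \<partial>lborel) + ennreal (C\<^sup>2)"
      unfolding nn_cos_defect nn_cos_X using cos_defect_nonneg[of t] cos_X_le_one[of t]
      by (simp add: ennreal_mult'[symmetric] ennreal_plus[symmetric] del: ennreal_plus)
  qed
  also have "\<dots> = (\<integral>\<^sup>+t. ennreal (1 / t\<^sup>2) * (\<integral>\<^sup>+x. ennreal ((1 - cos (t * x)) * m x) \<partial>lborel) \<partial>unit_interval) + (\<integral>\<^sup>+t. ennreal (C\<^sup>2) \<partial>unit_interval)"
  proof (rule nn_integral_add)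
    have "(\<lambda>z. norm (char (distr M borel X) z)) \<in> borel_measurable borel"
      using real_distribution.char_measurable[OF real_distribution_distr[OF X_measurable]] by simp
    then have "(\<lambda>z. - ln (norm (char (distr M borel X) z))) \<in> borel_measurable borel" by measurable
    then have "cos_defect \<in> borel_measurable borel"
      unfolding char_X norm_exp_psi by simp
    then have [measurable]: "cos_defect \<in> borel_measurable unit_interval"
      by (intro measurable_restrict_space1) simp
    show "(\<lambda>t. ennreal (1 / t\<^sup>2) * (\<integral>\<^sup>+x. ennreal ((1 - cos (t * x)) * m x) \<partial>lborel)) \<in> borel_measurable unit_interval"
      unfolding nn_cos_defect by measurable
  qed simp
  also have "\<dots> < \<infinity>"
    using cos_kernel_finite_of_first_moment[OF lborel.sigma_finite_measure_axioms _ _ m_nonneg m_integrable mean.large_integrable]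
    by (simp add: emeasure_restrict_space)
  finally have "integrable M (\<lambda>\<omega>. indicator {\<omega>. \<bar>X \<omega>\<bar> > 1} \<omega> * (\<bar>X \<omega>\<bar> * 1))"
    by (intro first_moment_of_cos_kernel_finite[OF sigma_finite_measure_axioms X_measurable]) auto
  then have i: "integrable M (\<lambda>\<omega>. 1 + indicator {\<omega>. \<bar>X \<omega>\<bar> > 1} \<omega> * (\<bar>X \<omega>\<bar> * 1))" by simp
  show ?thesis by (rule Bochner_Integration.integrable_bound[OF i]) (auto simp: indicator_def)
qed

theorem expectation_X:
  assumes "levy_density_mean m" and XI: "integrable M X"
  shows "expectation X = large_jump_mean m + \<mu>"
proof -
  interpret mean: levy_density_mean m by fact
  have "((\<lambda>t. LINT \<omega>|M. complex_of_real 1 * iexp (t * X \<omega>)) has_vector_derivative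
      (LINT \<omega>|M. (complex_of_real 1 * (\<i> * of_real (X \<omega>))) * iexp (0 * X \<omega>))) (at 0)"
    by (rule has_vector_derivative_fourier_integral) (use XI in auto)
  then have "((\<lambda>t. exp (psi \<mu> t)) has_vector_derivative (LINT \<omega>|M. \<i> * of_real (X \<omega>))) (at 0)"
    unfolding fourier_X by simp
  moreover have "((\<lambda>t. exp (psi \<mu> t)) has_vector_derivative mean.psi' \<mu> 0 * exp (psi \<mu> 0)) (at 0)"
    by (rule has_vector_derivative_exp_comp[OF mean.psi_has_derivative])
  ultimately have "(LINT \<omega>|M. \<i> * of_real (X \<omega>)) = mean.psi' \<mu> 0 * exp (psi \<mu> 0)"
    by (rule vector_derivative_unique_at)
  then have "\<i> * of_real (expectation X) = \<i> * of_real (large_jump_mean m + \<mu>)"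
    unfolding mean.psi'_zero psi_zero by (simp only: integral_mult_right_zero integral_complex_of_real exp_zero mult_1_right)
  then show ?thesis by (simp only: mult_cancel_left complex_i_not_zero of_real_eq_iff simp_thms)
qed

text \<open>The second derivative of \<open>\<phi> = exp \<psi>\<close> at \<open>0\<close> is \<open>\<psi>''(0) + \<psi>'(0)\<^sup>2\<close>, and \<open>\<psi>'(0)\<^sup>2\<close> is minus the square of the
mean.\<close>

theorem variance_X:
  assumes "levy_density_square m"
  shows "integrable M (\<lambda>\<omega>. (X \<omega>)\<^sup>2)" and "variance X = (LINT x|lborel. x\<^sup>2 * m x)"
proof -
  interpret sq: levy_density_square m by fact
  show X2: "integrable M (\<lambda>\<omega>. (X \<omega>)\<^sup>2)"
    using integrable_even_power_X[of 1] sq.times_differentiable_2_psi by simp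
  have XI: "integrable M X" using integrable_power_X[of 1 1] X2 by simp
  have c1: "integrable M (\<lambda>\<omega>. complex_of_real 1 * of_real (X \<omega>))" using XI by simp
  have d1: "((\<lambda>t. exp (psi \<mu> t)) has_vector_derivative (LINT \<omega>|M. (complex_of_real 1 * (\<i> * of_real (X \<omega>))) * iexp (t * X \<omega>))) (at t)" for t
    using has_vector_derivative_fourier_integral[OF _ X_measurable c1, of t] unfolding fourier_X by simp
  have e1: "(LINT \<omega>|M. (complex_of_real 1 * (\<i> * of_real (X \<omega>))) * iexp (t * X \<omega>)) = sq.psi' \<mu> t * exp (psi \<mu> t)" for t
    using vector_derivative_unique_at[OF d1[of t] has_vector_derivative_exp_comp[OF sq.psi_has_derivative]] .
  have i1: "integrable M (\<lambda>\<omega>. complex_of_real 1 * (\<i> * of_real (X \<omega>)))" using XI by simp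
  have i2: "integrable M (\<lambda>\<omega>. complex_of_real 1 * (\<i> * of_real (X \<omega>)) * of_real (X \<omega>))"
  proof -
    have "integrable M (\<lambda>\<omega>. \<i> * complex_of_real ((X \<omega>)\<^sup>2))" by (rule integrable_mult_right[OF integrable_of_real[OF X2]])
    then show ?thesis by (simp add: power2_eq_square mult_ac)
  qed
  have "((\<lambda>t. sq.psi' \<mu> t * exp (psi \<mu> t)) has_vector_derivative (LINT \<omega>|M. (complex_of_real 1 * (\<i> * of_real (X \<omega>)) * (\<i> * of_real (X \<omega>))) * iexp (0 * X \<omega>))) (at 0)"
    using has_vector_derivative_fourier_integral[OF i1 X_measurable i2, of 0] unfolding e1 .
  moreover have "((\<lambda>t. sq.psi' \<mu> t * exp (psi \<mu> t)) has_vector_derivative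
      sq.psi' \<mu> 0 * (sq.psi' \<mu> 0 * exp (psi \<mu> 0)) + sq.moment_integral 2 0 * exp (psi \<mu> 0)) (at 0)"
    by (intro has_vector_derivative_mult sq.psi'_has_derivative has_vector_derivative_exp_comp sq.psi_has_derivative)
  ultimately have "(LINT \<omega>|M. (complex_of_real 1 * (\<i> * of_real (X \<omega>)) * (\<i> * of_real (X \<omega>))) * iexp (0 * X \<omega>))
     = sq.psi' \<mu> 0 * (sq.psi' \<mu> 0 * exp (psi \<mu> 0)) + sq.moment_integral 2 0 * exp (psi \<mu> 0)"
    by (rule vector_derivative_unique_at)
  also have "\<dots> = - of_real ((expectation X)\<^sup>2 + (LINT x|lborel. x\<^sup>2 * m x))"
  proof -
    have "sq.psi' \<mu> 0 * (sq.psi' \<mu> 0 * exp (psi \<mu> 0)) = (\<i> * of_real (expectation X))\<^sup>2"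
      unfolding psi_zero sq.psi'_zero expectation_X[OF sq.levy_density_mean_axioms XI] by (simp add: power2_eq_square)
    also have "\<dots> = - of_real ((expectation X)\<^sup>2)" by (simp add: power_mult_distrib)
    finally show ?thesis unfolding sq.moment_integral_zero psi_zero by simp
  qed
  also have "(LINT \<omega>|M. (complex_of_real 1 * (\<i> * of_real (X \<omega>)) * (\<i> * of_real (X \<omega>))) * iexp (0 * X \<omega>)) = (LINT \<omega>|M. - complex_of_real ((X \<omega>)\<^sup>2))"
    by (intro Bochner_Integration.integral_cong refl) (simp add: power2_eq_square algebra_simps complex_i_mult_minus)
  also have "\<dots> = - complex_of_real (LINT \<omega>|M. (X \<omega>)\<^sup>2)" by (simp only: integral_minus integral_complex_of_real)
  finally have "(LINT \<omega>|M. (X \<omega>)\<^sup>2) = (expectation X)\<^sup>2 + (LINT x|lborel. x\<^sup>2 * m x)"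
    by (simp only: neg_equal_iff_equal of_real_eq_iff)
  then show "variance X = (LINT x|lborel. x\<^sup>2 * m x)" using variance_eq[OF XI X2] by simp
qed

text \<open>Near the origin \<open>\<bar>Im \<psi>\<bar> < \<pi>\<close>, so the principal logarithm of \<open>exp \<psi>\<close> is \<open>\<psi>\<close> itself.\<close>

theorem cumulants_X:
  assumes "levy_density_moments m"
  shows "integrable M (\<lambda>\<omega>. X \<omega> ^ n)"
    and "cumulant M X 1 = of_real (large_jump_mean m + \<mu>)"
    and "2 \<le> n \<Longrightarrow> cumulant M X n = of_real (LINT x|lborel. x ^ n * m x)"
proof -
  interpret mo: levy_density_moments m by fact
  show "integrable M (\<lambda>\<omega>. X \<omega> ^ n)"
    by (rule integrable_power_X[OF integrable_even_power_X[OF mo.times_differentiable_psi], of n n]) simp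
  have "isCont (psi \<mu>) 0"
    using has_vector_derivative_continuous[OF mo.psi_has_derivative] by blast
  then have "isCont (\<lambda>t. Im (psi \<mu> t)) 0" by (rule isCont_Im)
  moreover have "Im (psi \<mu> 0) = 0" by (simp add: psi_zero)
  ultimately have "(\<lambda>t. Im (psi \<mu> t)) \<midarrow>0\<rightarrow> 0" by (simp add: isCont_def)
  then obtain e where e: "0 < e" "\<And>t. t \<noteq> 0 \<Longrightarrow> \<bar>t\<bar> < e \<Longrightarrow> \<bar>Im (psi \<mu> t)\<bar> < pi"
    using LIM_D[of "\<lambda>t. Im (psi \<mu> t)" 0 0 pi] pi_gt_zero by auto
  have Ln: "Ln (char (distr M borel X) t) = mo.psi_deriv \<mu> 0 t" if "t \<in> {- e<..<e}" for t
  proof -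
    have "\<bar>Im (psi \<mu> t)\<bar> < pi" using e(2)[of t] that by (cases "t = 0") (auto simp: psi_zero)
    then show ?thesis unfolding char_X mo.psi_deriv_def by (simp add: Ln_exp abs_less_iff)
  qed
  have it: "((\<lambda>f t. vector_derivative f (at t)) ^^ k) (\<lambda>t. Ln (char (distr M borel X) t)) 0 = mo.psi_deriv \<mu> k 0" for k
    by (rule funpow_vector_derivative_eq[OF open_greaterThanLessThan Ln mo.psi_deriv_has_derivative]) (use e in auto)
  show "cumulant M X 1 = of_real (large_jump_mean m + \<mu>)"
    unfolding cumulant_def it by (simp add: mo.psi_deriv_def mo.psi'_zero del: funpow.simps of_real_add)
  show "cumulant M X n = of_real (LINT x|lborel. x ^ n * m x)" if "2 \<le> n"
  proof -
    have "(- \<i>) ^ n * \<i> ^ n = 1" by (simp flip: power_mult_distrib)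
    then show ?thesis
      unfolding cumulant_def it using that by (simp add: mo.psi_deriv_def mo.moment_integral_zero flip: mult.assoc)
  qed
qed

end

section \<open>Integrals against the half-densities\<close>

lemma has_bochner_integral_half_line_iff:
  fixes f :: "real \<Rightarrow> real"
  shows "has_bochner_integral half_line f x \<longleftrightarrow> has_bochner_integral lborel (\<lambda>t. indicator {0<..} t * f t) x"
    and "has_bochner_integral half_line f x \<longleftrightarrow> has_bochner_integral lborel (\<lambda>t. indicator {..<0} t * f (- t)) x"
proof -
  show 1: "has_bochner_integral half_line f x \<longleftrightarrow> has_bochner_integral lborel (\<lambda>t. indicator {0<..} t * f t) x"
    by (simp add: has_bochner_integral_restrict_space)
  show "has_bochner_integral half_line f x \<longleftrightarrow> has_bochner_integral lborel (\<lambda>t. indicator {..<0} t * f (- t)) x"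
    unfolding 1 using lborel_has_bochner_integral_real_affine_iff[of "-1" "\<lambda>t. indicator {0<..} t * f t" x 0]
    by (simp add: indicator_def)
qed

definition two_sided :: "(real \<Rightarrow> real) \<Rightarrow> (real \<Rightarrow> real) \<Rightarrow> real \<Rightarrow> real" where
  "two_sided p q x = p x * indicator {0<..} x + q \<bar>x\<bar> * indicator {..<0} x"

lemma two_sided_mult:
  "\<phi> x * two_sided p q x = indicator {0<..} x * (\<phi> x * p x) + indicator {..<0} x * (\<phi> (- (- x)) * q (- x))"
  by (auto simp: two_sided_def indicator_def)

text \<open>Reflection at the origin turns the contribution of the negative half-line into an integral over the positive one;
odd powers change their sign.\<close>

lemma has_bochner_integral_two_sided:
  assumes "has_bochner_integral half_line (\<lambda>r. \<phi> r * p r) a" "has_bochner_integral half_line (\<lambda>r. \<phi> (- r) * q r) b"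
  shows "has_bochner_integral lborel (\<lambda>x. \<phi> x * two_sided p q x) (a + b)"
  unfolding two_sided_mult
  using assms(1)[unfolded has_bochner_integral_half_line_iff(1)] assms(2)[unfolded has_bochner_integral_half_line_iff(2)]
  by (rule has_bochner_integral_add)

lemma integrable_two_sided_iff:
  "integrable lborel (\<lambda>x. \<phi> x * two_sided p q x) \<longleftrightarrow>
     integrable half_line (\<lambda>r. \<phi> r * p r) \<and> integrable half_line (\<lambda>r. \<phi> (- r) * q r)" (is "?L \<longleftrightarrow> ?R")
proof
  assume ?R
  then show ?L using has_bochner_integral_two_sided[of \<phi> p _ q] by (blast elim: integrable.cases intro: integrable.intros)
next
  assume L: ?L
  have "integrable lborel (\<lambda>x. indicator {0<..} x *\<^sub>R (\<phi> x * two_sided p q x))"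
    by (rule integrable_mult_indicator[OF _ L]) simp
  also have "(\<lambda>x. indicator {0<..} x *\<^sub>R (\<phi> x * two_sided p q x)) = (\<lambda>x. indicator {0<..} x * (\<phi> x * p x))"
    by (auto simp: two_sided_def indicator_def)
  finally have 1: "integrable half_line (\<lambda>r. \<phi> r * p r)"
    using has_bochner_integral_half_line_iff(1)[of "\<lambda>r. \<phi> r * p r"] by (auto simp: integrable.simps)
  have "integrable lborel (\<lambda>x. indicator {..<0} x *\<^sub>R (\<phi> x * two_sided p q x))"
    by (rule integrable_mult_indicator[OF _ L]) simp
  also have "(\<lambda>x. indicator {..<0} x *\<^sub>R (\<phi> x * two_sided p q x)) = (\<lambda>x. indicator {..<0} x * (\<phi> (- (- x)) * q (- x)))"
    by (auto simp: two_sided_def indicator_def)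
  finally have "integrable half_line (\<lambda>r. \<phi> (- r) * q r)"
    using has_bochner_integral_half_line_iff(2)[of "\<lambda>r. \<phi> (- r) * q r"] by (auto simp: integrable.simps)
  with 1 show ?R ..
qed

lemma integrable_half_line_powr_small:
  assumes "- 1 < s"
  shows "integrable half_line (\<lambda>r. indicator {0<..1} r * r powr s)"
proof (rule Bochner_Integration.integrable_bound)
  show "integrable half_line (\<lambda>r. exp 1 * (r powr ((s + 1) - 1) * exp (- 1 * r)))"
    using assms by (intro integrable_mult_right integrable.intros[OF has_bochner_integral_Gamma]) auto
  show "AE r in half_line. norm (indicator {0<..1} r * r powr s) \<le> norm (exp 1 * (r powr ((s + 1) - 1) * exp (- 1 * r)))"
  proof (rule AE_I2)
    fix r :: real
    have "r powr s * 1 \<le> r powr s * exp (1 - r)" if "r \<le> 1" using that by (intro mult_left_mono) auto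
    then show "norm (indicator {0<..1} r * r powr s) \<le> norm (exp 1 * (r powr ((s + 1) - 1) * exp (- 1 * r)))"
      by (auto simp: indicator_def exp_diff exp_minus divide_inverse mult_ac)
  qed
qed measurable

lemma nn_integral_powr_tail:
  assumes "s < - 1"
  shows "(\<integral>\<^sup>+r. ennreal (r powr s) * indicator {1..} r \<partial>lborel) < \<infinity>"
proof -
  have "(\<integral>\<^sup>+r. ennreal (r powr s) * indicator {1..} r \<partial>lborel) = ennreal (0 - 1 powr (s + 1) / (s + 1))"
  proof (rule nn_integral_FTC_atLeast[where F = "\<lambda>r. r powr (s + 1) / (s + 1)"])
    show "((\<lambda>r. r powr (s + 1) / (s + 1)) has_real_derivative r powr s) (at r)" if "1 \<le> r" for r
      using that assms by (auto intro!: derivative_eq_intros)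
    show "((\<lambda>r. r powr (s + 1) / (s + 1)) \<longlongrightarrow> 0) at_top"
      using assms by real_asymp
  qed auto
  then show ?thesis by simp
qed

lemma integrable_half_line_powr_large:
  assumes "s < - 1"
  shows "integrable half_line (\<lambda>r. indicator {1<..} r * r powr s)"
proof (rule integrableI_nonneg)
  have "(\<integral>\<^sup>+r. ennreal (indicator {1<..} r * r powr s) \<partial>half_line) \<le> (\<integral>\<^sup>+r. ennreal (r powr s) * indicator {1..} r \<partial>lborel)"
    unfolding nn_integral_half_line by (intro nn_integral_mono) (auto simp: indicator_def)
  then show "(\<integral>\<^sup>+r. ennreal (indicator {1<..} r * r powr s) \<partial>half_line) < \<infinity>"
    using nn_integral_powr_tail[OF assms] by (rule le_less_trans)
qed auto

lemma not_integrable_half_line_powr_large: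
  assumes "- 1 \<le> s"
  shows "\<not> integrable half_line (\<lambda>r. indicator {1<..} r * r powr s)"
proof
  assume int: "integrable half_line (\<lambda>r. indicator {1<..} r * r powr s)"
  define K where "K = (LINT r|half_line. indicator {1<..} r * r powr s)"
  have "ln b \<le> K" if b: "1 \<le> b" for b
  proof -
    have "ennreal (ln b - ln 1) = (\<integral>\<^sup>+r. ennreal (1 / r) * indicator {1..b} r \<partial>lborel)"
      by (rule nn_integral_FTC_Icc[symmetric]) (use b in \<open>auto intro!: derivative_eq_intros\<close>)
    also have "\<dots> \<le> (\<integral>\<^sup>+r. ennreal (indicator {1<..} r * r powr s) * indicator {0<..} r \<partial>lborel)"
    proof (rule nn_integral_mono_AE)
      have "AE r in lborel. r \<noteq> (1::real)" by (rule AE_lborel_singleton)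
      then show "AE r in lborel. ennreal (1 / r) * indicator {1..b} r \<le> ennreal (indicator {1<..} r * r powr s) * indicator {0<..} r"
      proof eventually_elim
        case (elim r)
        have "1 / r \<le> r powr s" if "1 < r"
        proof -
          have "r powr (- 1) \<le> r powr s" using that assms by (intro powr_mono) auto
          then show ?thesis using that by (simp add: powr_minus divide_inverse)
        qed
        then show ?case using elim by (auto simp: indicator_def intro!: ennreal_leI)
      qed
    qed
    also have "\<dots> = ennreal K"
      unfolding nn_integral_half_line[symmetric] K_def by (intro nn_integral_eq_integral int) auto
    finally show ?thesis
      by (subst (asm) ennreal_le_iff) (auto simp: K_def intro!: Bochner_Integration.integral_nonneg)
  qed
  from this[of "exp (\<bar>K\<bar> + 1)"] show False by simp
qed

context
  fixes a l g d :: real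
  assumes a: "0 < a" "a \<le> 1" and l: "0 < l" and d: "0 \<le> d"
begin

abbreviation ml_tail :: "real \<Rightarrow> real" where
  "ml_tail r \<equiv> mittag_leffler a (- l * r powr a)"

lemma ml_tail_bounds: "0 \<le> ml_tail r" "ml_tail r \<le> 1"
  using mittag_leffler_neg_bounds[OF a, of "l * r powr a"] l by simp_all

lemma ml_tail_scale: "0 < r \<Longrightarrow> ml_tail r = mittag_leffler a (- ((l powr (1 / a) * r) powr a))"
  using a l by (simp add: powr_mult powr_powr)

lemma ml_tail_upper:
  assumes r: "0 < r"
  shows "ml_tail r \<le> exp 1 / l * r powr (- a)"
proof -
  have "ml_tail r \<le> exp 1 * (l powr (1 / a) * r) powr (- a)"
    unfolding ml_tail_scale[OF r] using l r by (intro mittag_leffler_neg_upper[OF a] mult_pos_pos) auto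
  also have "(l powr (1 / a) * r) powr (- a) = 1 / l * r powr (- a)"
    using l r a by (simp add: powr_mult powr_powr powr_minus divide_inverse)
  finally show ?thesis by simp
qed

lemma ml_tail_lower:
  assumes a1: "a < 1"
  obtains c R where "0 < c" "1 \<le> R" "\<And>r. R \<le> r \<Longrightarrow> c * r powr (- a) \<le> ml_tail r"
proof -
  define k where "k = l powr (1 / a)"
  have k: "0 < k" unfolding k_def using l by simp
  obtain c where c: "0 < c" "\<And>t. 1 \<le> t \<Longrightarrow> c * t powr (- a) \<le> mittag_leffler a (- (t powr a))"
    using mittag_leffler_neg_lower[OF a(1) a1] by blast
  show ?thesis
  proof (rule that[of "c * k powr (- a)" "max 1 (1 / k)"])
    show "0 < c * k powr (- a)" using c k by simp
    fix r assume r: "max 1 (1 / k) \<le> r"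
    then have r0: "0 < r" by simp
    have "1 \<le> k * r" using r k by (simp add: field_simps)
    from c(2)[OF this] show "c * k powr (- a) * r powr (- a) \<le> ml_tail r"
      unfolding ml_tail_scale[OF r0] k_def[symmetric] using k r0 by (simp add: powr_mult mult.assoc)
  qed simp
qed

lemma half_density_nonneg: "0 \<le> half_density g a l t d r"
  unfolding half_density_def using d ml_tail_bounds[of r] by (intro mult_nonneg_nonneg divide_nonneg_nonneg) auto

lemma half_density_measurable: "half_density g a l t d \<in> borel_measurable borel"
proof -
  note [measurable] = mittag_leffler_measurable[OF a(1)]
  show ?thesis unfolding half_density_def[abs_def] by measurable
qed

lemma half_density_measurable_half_line: "half_density g a l t d \<in> borel_measurable half_line"
  using half_density_measurable by (intro measurable_restrict_space1) simp

lemma half_density_eq: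
  assumes "0 < r"
  shows "r ^ n * half_density g a l t d r = d * (r powr (real n - g - 1) * exp (- t * r) * ml_tail r)"
proof -
  have "r ^ n / r powr (1 + g) = r powr (real n - g - 1)"
    using assms by (simp add: powr_diff powr_realpow[symmetric] powr_add)
  moreover have "r ^ n * half_density g a l t d r = d * ((r ^ n / r powr (1 + g)) * exp (- t * r) * ml_tail r)"
    unfolding half_density_def by simp
  ultimately show ?thesis by simp
qed

lemma half_density_integrable_small:
  assumes g: "g < 2" and t: "0 \<le> t"
  shows "integrable half_line (\<lambda>r. indicator {0<..1} r * (r\<^sup>2 * half_density g a l t d r))"
proof (rule Bochner_Integration.integrable_bound)
  note [measurable] = half_density_measurable_half_line
  show "integrable half_line (\<lambda>r. d * (indicator {0<..1} r * r powr (1 - g)))"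
    using g by (intro integrable_mult_right integrable_half_line_powr_small) auto
  show "AE r in half_line. norm (indicator {0<..1} r * (r\<^sup>2 * half_density g a l t d r)) \<le> norm (d * (indicator {0<..1} r * r powr (1 - g)))"
  proof (rule AE_I2)
    fix r assume "r \<in> space half_line"
    then have r: "0 < r" by simp
    have "r powr (real 2 - g - 1) * exp (- t * r) * ml_tail r \<le> r powr (1 - g) * 1 * 1"
      using r t ml_tail_bounds[of r] by (intro mult_mono) auto
    then have "r\<^sup>2 * half_density g a l t d r \<le> d * r powr (1 - g)"
      unfolding half_density_eq[OF r] using d by (intro mult_left_mono) auto
    then show "norm (indicator {0<..1} r * (r\<^sup>2 * half_density g a l t d r)) \<le> norm (d * (indicator {0<..1} r * r powr (1 - g)))"
      using half_density_nonneg[of t r] d by (auto simp: indicator_def abs_mult)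
  qed
  show "(\<lambda>r. indicator {0<..1} r * (r\<^sup>2 * half_density g a l t d r)) \<in> borel_measurable half_line" by measurable
qed

lemma half_density_tail_integrable:
  assumes n: "real n < a + g"
  shows "integrable half_line (\<lambda>r. indicator {1<..} r * (r ^ n * half_density g a l 0 d r))"
proof (rule Bochner_Integration.integrable_bound)
  note [measurable] = half_density_measurable_half_line
  show "integrable half_line (\<lambda>r. d * exp 1 / l * (indicator {1<..} r * r powr (real n - g - 1 - a)))"
    using n by (intro integrable_mult_right integrable_half_line_powr_large) auto
  show "AE r in half_line. norm (indicator {1<..} r * (r ^ n * half_density g a l 0 d r)) \<le> norm (d * exp 1 / l * (indicator {1<..} r * r powr (real n - g - 1 - a)))"
  proof (rule AE_I2)
    fix r assume "r \<in> space half_line"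
    then have r: "0 < r" by simp
    have "r powr (real n - g - 1) * exp (- 0 * r) * ml_tail r \<le> r powr (real n - g - 1) * exp (- 0 * r) * (exp 1 / l * r powr (- a))"
      by (intro mult_left_mono ml_tail_upper r) auto
    also have "\<dots> = exp 1 / l * r powr (real n - g - 1 - a)"
      using r powr_add[of r "real n - g - 1" "- a"] by simp
    finally have "r ^ n * half_density g a l 0 d r \<le> d * (exp 1 / l * r powr (real n - g - 1 - a))"
      unfolding half_density_eq[OF r] using d by (intro mult_left_mono)
    then show "norm (indicator {1<..} r * (r ^ n * half_density g a l 0 d r)) \<le> norm (d * exp 1 / l * (indicator {1<..} r * r powr (real n - g - 1 - a)))"
      using half_density_nonneg[of 0 r] d l r by (auto simp: indicator_def abs_mult)
  qed
  show "(\<lambda>r. indicator {1<..} r * (r ^ n * half_density g a l 0 d r)) \<in> borel_measurable half_line" by measurable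
qed

text \<open>The lower bound of the Mittag-Leffler function holds only beyond some \<open>R\<close>; on \<open>(1, R]\<close> any bounded function
is integrable.\<close>

lemma half_density_tail_not_integrable:
  assumes n: "a + g \<le> real n" and d0: "0 < d" and a1: "a < 1"
  shows "\<not> integrable half_line (\<lambda>r. indicator {1<..} r * (r ^ n * half_density g a l 0 d r))"
proof
  assume int: "integrable half_line (\<lambda>r. indicator {1<..} r * (r ^ n * half_density g a l 0 d r))"
  obtain c R where c: "0 < c" "1 \<le> R" "\<And>r. R \<le> r \<Longrightarrow> c * r powr (- a) \<le> ml_tail r"
    using ml_tail_lower[OF a1] by blast
  define s where "s = real n - g - 1 - a"
  have s: "- 1 \<le> s" unfolding s_def using n by simp
  \<comment> \<open>The first summand dominates \<open>r powr s\<close> on \<open>(1, R]\<close>, whatever the sign of \<open>s\<close>.\<close>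
  have "integrable half_line (\<lambda>r. indicator {1<..R} r * R powr \<bar>s\<bar> + 1 / (d * c) * (indicator {1<..} r * (r ^ n * half_density g a l 0 d r)))"
  proof (intro Bochner_Integration.integrable_add integrable_mult_right int integrable_mult_left)
    have "emeasure half_line {1<..R} \<le> emeasure lborel {1<..R}"
      by (subst emeasure_restrict_space) (auto intro!: emeasure_mono)
    also have "\<dots> < \<infinity>" using c by simp
    finally show "integrable half_line (indicator {1<..R} :: real \<Rightarrow> real)"
      by (intro integrable_real_indicator) (auto simp: sets_restrict_space_iff)
  qed
  then have "integrable half_line (\<lambda>r. indicator {1<..} r * r powr s)"
  proof (rule Bochner_Integration.integrable_bound)
    show "AE r in half_line. norm (indicator {1<..} r * r powr s) \<le> norm (indicator {1<..R} r * R powr \<bar>s\<bar> + 1 / (d * c) * (indicator {1<..} r * (r ^ n * half_density g a l 0 d r)))"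
    proof (rule AE_I2)
      fix r assume "r \<in> space half_line"
      then have r: "0 < r" by simp
      have h0: "0 \<le> 1 / (d * c) * (r ^ n * half_density g a l 0 d r)" using half_density_nonneg[of 0 r] d c r by simp
      show "norm (indicator {1<..} r * r powr s) \<le> norm (indicator {1<..R} r * R powr \<bar>s\<bar> + 1 / (d * c) * (indicator {1<..} r * (r ^ n * half_density g a l 0 d r)))"
      proof (cases "1 < r")
        case r1: True
        show ?thesis
        proof (cases "r \<le> R")
          case True
          have "r powr s \<le> r powr \<bar>s\<bar>" using r1 by (intro powr_mono) auto
          also have "\<dots> \<le> R powr \<bar>s\<bar>" using r1 True by (intro powr_mono2) auto
          finally show ?thesis using True r1 h0 by simp
        next
          case False
          have "c * r powr s = r powr (real n - g - 1) * (c * r powr (- a))"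
            using r powr_add[of r "real n - g - 1" "- a"] by (simp add: s_def)
          also have "\<dots> \<le> r powr (real n - g - 1) * ml_tail r" using False by (intro mult_left_mono c) auto
          finally have "d * (c * r powr s) \<le> r ^ n * half_density g a l 0 d r"
            unfolding half_density_eq[OF r] using d by (simp add: mult_left_mono)
          then have "1 / (d * c) * (d * (c * r powr s)) \<le> 1 / (d * c) * (r ^ n * half_density g a l 0 d r)"
            using d c by (intro mult_left_mono) auto
          then have le: "r powr s \<le> 1 / (d * c) * (r ^ n * half_density g a l 0 d r)" using d0 c by simp
          have "indicator {1<..R} r * R powr \<bar>s\<bar> + 1 / (d * c) * (indicator {1<..} r * (r ^ n * half_density g a l 0 d r)) = 1 / (d * c) * (r ^ n * half_density g a l 0 d r)"
            using False r1 by simp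
          moreover have "norm (indicator {1<..} r * r powr s) = r powr s" using r1 by simp
          ultimately show ?thesis using le unfolding real_norm_def by (simp only: abs_of_nonneg[OF h0])
        qed
      qed simp
    qed
  qed measurable
  then show False using not_integrable_half_line_powr_large[OF s] by blast
qed

lemma half_density_tempered_integrable:
  assumes t: "0 < t" and n: "g < real n"
  shows "integrable half_line (\<lambda>r. r ^ n * half_density g a l t d r)"
proof -
  note [measurable] = mittag_leffler_measurable[OF a(1)]
  have "integrable half_line (\<lambda>r. r powr ((real n - g) - 1) * exp (- t * r) * ml_tail r)"
  proof (rule Bochner_Integration.integrable_bound)
    show "integrable half_line (\<lambda>r. r powr ((real n - g) - 1) * exp (- t * r))"
      using n t by (intro integrable.intros[OF has_bochner_integral_Gamma]) auto
    show "AE r in half_line. norm (r powr ((real n - g) - 1) * exp (- t * r) * ml_tail r) \<le> norm (r powr ((real n - g) - 1) * exp (- t * r))"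
      using ml_tail_bounds by (intro AE_I2) (auto simp: abs_mult intro!: mult_left_le)
    show "(\<lambda>r. r powr ((real n - g) - 1) * exp (- t * r) * ml_tail r) \<in> borel_measurable half_line" by measurable
  qed
  then have "integrable half_line (\<lambda>r. d * (r powr (real n - g - 1) * exp (- t * r) * ml_tail r))" by (intro integrable_mult_right) simp
  also have "?this \<longleftrightarrow> ?thesis"
    by (rule Bochner_Integration.integrable_cong[OF refl]) (simp only: space_half_line greaterThan_iff half_density_eq)
  finally show ?thesis .
qed

lemma half_density_tempered_moment:
  assumes t: "0 < t" and n: "g < real n"
  shows "complex_of_real (LINT r|half_line. r ^ n * half_density g a l t d r)
     = of_real (d * Gamma (real n - g) / t powr (real n - g)) * hyp_2R1 1 (of_real (real n - g)) 1 a (of_real (- (l / t powr a)))"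
proof -
  have "(LINT r|half_line. r ^ n * half_density g a l t d r) = (LINT r|half_line. d * (r powr (real n - g - 1) * exp (- t * r) * ml_tail r))"
    by (intro Bochner_Integration.integral_cong refl) (simp only: space_half_line greaterThan_iff half_density_eq)
  also have "\<dots> = d * (LINT r|half_line. r powr (real n - g - 1) * exp (- t * r) * ml_tail r)" by simp
  finally have "complex_of_real (LINT r|half_line. r ^ n * half_density g a l t d r)
     = of_real d * complex_of_real (LINT r|half_line. r powr (real n - g - 1) * exp (- t * r) * ml_tail r)" by simp
  also have "complex_of_real (LINT r|half_line. r powr (real n - g - 1) * exp (- t * r) * ml_tail r)
     = of_real (Gamma (real n - g) / t powr (real n - g)) * hyp_2R1 1 (of_real (real n - g)) 1 a (of_real (- (l / t powr a)))"
    by (rule laplace_mittag_leffler_hyp_2R1[OF a _ l t]) (use n in simp)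
  finally show ?thesis by simp
qed

text \<open>For \<open>a = 1\<close> the Mittag-Leffler factor is \<open>exp (- l r)\<close>.\<close>

lemma half_density_one_tail_integrable:
  assumes a1: "a = 1" and g: "0 \<le> g"
  shows "integrable half_line (\<lambda>r. indicator {1<..} r * (r ^ n * half_density g a l 0 d r))"
proof (rule Bochner_Integration.integrable_bound)
  note [measurable] = half_density_measurable_half_line
  show "integrable half_line (\<lambda>r. d * (r powr (real (n + 1) - 1) * exp (- l * r)))"
    using l by (intro integrable_mult_right integrable.intros[OF has_bochner_integral_Gamma]) auto
  show "AE r in half_line. norm (indicator {1<..} r * (r ^ n * half_density g a l 0 d r)) \<le> norm (d * (r powr (real (n + 1) - 1) * exp (- l * r)))"
  proof (rule AE_I2)
    fix r assume "r \<in> space half_line"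
    then have r: "0 < r" by simp
    have mt1: "ml_tail r = exp (- l * r)" using a1 r by (simp add: mittag_leffler_one)
    show "norm (indicator {1<..} r * (r ^ n * half_density g a l 0 d r)) \<le> norm (d * (r powr (real (n + 1) - 1) * exp (- l * r)))"
    proof (cases "1 < r")
      case True
      have "r powr (real n - g - 1) * exp (- 0 * r) * ml_tail r \<le> r powr (real (n + 1) - 1) * 1 * exp (- l * r)"
        unfolding mt1 using True g by (intro mult_mono powr_mono) auto
      then have "r ^ n * half_density g a l 0 d r \<le> d * (r powr (real (n + 1) - 1) * exp (- l * r))"
        unfolding half_density_eq[OF r] using d by (intro mult_left_mono) auto
      then show ?thesis using half_density_nonneg[of 0 r] d r True by (auto simp: abs_mult)
    qed simp
  qed
  show "(\<lambda>r. indicator {1<..} r * (r ^ n * half_density g a l 0 d r)) \<in> borel_measurable half_line" by measurable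
qed

lemma half_density_tail_integrable_iff:
  assumes g: "0 \<le> g"
  shows "integrable half_line (\<lambda>r. indicator {1<..} r * (r ^ n * half_density g a l 0 d r)) \<longleftrightarrow> tail_moment g a d n"
proof (cases "0 < d \<and> a < 1")
  case True
  then show ?thesis
    using half_density_tail_integrable[of n] half_density_tail_not_integrable[of n] unfolding tail_moment_def by (meson not_less)
next
  case False
  then have "d = 0 \<or> a = 1" using d a by auto
  then have "integrable half_line (\<lambda>r. indicator {1<..} r * (r ^ n * half_density g a l 0 d r))"
    using half_density_one_tail_integrable[OF _ g] by (auto simp: half_density_def)
  then show ?thesis using False by (auto simp: tail_moment_def)
qed

text \<open>The scaling \<open>c = l powr (- 1 / a)\<close> reduces the integral to the Mellin transform at \<open>s = 2 - g\<close>, whose range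
\<open>0 < s < a\<close> is the hypothesis on \<open>g\<close>.\<close>

lemma half_density_second_moment:
  assumes g: "g < 2" and ag: "2 < a + g"
  shows "has_bochner_integral half_line (\<lambda>r. r\<^sup>2 * half_density g a l 0 d r) (d * ell (g - 2) a l)"
proof -
  note [measurable] = mittag_leffler_measurable[OF a(1)]
  define s where "s = 2 - g"
  have s: "0 < s" "s < a" unfolding s_def using g ag by auto
  define c where "c = l powr (- (1 / a))"
  have c: "0 < c" unfolding c_def using l by simp
  have "c powr a = l powr (- 1)" unfolding c_def powr_powr using a by simp
  then have lc: "l * c powr a = 1" using l by (simp add: powr_minus)
  define V where "V = pi / (sin (pi * s / a) * a * Gamma (1 - s))"
  have V: "0 \<le> V"
  proof -
    have "0 < sin (pi * s / a)" using s a by (intro sin_gt_zero) (auto simp: field_simps)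
    moreover have "0 < Gamma (1 - s)" using s a by (intro Gamma_real_pos) auto
    ultimately show ?thesis unfolding V_def using a by simp
  qed
  have "(\<integral>\<^sup>+r. ennreal (r powr (s - 1) * ml_tail r) \<partial>half_line) = ennreal c * (\<integral>\<^sup>+r. ennreal ((c * r) powr (s - 1) * ml_tail (c * r)) \<partial>half_line)"
    by (rule nn_integral_half_line_scale[OF _ c]) measurable
  also have "(\<integral>\<^sup>+r. ennreal ((c * r) powr (s - 1) * ml_tail (c * r)) \<partial>half_line) = (\<integral>\<^sup>+r. ennreal (c powr (s - 1)) * ennreal (r powr (s - 1) * mittag_leffler a (- (r powr a))) \<partial>half_line)"
  proof (intro nn_integral_cong)
    fix r assume "r \<in> space half_line"
    then have r: "0 < r" by simp
    have "- l * (c * r) powr a = - ((l * c powr a) * r powr a)" using c r by (simp add: powr_mult)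
    then have "- l * (c * r) powr a = - (r powr a)" unfolding lc by simp
    then show "ennreal ((c * r) powr (s - 1) * ml_tail (c * r)) = ennreal (c powr (s - 1)) * ennreal (r powr (s - 1) * mittag_leffler a (- (r powr a)))"
      using c r by (simp only: powr_mult mult.assoc) (simp add: ennreal_mult'[symmetric])
  qed
  also have "\<dots> = ennreal (c powr (s - 1)) * ennreal V"
    unfolding V_def by (subst nn_integral_cmult, measurable) (simp only: mellin_mittag_leffler[OF a s])
  also have "ennreal c * (ennreal (c powr (s - 1)) * ennreal V) = ennreal (c powr s * V)"
    using c V by (simp add: ennreal_mult'[symmetric] powr_diff)
  finally have "(\<integral>\<^sup>+r. ennreal (r powr (s - 1) * ml_tail r) \<partial>half_line) = ennreal (c powr s * V)" .
  then have "has_bochner_integral half_line (\<lambda>r. r powr (s - 1) * ml_tail r) (c powr s * V)"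
    using ml_tail_bounds V by (intro has_bochner_integral_nn_integral) auto
  then have "has_bochner_integral half_line (\<lambda>r. d * (r powr (s - 1) * ml_tail r)) (d * (c powr s * V))"
    by (rule has_bochner_integral_mult_right)
  also have "?this \<longleftrightarrow> has_bochner_integral half_line (\<lambda>r. r\<^sup>2 * half_density g a l 0 d r) (d * (c powr s * V))"
  proof (rule has_bochner_integral_cong[OF refl _ refl])
    fix r assume "r \<in> space half_line"
    then have r: "0 < r" by simp
    show "d * (r powr (s - 1) * ml_tail r) = r\<^sup>2 * half_density g a l 0 d r"
      using half_density_eq[OF r, of 2 0] by (simp add: s_def algebra_simps)
  qed
  also have "c powr s * V = ell (g - 2) a l"
  proof -
    have "- (1 / a) * (2 - g) = (g - 2) / a" using a by (simp add: field_simps)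
    then have "c powr s = l powr ((g - 2) / a)" unfolding c_def s_def powr_powr by (simp only:)
    moreover have "sin (- pi * (g - 2) / a) = sin (pi * s / a)" unfolding s_def by (simp add: algebra_simps)
    moreover have "1 + (g - 2) = 1 - s" unfolding s_def by simp
    ultimately show ?thesis unfolding ell_def V_def by (simp only: times_divide_times_eq mult_1_right mult.assoc times_divide_eq_right divide_divide_eq_left)
  qed
  finally show ?thesis .
qed

end

section \<open>The two classes of laws\<close>

text \<open>Tempering only decreases the density, so the untempered bound is enough on \<open>(1, \<infinity>)\<close>.\<close>

lemma half_density_levy_integrable:
  assumes a: "0 < a" "a \<le> 1" and l: "0 < l" and d: "0 \<le> d" and g: "0 \<le> g" "g < 2" and t: "0 \<le> t"
  shows "integrable half_line (\<lambda>r. min 1 (r\<^sup>2) * half_density g a l t d r)"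
proof (rule Bochner_Integration.integrable_bound)
  note hd = a l d
  note [measurable] = half_density_measurable_half_line[OF hd]
  show "(\<lambda>r. min 1 (r\<^sup>2) * half_density g a l t d r) \<in> borel_measurable half_line" by measurable
  have "tail_moment g a d 0" using a g by (simp add: tail_moment_def add_pos_nonneg)
  then have "integrable half_line (\<lambda>r. indicator {1<..} r * (r ^ 0 * half_density g a l 0 d r))"
    using half_density_tail_integrable_iff[OF hd g(1)] by blast
  then show "integrable half_line (\<lambda>r. indicator {0<..1} r * (r\<^sup>2 * half_density g a l t d r) + indicator {1<..} r * (r ^ 0 * half_density g a l 0 d r))"
    by (intro Bochner_Integration.integrable_add half_density_integrable_small[OF hd g(2) t])
  show "AE r in half_line. norm (min 1 (r\<^sup>2) * half_density g a l t d r)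
     \<le> norm (indicator {0<..1} r * (r\<^sup>2 * half_density g a l t d r) + indicator {1<..} r * (r ^ 0 * half_density g a l 0 d r))"
  proof (rule AE_I2)
    fix r assume "r \<in> space half_line"
    then have r: "0 < r" by simp
    note nn = half_density_nonneg[OF hd, of g _ r]
    show "norm (min 1 (r\<^sup>2) * half_density g a l t d r)
       \<le> norm (indicator {0<..1} r * (r\<^sup>2 * half_density g a l t d r) + indicator {1<..} r * (r ^ 0 * half_density g a l 0 d r))"
    proof (cases "r \<le> 1")
      case True
      then have "r\<^sup>2 \<le> 1" using r by (simp add: power_le_one)
      then show ?thesis using True r nn by (simp add: min_absorb2)
    next
      case False
      then have "1 \<le> r\<^sup>2" by (simp add: one_le_power)
      moreover have "half_density g a l t d r \<le> half_density g a l 0 d r"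
      proof -
        have "exp (- t * r) \<le> exp (- 0 * r)" using t r by simp
        then show ?thesis unfolding half_density_def using d mittag_leffler_neg_bounds(1)[OF a, of "l * r powr a"] l
          by (intro mult_right_mono mult_left_mono divide_right_mono) auto
      qed
      ultimately show ?thesis using False nn by (simp add: min_absorb1)
    qed
  qed
qed

lemma half_density_second_moment_integrable_iff:
  assumes a: "0 < a" "a \<le> 1" and l: "0 < l" and d: "0 \<le> d" and g: "0 \<le> g" "g < 2"
  shows "integrable half_line (\<lambda>r. r\<^sup>2 * half_density g a l 0 d r) \<longleftrightarrow> tail_moment g a d 2"
proof
  note hd = a l d
  assume int: "integrable half_line (\<lambda>r. r\<^sup>2 * half_density g a l 0 d r)"
  have "integrable half_line (\<lambda>r. indicator {1<..} r *\<^sub>R (r\<^sup>2 * half_density g a l 0 d r))"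
    by (rule integrable_mult_indicator[OF _ int]) (auto simp: sets_restrict_space_iff)
  then show "tail_moment g a d 2" using half_density_tail_integrable_iff[OF hd g(1), of 2] by simp
next
  note hd = a l d
  assume "tail_moment g a d 2"
  then have "integrable half_line (\<lambda>r. indicator {1<..} r * (r\<^sup>2 * half_density g a l 0 d r))"
    using half_density_tail_integrable_iff[OF hd g(1), of 2] by simp
  then have "integrable half_line (\<lambda>r. indicator {0<..1} r * (r\<^sup>2 * half_density g a l 0 d r) + indicator {1<..} r * (r\<^sup>2 * half_density g a l 0 d r))"
    by (intro Bochner_Integration.integrable_add half_density_integrable_small[OF hd g(2)]) auto
  also have "?this \<longleftrightarrow> integrable half_line (\<lambda>r. r\<^sup>2 * half_density g a l 0 d r)"
    by (rule Bochner_Integration.integrable_cong[OF refl]) (auto simp: indicator_def)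
  finally show "integrable half_line (\<lambda>r. r\<^sup>2 * half_density g a l 0 d r)" .
qed

lemma gtgs_density_two_sided:
  "gtgs_density (gp, gm) (ap, am) (lp, lm) (tp, tm) (dp, dm)
     = two_sided (half_density gp ap lp tp dp) (half_density gm am lm tm dm)"
  by (auto simp: fun_eq_iff gtgs_density_def two_sided_def)

locale gtgs_parameters =
  fixes ap am lp lm tp tm dp dm gp gm :: real
  assumes ap: "0 < ap" "ap \<le> 1" and am: "0 < am" "am \<le> 1"
    and lp: "0 < lp" and lm: "0 < lm"
    and tp: "0 \<le> tp" and tm: "0 \<le> tm"
    and dp: "0 \<le> dp" and dm: "0 \<le> dm"
    and gp: "0 \<le> gp" "gp < 2" and gm: "0 \<le> gm" "gm < 2"
begin

abbreviation hp :: "real \<Rightarrow> real" where "hp \<equiv> half_density gp ap lp tp dp"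
abbreviation hm :: "real \<Rightarrow> real" where "hm \<equiv> half_density gm am lm tm dm"
abbreviation dens :: "real \<Rightarrow> real" where "dens \<equiv> gtgs_density (gp, gm) (ap, am) (lp, lm) (tp, tm) (dp, dm)"

sublocale levy_density dens
proof
  note [measurable] = half_density_measurable[OF ap lp dp] half_density_measurable[OF am lm dm]
  show "dens \<in> borel_measurable borel"
    unfolding gtgs_density_two_sided two_sided_def[abs_def] by measurable
  show "0 \<le> dens x" for x
    unfolding gtgs_density_two_sided two_sided_def
    using half_density_nonneg[OF ap lp dp] half_density_nonneg[OF am lm dm] by simp
  show "integrable lborel (\<lambda>x. min 1 (x\<^sup>2) * dens x)"
    unfolding gtgs_density_two_sided integrable_two_sided_iff[of "\<lambda>x. min 1 (x\<^sup>2)"]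
    using half_density_levy_integrable[OF ap lp dp gp tp] half_density_levy_integrable[OF am lm dm gm tm] by simp
qed

lemma levy_rvI:
  "gtgs_rv M X (gp, gm) (ap, am) (lp, lm) (tp, tm) (dp, dm) \<mu> \<Longrightarrow> levy_rv dens M X \<mu>"
  unfolding gtgs_rv_def levy_rv_def levy_rv_axioms_def using levy_density_axioms by blast

lemma has_bochner_integral_moment:
  assumes "integrable half_line (\<lambda>r. r ^ n * hp r)" "integrable half_line (\<lambda>r. r ^ n * hm r)"
  shows "has_bochner_integral lborel (\<lambda>x. x ^ n * dens x)
     ((LINT r|half_line. r ^ n * hp r) + (-1) ^ n * (LINT r|half_line. r ^ n * hm r))"
  unfolding gtgs_density_two_sided
proof (rule has_bochner_integral_two_sided)
  show "has_bochner_integral half_line (\<lambda>r. r ^ n * hp r) (LINT r|half_line. r ^ n * hp r)"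
    using assms(1) by (rule has_bochner_integral_integrable)
  have "has_bochner_integral half_line (\<lambda>r. (-1) ^ n * (r ^ n * hm r)) ((-1) ^ n * (LINT r|half_line. r ^ n * hm r))"
    by (rule has_bochner_integral_mult_right) (rule has_bochner_integral_integrable[OF assms(2)])
  moreover have "(- r) ^ n * hm r = (-1) ^ n * (r ^ n * hm r)" for r
    by (simp only: power_minus[of r n] mult.assoc)
  ultimately show "has_bochner_integral half_line (\<lambda>r. (- r) ^ n * hm r) ((-1) ^ n * (LINT r|half_line. r ^ n * hm r))"
    by (simp only:)
qed

text \<open>The moments of order at least \<open>2\<close> are integrable at the origin because \<open>\<gamma> < 2\<close>, and at infinity by
tempering.\<close>

theorem tempered_cumulants:
  assumes rv: "gtgs_rv M X (gp, gm) (ap, am) (lp, lm) (tp, tm) (dp, dm) \<mu>" and t: "0 < tp" "0 < tm"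
  shows "integrable M (\<lambda>\<omega>. X \<omega> ^ n)"
    and "cumulant M X 1 = complex_of_real (large_jump_mean dens + \<mu>)"
    and "1 < n \<Longrightarrow> cumulant M X n =
       complex_of_real (dp * Gamma (real n - gp) / tp powr (real n - gp))
         * hyp_2R1 1 (complex_of_real (real n - gp)) 1 ap (complex_of_real (- (lp / tp powr ap)))
       + (-1) ^ n * complex_of_real (dm * Gamma (real n - gm) / tm powr (real n - gm))
         * hyp_2R1 1 (complex_of_real (real n - gm)) 1 am (complex_of_real (- (lm / tm powr am)))"
proof -
  interpret rv: levy_rv dens M X \<mu> by (rule levy_rvI[OF rv])
  have intp: "integrable half_line (\<lambda>r. r ^ k * hp r)" and intm: "integrable half_line (\<lambda>r. r ^ k * hm r)" if "2 \<le> k" for k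
    using that gp gm half_density_tempered_integrable[OF ap lp dp t(1), of gp k]
      half_density_tempered_integrable[OF am lm dm t(2), of gm k] by auto
  have moments: "integrable lborel (\<lambda>x. x ^ k * dens x)" if "2 \<le> k" for k
    using has_bochner_integral_moment[OF intp[OF that] intm[OF that]] by (rule integrable.intros)
  interpret sq: levy_density_square dens
    by (rule levy_density_squareI) (use moments[of 2] in simp)
  have mo: "levy_density_moments dens"
    by unfold_locales (rule moments)
  show "integrable M (\<lambda>\<omega>. X \<omega> ^ n)" by (rule rv.cumulants_X(1)[OF mo])
  show "cumulant M X 1 = complex_of_real (large_jump_mean dens + \<mu>)" by (rule rv.cumulants_X(2)[OF mo])
  assume n: "1 < n"
  then have "cumulant M X n = complex_of_real (LINT x|lborel. x ^ n * dens x)"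
    by (intro rv.cumulants_X(3)[OF mo]) simp
  also have "(LINT x|lborel. x ^ n * dens x) = (LINT r|half_line. r ^ n * hp r) + (-1) ^ n * (LINT r|half_line. r ^ n * hm r)"
    using n by (intro has_bochner_integral_integral_eq[OF has_bochner_integral_moment] intp intm) auto
  also have "complex_of_real \<dots> = complex_of_real (LINT r|half_line. r ^ n * hp r) + (-1) ^ n * complex_of_real (LINT r|half_line. r ^ n * hm r)"
    by (simp only: of_real_add of_real_mult of_real_power of_real_minus of_real_1)
  finally show "cumulant M X n =
       complex_of_real (dp * Gamma (real n - gp) / tp powr (real n - gp))
         * hyp_2R1 1 (complex_of_real (real n - gp)) 1 ap (complex_of_real (- (lp / tp powr ap)))
       + (-1) ^ n * complex_of_real (dm * Gamma (real n - gm) / tm powr (real n - gm))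
         * hyp_2R1 1 (complex_of_real (real n - gm)) 1 am (complex_of_real (- (lm / tm powr am)))"
    using n gp gm by (simp only: half_density_tempered_moment[OF ap lp dp t(1)] half_density_tempered_moment[OF am lm dm t(2)] mult.assoc)
qed

end

locale gtgs0_parameters = gtgs_parameters ap am lp lm 0 0 dp dm gp gm
  for ap am lp lm dp dm gp gm
begin

lemma large_integrable_iff:
  "integrable lborel (\<lambda>x. indicator {x. \<bar>x\<bar> > 1} x * (\<bar>x\<bar> * dens x)) \<longleftrightarrow> tail_moment gp ap dp 1 \<and> tail_moment gm am dm 1"
proof -
  have eq: "indicator {x. \<bar>x\<bar> > 1} x * (\<bar>x\<bar> * dens x) = (indicator {x. \<bar>x\<bar> > 1} x * \<bar>x\<bar>) * dens x" for x
    by simp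
  have half: "integrable half_line (\<lambda>r. (indicator {x. \<bar>x\<bar> > 1} r * \<bar>r\<bar>) * f r) \<longleftrightarrow> integrable half_line (\<lambda>r. indicator {1<..} r * (r ^ 1 * f r))" for f :: "real \<Rightarrow> real"
    by (rule Bochner_Integration.integrable_cong[OF refl]) (auto simp: indicator_def)
  have neg: "indicator {x. \<bar>x\<bar> > 1} (- r) * \<bar>- r\<bar> = (indicator {x. \<bar>x\<bar> > 1} r * \<bar>r\<bar> :: real)" for r :: real
    by (simp add: indicator_def)
  show ?thesis
    unfolding eq
    unfolding gtgs_density_two_sided integrable_two_sided_iff[of "\<lambda>x. indicator {x. \<bar>x\<bar> > 1} x * \<bar>x\<bar>"] neg half
    by (simp only: half_density_tail_integrable_iff[OF ap lp dp gp(1)] half_density_tail_integrable_iff[OF am lm dm gm(1)])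
qed

lemma square_integrable_iff:
  "integrable lborel (\<lambda>x. x\<^sup>2 * dens x) \<longleftrightarrow> tail_moment gp ap dp 2 \<and> tail_moment gm am dm 2"
  unfolding gtgs_density_two_sided integrable_two_sided_iff[of "\<lambda>x. x\<^sup>2"]
  by (simp only: power2_minus half_density_second_moment_integrable_iff[OF ap lp dp gp] half_density_second_moment_integrable_iff[OF am lm dm gm])

text \<open>Near the origin the density never obstructs a moment of the law; the conditions come from its tails, one on
each half-line.\<close>

theorem untempered_moments:
  assumes rv: "gtgs0_rv N Y (gp, gm) (ap, am) (lp, lm) (dp, dm) \<mu>"
  shows "integrable N Y \<longleftrightarrow> tail_moment gp ap dp 1 \<and> tail_moment gm am dm 1"
    and "integrable N (\<lambda>\<omega>. (Y \<omega>)\<^sup>2) \<longleftrightarrow> tail_moment gp ap dp 2 \<and> tail_moment gm am dm 2"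
    and "integrable N Y \<Longrightarrow> prob_space.expectation N Y = large_jump_mean dens + \<mu>"
    and "(0 < dp \<longrightarrow> ap + gp > 2) \<Longrightarrow> (0 < dm \<longrightarrow> am + gm > 2) \<Longrightarrow>
       prob_space.variance N Y = dp * ell (gp - 2) ap lp + dm * ell (gm - 2) am lm"
proof -
  interpret rv: levy_rv dens N Y \<mu> by (rule levy_rvI[OF rv[unfolded gtgs0_rv_def]])
  have mean: "levy_density_mean dens" if "integrable lborel (\<lambda>x. indicator {x. \<bar>x\<bar> > 1} x * (\<bar>x\<bar> * dens x))"
    using that by unfold_locales
  show "integrable N Y \<longleftrightarrow> tail_moment gp ap dp 1 \<and> tail_moment gm am dm 1"
    using rv.large_integrable_of_X rv.integrable_X_of_large_integrable[OF mean] unfolding large_integrable_iff by blast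
  show "integrable N (\<lambda>\<omega>. (Y \<omega>)\<^sup>2) \<longleftrightarrow> tail_moment gp ap dp 2 \<and> tail_moment gm am dm 2"
    using rv.square_integrable_of_X rv.variance_X(1)[OF levy_density_squareI] unfolding square_integrable_iff by blast
  show "prob_space.expectation N Y = large_jump_mean dens + \<mu>" if "integrable N Y"
    by (rule rv.expectation_X[OF mean[OF rv.large_integrable_of_X[OF that]] that])
  assume c: "0 < dp \<longrightarrow> ap + gp > 2" "0 < dm \<longrightarrow> am + gm > 2"
  have half: "has_bochner_integral half_line (\<lambda>r. r\<^sup>2 * half_density g a l 0 d r) (d * ell (g - 2) a l)"
    if "0 < a" "a \<le> 1" "0 < l" "0 \<le> d" "g < 2" "0 < d \<longrightarrow> a + g > 2" for g a l d
  proof (cases "d = 0")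
    case True
    then show ?thesis by (simp add: half_density_def has_bochner_integral_zero)
  next
    case False
    then show ?thesis using that by (intro half_density_second_moment) auto
  qed
  have "has_bochner_integral lborel (\<lambda>x. x\<^sup>2 * dens x) (dp * ell (gp - 2) ap lp + dm * ell (gm - 2) am lm)"
    unfolding gtgs_density_two_sided
    by (rule has_bochner_integral_two_sided)
       (simp_all only: power2_minus half[OF ap lp dp gp(2) c(1)] half[OF am lm dm gm(2) c(2)])
  then show "prob_space.variance N Y = dp * ell (gp - 2) ap lp + dm * ell (gm - 2) am lm"
    using rv.variance_X(2)[OF levy_density_squareI] by (simp only: has_bochner_integral_iff)
qed

end

theorem proposition2:
  fixes M :: "'a measure" and X :: "'a \<Rightarrow> real"
    and N :: "'b measure" and Y :: "'b \<Rightarrow> real"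
    and \<alpha>p \<alpha>m lp lm \<theta>p \<theta>m \<delta>p \<delta>m \<gamma>p \<gamma>m \<mu> :: real
  assumes "0 < \<alpha>p" "\<alpha>p \<le> 1" "0 < \<alpha>m" "\<alpha>m \<le> 1"
    and "0 < lp" "0 < lm"
    and "0 \<le> \<delta>p" "0 \<le> \<delta>m" "(\<delta>p, \<delta>m) \<noteq> (0, 0)"
    and "0 \<le> \<gamma>p" "\<gamma>p < 2" "0 \<le> \<gamma>m" "\<gamma>m < 2"
  shows
    "(gtgs_rv M X (\<gamma>p, \<gamma>m) (\<alpha>p, \<alpha>m) (lp, lm) (\<theta>p, \<theta>m) (\<delta>p, \<delta>m) \<mu> \<and>
        0 < \<theta>p \<and> 0 < \<theta>m \<and> \<gamma>p \<noteq> 1 \<and> \<gamma>m \<noteq> 1 \<longrightarrow>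
        (\<forall>n\<ge>1. integrable M (\<lambda>\<omega>. X \<omega> ^ n)) \<and>
        cumulant M X 1 = complex_of_real
          (large_jump_mean (gtgs_density (\<gamma>p, \<gamma>m) (\<alpha>p, \<alpha>m) (lp, lm) (\<theta>p, \<theta>m) (\<delta>p, \<delta>m)) + \<mu>) \<and>
        (\<forall>n>1. cumulant M X n =
           complex_of_real (\<delta>p * Gamma (real n - \<gamma>p) / \<theta>p powr (real n - \<gamma>p))
             * hyp_2R1 1 (complex_of_real (real n - \<gamma>p)) 1 \<alpha>p
                 (complex_of_real (- (lp / \<theta>p powr \<alpha>p)))
           + (-1) ^ n * complex_of_real (\<delta>m * Gamma (real n - \<gamma>m) / \<theta>m powr (real n - \<gamma>m))
             * hyp_2R1 1 (complex_of_real (real n - \<gamma>m)) 1 \<alpha>m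
                 (complex_of_real (- (lm / \<theta>m powr \<alpha>m)))))
     \<and>
     (gtgs0_rv N Y (\<gamma>p, \<gamma>m) (\<alpha>p, \<alpha>m) (lp, lm) (\<delta>p, \<delta>m) \<mu> \<longrightarrow>
        (0 < \<delta>p \<and> 0 < \<delta>m \<and> \<alpha>p < 1 \<and> \<alpha>m < 1 \<longrightarrow>
           (integrable N Y \<longleftrightarrow> min (\<alpha>p + \<gamma>p) (\<alpha>m + \<gamma>m) > 1) \<and>
           (integrable N (\<lambda>\<omega>. (Y \<omega>)\<^sup>2) \<longleftrightarrow> min (\<alpha>p + \<gamma>p) (\<alpha>m + \<gamma>m) > 2)) \<and>
        (integrable N Y \<longleftrightarrow> tail_moment \<gamma>p \<alpha>p \<delta>p 1 \<and> tail_moment \<gamma>m \<alpha>m \<delta>m 1) \<and>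
        (integrable N (\<lambda>\<omega>. (Y \<omega>)\<^sup>2) \<longleftrightarrow> tail_moment \<gamma>p \<alpha>p \<delta>p 2 \<and> tail_moment \<gamma>m \<alpha>m \<delta>m 2) \<and>
        (integrable N Y \<longrightarrow>
           prob_space.expectation N Y =
             large_jump_mean (gtgs_density (\<gamma>p, \<gamma>m) (\<alpha>p, \<alpha>m) (lp, lm) (0, 0) (\<delta>p, \<delta>m)) + \<mu>) \<and>
        ((0 < \<delta>p \<longrightarrow> \<alpha>p + \<gamma>p > 2) \<and> (0 < \<delta>m \<longrightarrow> \<alpha>m + \<gamma>m > 2) \<longrightarrow>
           prob_space.variance N Y =
             \<delta>p * ell (\<gamma>p - 2) \<alpha>p lp + \<delta>m * ell (\<gamma>m - 2) \<alpha>m lm))"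
proof (intro conjI impI; (elim conjE)?)
  assume rv: "gtgs_rv M X (\<gamma>p, \<gamma>m) (\<alpha>p, \<alpha>m) (lp, lm) (\<theta>p, \<theta>m) (\<delta>p, \<delta>m) \<mu>" and t: "0 < \<theta>p" "0 < \<theta>m"
  interpret gtgs_parameters \<alpha>p \<alpha>m lp lm \<theta>p \<theta>m \<delta>p \<delta>m \<gamma>p \<gamma>m
    using assms t by unfold_locales auto
  note c = tempered_cumulants[OF rv t]
  show "\<forall>n\<ge>1. integrable M (\<lambda>\<omega>. X \<omega> ^ n)" using c(1) by blast
  show "cumulant M X 1 = complex_of_real
          (large_jump_mean (gtgs_density (\<gamma>p, \<gamma>m) (\<alpha>p, \<alpha>m) (lp, lm) (\<theta>p, \<theta>m) (\<delta>p, \<delta>m)) + \<mu>)" by (rule c(2))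
  show "\<forall>n>1. cumulant M X n =
           complex_of_real (\<delta>p * Gamma (real n - \<gamma>p) / \<theta>p powr (real n - \<gamma>p))
             * hyp_2R1 1 (complex_of_real (real n - \<gamma>p)) 1 \<alpha>p
                 (complex_of_real (- (lp / \<theta>p powr \<alpha>p)))
           + (-1) ^ n * complex_of_real (\<delta>m * Gamma (real n - \<gamma>m) / \<theta>m powr (real n - \<gamma>m))
             * hyp_2R1 1 (complex_of_real (real n - \<gamma>m)) 1 \<alpha>m
                 (complex_of_real (- (lm / \<theta>m powr \<alpha>m)))"
    using c(3) by blast
next
  assume rv: "gtgs0_rv N Y (\<gamma>p, \<gamma>m) (\<alpha>p, \<alpha>m) (lp, lm) (\<delta>p, \<delta>m) \<mu>"
  interpret gtgs0_parameters \<alpha>p \<alpha>m lp lm \<delta>p \<delta>m \<gamma>p \<gamma>m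
    using assms by unfold_locales auto
  note u = untempered_moments[OF rv]
  show "integrable N Y \<longleftrightarrow> tail_moment \<gamma>p \<alpha>p \<delta>p 1 \<and> tail_moment \<gamma>m \<alpha>m \<delta>m 1" by (rule u(1))
  show "integrable N (\<lambda>\<omega>. (Y \<omega>)\<^sup>2) \<longleftrightarrow> tail_moment \<gamma>p \<alpha>p \<delta>p 2 \<and> tail_moment \<gamma>m \<alpha>m \<delta>m 2" by (rule u(2))
  show "prob_space.expectation N Y =
             large_jump_mean (gtgs_density (\<gamma>p, \<gamma>m) (\<alpha>p, \<alpha>m) (lp, lm) (0, 0) (\<delta>p, \<delta>m)) + \<mu>" if "integrable N Y"
    by (rule u(3)[OF that])
  show "prob_space.variance N Y = \<delta>p * ell (\<gamma>p - 2) \<alpha>p lp + \<delta>m * ell (\<gamma>m - 2) \<alpha>m lm"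
    if "0 < \<delta>p \<longrightarrow> \<alpha>p + \<gamma>p > 2" "0 < \<delta>m \<longrightarrow> \<alpha>m + \<gamma>m > 2"
    by (rule u(4)[OF that])
  assume pos: "0 < \<delta>p" "0 < \<delta>m" "\<alpha>p < 1" "\<alpha>m < 1"
  show "integrable N Y \<longleftrightarrow> min (\<alpha>p + \<gamma>p) (\<alpha>m + \<gamma>m) > 1" unfolding u(1) tail_moment_def using pos by auto
  show "integrable N (\<lambda>\<omega>. (Y \<omega>)\<^sup>2) \<longleftrightarrow> min (\<alpha>p + \<gamma>p) (\<alpha>m + \<gamma>m) > 2" unfolding u(2) tail_moment_def using pos by auto
qed

end
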